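(* Let $E$ be an affine space of dimension $n\ge2$ with a Lorentz norm $L$ on $A_\ast\subseteq\vec{E}\setminus0$, and let $V\in\mathfrak{X}^A(E)$ be the parallel (constant) vector field identifiable with a vector $v\in A_\ast$ with $L(v)=1$. Fix $p_0\in E$, let $\mathscr{R}=p_0+\{w\in\vec{E}\colon g_v(v,w)=0\}$, let $\overline{\Omega}\subseteq\mathscr{R}$ be a compact domain with $\partial\Omega\subseteq\mathscr{R}$ smooth up to a set of null $(n-2)$-dimensional measure (a regularity under which Stokes' theorem can be applied), with salient (outward) unit $(-g_v|_{\mathscr{R}})$-normal $\widehat{n}_V$, and let $t_0<t_1$. Identify $E\equiv\mathbb{R}\times\mathscr{R}$ by $p+tv\equiv(t,p)$. If $T\in\mathcal{T}^1_1(E_A)$ is such that $\mathrm{div}(T_V)=0$ and $X\in\mathfrak{X}(E_A)$ is such that $T^\flat_V(-,\nabla^V_{-}X)$ is antisymmetric, or $T^\flat_V$ is symmetric and $\mathfrak{L}_{X_V}(g_V)=0$, then $$0=\int_{\{t_1\}\times\Omega}T^\flat_V(V,X_V)\,d\sigma_V-\int_{\{t_0\}\times\Omega}T^\flat_V(V,X_V)\,d\sigma_V-\int_{]t_0,t_1[\times\partial\Omega}T^\flat_V(\widehat{n}_V,X_V)\,d\sigma_V,$$ where $d\sigma_V$ is identifiable with the volume form of $-g_v|_\Omega$ on $\{t_\mu\}\times\Omega$ ($\mu=0,1$) and coincides with the volume form of $g_v|_{]t_0,t_1[\times\partial\Omega}$ on $]t_0,t_1[\times\partial\Omega$.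
   Context: $E$ is a real affine space with associated vector space $\vec{E}$; $\mathrm{T}E\equiv E\times\vec{E}$. A Lorentz norm on an open conic subset $A_\ast\subseteq\vec{E}\setminus0$ (conic: closed under multiplication by positive reals) is a smooth positively $2$-homogeneous function $L\colon A_\ast\to(0,\infty)$ whose fundamental tensor $g_v(u,w)=\frac12\frac{\partial^2}{\partial s\partial t}L(v+su+tw)|_{s=t=0}$ is nondegenerate with signature $(+,-,\dots,-)$ for all $v\in A_\ast$; moreover $A_\ast$ is connected and salient, $L$ extends smoothly (with nondegenerate fundamental tensor) to the boundary of $A_\ast$ in $\vec E\setminus0$, and this boundary equals $L^{-1}(0)$. It is regarded as a Lorentz-Finsler metric on $A:=E\times A_\ast$ independent of the first factor. $\mathfrak{X}^A(E)$ denotes the vector fields $V$ on $E$ with values in $A$. $g_V$ is the constant Lorentzian metric $g_v$ on $E$ when $V\equiv v$. An anisotropic tensor field $T\in\mathcal{T}^r_s(E_A)$ assigns smoothly to each $(p,u)\in A$ an $r$-contravariant $s$-covariant tensor on $\vec{E}\equiv\mathrm{T}_pE$; $\mathfrak{X}(E_A)=\mathcal{T}^1_0(E_A)$. $T_V$ is the ordinary tensor field $p\mapsto T_{V_p}$. $T\in\mathcal{T}^1_1(E_A)$ is regarded as an endomorphism, and $T^\flat(Y,W)=g(Y,T(W))$, so $T_V^\flat(Y,W)=g_v(Y,T_V(W))$. The metric nonlinear connection and the Chern anisotropic connection $\nabla$ of $L$ coincide with the canonical flat connection of $E$: in affine coordinates all Christoffel symbols and nonlinear coefficients vanish, so for $V$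 constant $\nabla^V_YX$ is the ordinary directional derivative of the vector field $X_V$ along $Y$. $\mathrm{div}(T_V)$ is the one-form $\partial_i(T_V)^i_j\,dx^j$ in affine coordinates, and $\mathfrak{L}$ is the ordinary Lie derivative. A domain $\overline{\Omega}$ of $\mathscr{R}$ is a nonempty connected set coinciding with the closure of its interior $\Omega$ in $\mathscr R$. A set has null $m$-dimensional measure if its intersection with any embedded $m$-dimensional submanifold $\sigma$ has measure $0$ in $\sigma$. That Stokes' theorem can be applied on $\overline\Omega$ means $\int_\Omega d\eta=\int_{\partial\Omega}\eta$ for every smooth $(n-2)$-form $\eta$ on $\mathscr{R}$, the right-hand integral being over the smooth part of $\partial\Omega$ with its induced orientation. Integrals against $d\sigma_V$ are integrals with respect to the indicated (positive) pseudo-Riemannian hypersurface volumes; the metric $-g_v|_{\mathscr R}$ is Euclidean. $\widehat n_V$ is extended to $]t_0,t_1[\times\partial\Omega$ independently of $t$. *)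

theory Defs
  imports "HOL-Analysis.Analysis" "Jordan_Normal_Form.Determinant"
begin

text \<open>
  The affine space is modelled by a type \<open>'a::euclidean_space\<close>, which serves both as the space of
  points and as the space of vectors (an origin is chosen). The inner product of the type only
  supplies the topology, the notion of derivative, and one fixed system of affine coordinates.
\<close>

subsection \<open>Smooth maps on open sets\<close>

primrec Ck_on :: "nat \<Rightarrow> 'a::euclidean_space set \<Rightarrow> ('a \<Rightarrow> 'b::real_normed_vector) \<Rightarrow> bool" where
  "Ck_on 0 = (\<lambda>S f. continuous_on S f)"
| "Ck_on (Suc k) = (\<lambda>S f. (\<forall>x\<in>S. f differentiable (at x)) \<and>
      (\<forall>w. Ck_on k S (\<lambda>x. frechet_derivative f (at x) w)))"

definition smooth_on :: "'a::euclidean_space set \<Rightarrow> ('a \<Rightarrow> 'b::real_normed_vector) \<Rightarrow> bool" where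
  "smooth_on S f \<longleftrightarrow> (\<forall>k. Ck_on k S f)"

subsection \<open>Lorentz norms\<close>

definition fund_tensor :: "('a::euclidean_space \<Rightarrow> real) \<Rightarrow> 'a \<Rightarrow> 'a \<Rightarrow> 'a \<Rightarrow> real" where
  "fund_tensor L v u w =
     (1/2) * deriv (\<lambda>s. deriv (\<lambda>t. L (v + s *\<^sub>R u + t *\<^sub>R w)) 0) 0"

definition nondegenerate_form :: "('a::euclidean_space \<Rightarrow> 'a \<Rightarrow> real) \<Rightarrow> bool" where
  "nondegenerate_form b \<longleftrightarrow> (\<forall>u. (\<forall>w. b u w = 0) \<longrightarrow> u = 0)"

text \<open>A scalar product of signature \<open>(+,-,\<dots>,-)\<close>, by means of a diagonalizing basis.\<close>

definition lorentzian_form :: "('a::euclidean_space \<Rightarrow> 'a \<Rightarrow> real) \<Rightarrow> bool" where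
  "lorentzian_form b \<longleftrightarrow> bilinear b \<and> (\<forall>u w. b u w = b w u) \<and>
     (\<exists>B e. independent B \<and> span B = UNIV \<and> e \<in> B \<and> b e e > 0 \<and>
        (\<forall>x\<in>B - {e}. b x x < 0) \<and> (\<forall>x\<in>B. \<forall>y\<in>B. x \<noteq> y \<longrightarrow> b x y = 0))"

text \<open>
  The function \<open>L\<close> is total, but only its values on \<open>A\<close> matter. The function \<open>L'\<close> is the smooth
  extension to the boundary of \<open>A\<close> in the complement of the origin; a smooth function on a
  set with boundary is one that extends smoothly to an open neighbourhood.
\<close>

definition lorentz_norm :: "'a::euclidean_space set \<Rightarrow> ('a \<Rightarrow> real) \<Rightarrow> bool" where
  "lorentz_norm A L \<longleftrightarrow>
     open A \<and> A \<noteq> {} \<and> 0 \<notin> A \<and> (\<forall>x\<in>A. \<forall>c>0. c *\<^sub>R x \<in> A) \<and>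
     connected A \<and> (\<forall>x\<in>A. - x \<notin> A) \<and>
     smooth_on A L \<and> (\<forall>x\<in>A. L x > 0) \<and> (\<forall>x\<in>A. \<forall>c>0. L (c *\<^sub>R x) = c\<^sup>2 * L x) \<and>
     (\<forall>x\<in>A. lorentzian_form (fund_tensor L x)) \<and>
     (\<exists>U L'. open U \<and> closure A - {0} \<subseteq> U \<and> smooth_on U L' \<and> (\<forall>x\<in>A. L' x = L x) \<and>
        (\<forall>x\<in>closure A - {0}. nondegenerate_form (fund_tensor L' x)) \<and>
        frontier A - {0} = {x \<in> closure A - {0}. L' x = 0})"

subsection \<open>Anisotropic tensor fields evaluated along a vector field\<close>

text \<open>
  An anisotropic vector field is a smooth map \<open>X\<close> and an anisotropic \<open>(1,1)\<close>-tensor field a smooth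
  map \<open>T\<close> into the endomorphisms, both defined on pairs (point, direction).
\<close>

definition along :: "('a \<times> 'a \<Rightarrow> 'b) \<Rightarrow> ('a \<Rightarrow> 'a) \<Rightarrow> 'a \<Rightarrow> 'b" where
  "along F V = (\<lambda>p. F (p, V p))"

definition metric_along ::
    "('a::euclidean_space \<Rightarrow> real) \<Rightarrow> ('a \<Rightarrow> 'a) \<Rightarrow> 'a \<Rightarrow> 'a \<Rightarrow> 'a \<Rightarrow> real" where
  "metric_along L V = (\<lambda>p. fund_tensor L (V p))"

definition flat_along ::
    "('a::euclidean_space \<Rightarrow> real) \<Rightarrow> ('a \<times> 'a \<Rightarrow> ('a \<Rightarrow>\<^sub>L 'a)) \<Rightarrow> ('a \<Rightarrow> 'a)
       \<Rightarrow> 'a \<Rightarrow> 'a \<Rightarrow> 'a \<Rightarrow> real" where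
  "flat_along L T V p y w = metric_along L V p y (blinfun_apply (along T V p) w)"

text \<open>
  \<open>(\<nabla>\<^sup>V\<^sub>y X)\<^sub>p\<close> for constant \<open>V\<close>: the Chern connection of a Lorentz norm is the flat one, so this is
  the directional derivative of \<open>X\<^sub>V\<close>. The formula is not meant for non-constant \<open>V\<close>.
\<close>

definition nabla_along ::
    "('a::euclidean_space \<times> 'a \<Rightarrow> 'a) \<Rightarrow> ('a \<Rightarrow> 'a) \<Rightarrow> 'a \<Rightarrow> 'a \<Rightarrow> 'a" where
  "nabla_along X V p y = frechet_derivative (along X V) (at p) y"

text \<open>The one-form \<open>\<partial>\<^sub>i F\<^sup>i\<^sub>j dx\<^sup>j\<close> at \<open>p\<close>, applied to the vector \<open>w\<close>.\<close>

definition div_tensor :: "('a::euclidean_space \<Rightarrow> ('a \<Rightarrow>\<^sub>L 'a)) \<Rightarrow> 'a \<Rightarrow> 'a \<Rightarrow> real" where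
  "div_tensor F p w =
     (\<Sum>b\<in>Basis. frechet_derivative (\<lambda>q. blinfun_apply (F q) w) (at p) b \<bullet> b)"

definition lie_bracket ::
    "('a::euclidean_space \<Rightarrow> 'a) \<Rightarrow> ('a \<Rightarrow> 'a) \<Rightarrow> 'a \<Rightarrow> 'a" where
  "lie_bracket X Y p =
     frechet_derivative Y (at p) (X p) - frechet_derivative X (at p) (Y p)"

definition lie_derivative ::
    "('a::euclidean_space \<Rightarrow> 'a) \<Rightarrow> ('a \<Rightarrow> 'a \<Rightarrow> 'a \<Rightarrow> real)
       \<Rightarrow> ('a \<Rightarrow> 'a) \<Rightarrow> ('a \<Rightarrow> 'a) \<Rightarrow> 'a \<Rightarrow> real" where
  "lie_derivative X h Y W p =
     frechet_derivative (\<lambda>q. h q (Y q) (W q)) (at p) (X p)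
       - h p (lie_bracket X Y p) (W p) - h p (Y p) (lie_bracket X W p)"

subsection \<open>Embedded submanifolds and their pseudo-Riemannian volume\<close>

text \<open>
  A slice chart of \<open>S\<close> is a diffeomorphism \<open>\<phi>\<close> between open sets \<open>U\<close> and \<open>\<phi> ` U\<close> that maps the part
  of \<open>U\<close> in the \<open>m\<close>-dimensional subspace spanned by \<open>e 0, \<dots>, e (m - 1)\<close> onto \<open>S \<inter> \<phi> ` U\<close>.
  The vectors \<open>e i\<close> turn this subspace into a copy of \<open>\<real>\<^sup>m\<close>, so that \<open>\<phi> \<circ> slice_par m e\<close> is a local
  parametrization of \<open>S\<close>. Points of \<open>\<real>\<^sup>m\<close> are (extensional) functions on \<open>{..<m}\<close>.
\<close>

definition slice_chart ::
    "nat \<Rightarrow> 'a::euclidean_space set \<Rightarrow> (nat \<Rightarrow> 'a) \<Rightarrow> 'a set \<Rightarrow> ('a \<Rightarrow> 'a) \<Rightarrow> bool" where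
  "slice_chart m S e U \<phi> \<longleftrightarrow>
     inj_on e {..<m} \<and> independent (e ` {..<m}) \<and>
     open U \<and> smooth_on U \<phi> \<and> inj_on \<phi> U \<and> open (\<phi> ` U) \<and> smooth_on (\<phi> ` U) (inv_into U \<phi>) \<and>
     \<phi> ` (U \<inter> span (e ` {..<m})) = S \<inter> \<phi> ` U"

definition slice_par :: "nat \<Rightarrow> (nat \<Rightarrow> 'a::euclidean_space) \<Rightarrow> (nat \<Rightarrow> real) \<Rightarrow> 'a" where
  "slice_par m e x = (\<Sum>i<m. x i *\<^sub>R e i)"

definition smooth_part :: "nat \<Rightarrow> 'a::euclidean_space set \<Rightarrow> 'a set" where
  "smooth_part m S = {p \<in> S. \<exists>e U \<phi>. slice_chart m S e U \<phi> \<and> p \<in> \<phi> ` U}"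

definition embedded_submanifold :: "nat \<Rightarrow> 'a::euclidean_space set \<Rightarrow> bool" where
  "embedded_submanifold m S \<longleftrightarrow> smooth_part m S = S"

definition tangent_space :: "nat \<Rightarrow> 'a::euclidean_space set \<Rightarrow> 'a \<Rightarrow> 'a set" where
  "tangent_space m S p =
     {w. \<exists>e U \<phi> x u. slice_chart m S e U \<phi> \<and> x \<in> U \<inter> span (e ` {..<m}) \<and> \<phi> x = p \<and>
           u \<in> span (e ` {..<m}) \<and> w = frechet_derivative \<phi> (at x) u}"

definition volume_density ::
    "('a::euclidean_space \<Rightarrow> 'a \<Rightarrow> 'a \<Rightarrow> real) \<Rightarrow> nat \<Rightarrow> (nat \<Rightarrow> 'a) \<Rightarrow> ('a \<Rightarrow> 'a) \<Rightarrow> 'a \<Rightarrow> real" where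
  "volume_density h m e \<phi> y =
     sqrt \<bar>Determinant.det (Matrix.mat m m (\<lambda>(i, j).
        h (\<phi> y) (frechet_derivative \<phi> (at y) (e i)) (frechet_derivative \<phi> (at y) (e j))))\<bar>"

text \<open>
  \<open>\<mu>\<close> is the volume measure that the (pseudo-Riemannian) metric \<open>h\<close> induces on the
  \<open>m\<close>-dimensional embedded submanifold \<open>S\<close>: in every local parametrization its density with
  respect to Lebesgue measure is \<open>sqrt \<bar>det h\<^sub>i\<^sub>j\<bar>\<close>. This determines \<open>\<mu>\<close>, which always exists by the
  change of variables formula. For \<open>m = 0\<close> it is the counting measure.
\<close>

definition volume_measure ::
    "('a::euclidean_space \<Rightarrow> 'a \<Rightarrow> 'a \<Rightarrow> real) \<Rightarrow> nat \<Rightarrow> 'a set \<Rightarrow> 'a measure \<Rightarrow> bool" where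
  "volume_measure h m S \<mu> \<longleftrightarrow>
     sets \<mu> = sets (restrict_space borel S) \<and>
     (\<forall>e U \<phi> B. slice_chart m S e U \<phi> \<longrightarrow> B \<in> sets borel \<longrightarrow> B \<subseteq> S \<inter> \<phi> ` U \<longrightarrow>
        emeasure \<mu> B =
          (\<integral>\<^sup>+ x. indicator {x. slice_par m e x \<in> U \<and> \<phi> (slice_par m e x) \<in> B} x *
                 ennreal (volume_density h m e \<phi> (slice_par m e x))
             \<partial>Pi\<^sub>M {..<m} (\<lambda>_. lborel)))"

text \<open>\<open>N\<close> has null \<open>m\<close>-dimensional measure in \<open>R\<close>.\<close>

definition null_dim_measure :: "'a::euclidean_space set \<Rightarrow> nat \<Rightarrow> 'a set \<Rightarrow> bool" where
  "null_dim_measure R m N \<longleftrightarrow>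
     (\<forall>\<sigma>. embedded_submanifold m \<sigma> \<longrightarrow> \<sigma> \<subseteq> R \<longrightarrow>
        (\<forall>e U \<phi>. slice_chart m \<sigma> e U \<phi> \<longrightarrow>
           (AE x in Pi\<^sub>M {..<m} (\<lambda>_. lborel).
              slice_par m e x \<in> U \<longrightarrow> \<phi> (slice_par m e x) \<notin> N)))"

subsection \<open>Differential forms\<close>

definition alternating_form :: "nat \<Rightarrow> ('a::euclidean_space list \<Rightarrow> real) \<Rightarrow> bool" where
  "alternating_form k \<omega> \<longleftrightarrow>
     (\<forall>ws. length ws = k \<longrightarrow>
        (\<forall>i<k. linear (\<lambda>x. \<omega> (ws[i := x]))) \<and>
        (\<forall>i j. i < j \<longrightarrow> j < k \<longrightarrow> ws ! i = ws ! j \<longrightarrow> \<omega> ws = 0))"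

definition smooth_form :: "nat \<Rightarrow> ('a::euclidean_space \<Rightarrow> 'a list \<Rightarrow> real) \<Rightarrow> bool" where
  "smooth_form k \<eta> \<longleftrightarrow>
     (\<forall>p. alternating_form k (\<eta> p)) \<and> (\<forall>ws. length ws = k \<longrightarrow> smooth_on UNIV (\<lambda>p. \<eta> p ws))"

text \<open>The terms with brackets of the invariant formula vanish for constant vector fields \<open>ws\<close>.\<close>

definition ext_deriv ::
    "('a::euclidean_space \<Rightarrow> 'a list \<Rightarrow> real) \<Rightarrow> 'a \<Rightarrow> 'a list \<Rightarrow> real" where
  "ext_deriv \<eta> p ws =
     (\<Sum>i<length ws.
        (-1) ^ i * frechet_derivative (\<lambda>q. \<eta> q (take i ws @ drop (Suc i) ws)) (at p) (ws ! i))"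

definition orthonormal_basis :: "('a::euclidean_space \<Rightarrow> 'a \<Rightarrow> real) \<Rightarrow> 'a set \<Rightarrow> 'a list \<Rightarrow> bool" where
  "orthonormal_basis b W fs \<longleftrightarrow>
     span (set fs) = W \<and>
     (\<forall>i<length fs. \<forall>j<length fs. b (fs ! i) (fs ! j) = (if i = j then 1 else 0))"

text \<open>
  An orientation of an \<open>m\<close>-dimensional space \<open>W\<close> is given by a non-zero alternating \<open>m\<close>-form on it
  (\<open>ori\<close>), a basis being positive if \<open>ori\<close> is. If \<open>b\<close> is positive definite on \<open>W\<close>, the following is the
  factor \<open>c\<close> such that the \<open>m\<close>-form \<open>\<omega>\<close> is \<open>c\<close> times the oriented volume form of \<open>b\<close>; it does not
  depend on the choice of the basis. With this convention the sign of an oriented point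
  (\<open>m = 0\<close>) is covered as well.
\<close>

definition form_coefficient ::
    "('a::euclidean_space \<Rightarrow> 'a \<Rightarrow> real) \<Rightarrow> 'a set \<Rightarrow> ('a list \<Rightarrow> real) \<Rightarrow> ('a list \<Rightarrow> real) \<Rightarrow> real" where
  "form_coefficient b W ori \<omega> =
     (let fs = (SOME fs. orthonormal_basis b W fs) in sgn (ori fs) * \<omega> fs)"

text \<open>
  The integral of the \<open>m\<close>-form \<open>\<omega>\<close> over the \<open>m\<close>-dimensional submanifold \<open>S\<close> oriented by \<open>ori\<close>
  exists and equals \<open>I\<close>. Here \<open>h\<close> is any metric that is positive definite on \<open>S\<close>.
\<close>

definition has_form_integral ::
    "('a::euclidean_space \<Rightarrow> 'a \<Rightarrow> 'a \<Rightarrow> real) \<Rightarrow> nat \<Rightarrow> 'a set \<Rightarrow> ('a \<Rightarrow> 'a list \<Rightarrow> real)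
       \<Rightarrow> ('a \<Rightarrow> 'a list \<Rightarrow> real) \<Rightarrow> real \<Rightarrow> bool" where
  "has_form_integral h m S ori \<omega> I \<longleftrightarrow>
     (\<exists>\<mu>. volume_measure h m S \<mu> \<and>
          has_bochner_integral \<mu>
            (\<lambda>p. form_coefficient (h p) (tangent_space m S p) (ori p) (\<omega> p)) I)"

subsection \<open>Domains in a hyperplane\<close>

definition is_domain :: "'a::euclidean_space set \<Rightarrow> 'a set \<Rightarrow> bool" where
  "is_domain R D \<longleftrightarrow> D \<subseteq> R \<and> D \<noteq> {} \<and> connected D \<and>
     D = (top_of_set R) closure_of ((top_of_set R) interior_of D)"

text \<open>
  \<open>\<nu>\<close> is the outward unit normal, with respect to the metric \<open>h\<close> (positive definite on the
  vectors \<open>W\<close> tangent to the ambient hyperplane), of the domain \<open>D\<close> at the point \<open>p\<close> of the smooth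
  part \<open>S\<close> of its boundary, \<open>dim S = m\<close>.
\<close>

definition outward_unit_normal ::
    "('a::euclidean_space \<Rightarrow> 'a \<Rightarrow> 'a \<Rightarrow> real) \<Rightarrow> 'a set \<Rightarrow> 'a set \<Rightarrow> nat \<Rightarrow> 'a set \<Rightarrow> 'a \<Rightarrow> 'a \<Rightarrow> bool"
  where
  "outward_unit_normal h W D m S p \<nu> \<longleftrightarrow>
     \<nu> \<in> W \<and> h p \<nu> \<nu> = 1 \<and> (\<forall>w\<in>tangent_space m S p. h p \<nu> w = 0) \<and>
     (\<forall>\<^sub>F s in at_right 0. p + s *\<^sub>R \<nu> \<notin> D)"

text \<open>
  Stokes' theorem holds on a domain with interior \<open>\<Omega>\<close> in an oriented hyperplane of dimension
  \<open>Suc m\<close> with vector space \<open>W\<close>; \<open>S\<close> is the smooth part of the boundary and \<open>\<nu>\<close> its outward normal,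
  which is put first for the induced orientation. Every smooth form on the hyperplane is
  the restriction of a smooth form \<open>\<eta>\<close> on the whole space (pull back along an affine projection);
  only this restriction enters below.
\<close>

definition stokes_applies ::
    "('a::euclidean_space \<Rightarrow> 'a \<Rightarrow> 'a \<Rightarrow> real) \<Rightarrow> nat \<Rightarrow> ('a list \<Rightarrow> real) \<Rightarrow> 'a set \<Rightarrow> 'a set
       \<Rightarrow> ('a \<Rightarrow> 'a) \<Rightarrow> bool" where
  "stokes_applies h m ori \<Omega> S \<nu> \<longleftrightarrow>
     (\<forall>\<eta>. smooth_form m \<eta> \<longrightarrow>
        (\<exists>I. has_form_integral h (Suc m) \<Omega> (\<lambda>p. ori) (ext_deriv \<eta>) I \<and>
             has_form_integral h m S (\<lambda>p fs. ori (\<nu> p # fs)) \<eta> I))"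

text \<open>The set \<open>J \<times> S\<close> under the identification of \<open>(t, p)\<close> with \<open>p + t v\<close>.\<close>

definition cylinder :: "'a::euclidean_space \<Rightarrow> real set \<Rightarrow> 'a set \<Rightarrow> 'a set" where
  "cylinder v J S = {p + t *\<^sub>R v | t p. t \<in> J \<and> p \<in> S}"

end

theory Submission
  imports Defs
begin

text \<open>
  The hypotheses on \<open>T\<close> and \<open>X\<close> make the vector field \<open>Y = T\<^sub>V X\<^sub>V\<close> divergence free. Split \<open>Y = a v + Z\<close> with \<open>Z\<close>
  tangent to the hyperplane, so that \<open>\<partial>\<^sub>t a = - div Z\<close> on every slice. Stokes' theorem, applied at each time \<open>t\<close>
  to the contraction of \<open>ori\<close> with the translated field \<open>Z (\<cdot> + t v)\<close>, turns the integral of \<open>div Z\<close> over \<open>\<Omega>\<close> into a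
  flux through \<open>S\<close>; integrating over \<open>t\<close> gives the balance by Fubini's theorem, since the volume of the lateral
  boundary is the product of the volume of \<open>S\<close> with \<open>dt\<close>. Stokes' theorem for the position field and for
  constant fields shows that \<open>\<Omega>\<close> and \<open>S\<close> have finite volume, whence all integrability claims.
\<close>

subsection \<open>Smooth maps and the inverse function theorem\<close>

text \<open>\<open>Y\<close> is divergence free because its divergence is \<open>div T\<close>
  applied to \<open>X\<close> plus the trace of \<open>T\<close> composed with the derivative of
  \<open>X\<close>, and this composition is either \<open>g\<close>-antisymmetric or the product of
  a \<open>g\<close>-symmetric and a \<open>g\<close>-antisymmetric endomorphism. The main obstacle
  is the measures: \<open>volume_measure\<close> prescribes them chart by chart, so each relation
  between them has to be checked in charts. For the lateral boundary a chart of the cylinder is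
  built from one of \<open>S\<close>, which calls for an inverse function theorem with a smooth
  inverse. As \<open>v\<close> is a \<open>g\<close>-unit vector orthogonal to the hyperplane, it
  borders the Gram matrix without changing the absolute value of its determinant; hence the product
  with \<open>dt\<close>. Stokes' theorem comes with measures of its own, which uniqueness
  identifies. Since \<open>\<nu>\<close> is an arbitrary function, its measurability also has to
  come from Stokes' theorem: constant fields along an orthonormal basis make its components
  integrable. Their squares add up to 1, so the sum of their absolute values dominates 1, which
  bounds the volume of \<open>S\<close>. The form \<open>ori\<close> is not normalized; it
  contributes a constant \<open>c0\<close> to both sides of Stokes' theorem, which cancels.\<close>

lemma Ck_on_SucD:
  assumes "Ck_on (Suc k) S f" "x \<in> S"
  shows "(f has_derivative frechet_derivative f (at x)) (at x)"
  using assms by (simp add: frechet_derivative_works)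

lemma Ck_on_Suc_imp_Ck_on: "Ck_on (Suc k) S f \<Longrightarrow> Ck_on k S f"
proof (induction k arbitrary: f)
  case 0
  then show ?case
    by (auto intro!: continuous_at_imp_continuous_on differentiable_imp_continuous_within)
next
  case (Suc k)
  then show ?case
    by (metis Ck_on.simps(2))
qed

lemma Ck_on_imp_continuous_on: "Ck_on k S f \<Longrightarrow> continuous_on S f"
  by (induction k) (simp, use Ck_on_Suc_imp_Ck_on in blast)

lemma Ck_on_subset: "Ck_on k S f \<Longrightarrow> S' \<subseteq> S \<Longrightarrow> Ck_on k S' f"
  by (induction k arbitrary: f) (auto intro: continuous_on_subset)

lemma Ck_on_cong:
  assumes "open S" "\<And>x. x \<in> S \<Longrightarrow> f x = g x" "Ck_on k S f"
  shows "Ck_on k S g"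
  using assms(2,3)
proof (induction k arbitrary: f g)
  case 0
  then show ?case by (metis Ck_on.simps(1) continuous_on_cong)
next
  case (Suc k)
  have d: "f differentiable (at x)" if "x \<in> S" for x
    using Suc.prems that by simp
  have "g differentiable (at x)" if x: "x \<in> S" for x
  proof -
    obtain f' where "(f has_derivative f') (at x)" using d[OF x] unfolding differentiable_def by blast
    then have "(g has_derivative f') (at x)"
      by (rule has_derivative_transform_within_open[OF _ \<open>open S\<close> x Suc.prems(1)])
    then show ?thesis unfolding differentiable_def by blast
  qed
  moreover have eq: "frechet_derivative f (at x) = frechet_derivative g (at x)" if "x \<in> S" for x
    using frechet_derivative_transform_within_open[OF d[OF that] \<open>open S\<close> that] Suc.prems(1) by blast
  have "Ck_on k S (\<lambda>x. frechet_derivative g (at x) w)" for w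
  proof (rule Suc.IH)
    show "Ck_on k S (\<lambda>x. frechet_derivative f (at x) w)" using Suc.prems(2) by simp
  qed (simp add: eq)
  ultimately show ?case by simp
qed

text \<open>\<open>frechet_derivative\<close> is a choice operator. Smoothness proofs exhibit an
  explicit derivative instead, and uniqueness of derivatives identifies the two.\<close>

lemma Ck_on_SucI:
  assumes "open S" and f': "\<And>x. x \<in> S \<Longrightarrow> (f has_derivative f' x) (at x)"
    and "\<And>w. Ck_on k S (\<lambda>x. f' x w)"
  shows "Ck_on (Suc k) S f"
proof -
  have "f' x = frechet_derivative f (at x)" if "x \<in> S" for x
    using frechet_derivative_at f'[OF that] by blast
  then have "Ck_on k S (\<lambda>x. frechet_derivative f (at x) w)" for w
    using assms by (intro Ck_on_cong[OF \<open>open S\<close> _ assms(3)]) simp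
  then show ?thesis
    using f' by (auto simp: differentiable_def)
qed

lemma Ck_on_const: "open S \<Longrightarrow> Ck_on k S (\<lambda>x. c)"
proof (induction k arbitrary: c)
  case (Suc k)
  show ?case
    by (rule Ck_on_SucI[where f' = "\<lambda>x w. 0"]) (use Suc in \<open>auto intro!: derivative_eq_intros\<close>)
qed simp

lemma Ck_on_bounded_linear:
  assumes "bounded_linear l" "open S"
  shows "Ck_on k S f \<Longrightarrow> Ck_on k S (\<lambda>x. l (f x))"
proof (induction k arbitrary: f)
  case 0
  then show ?case using assms by (simp add: bounded_linear.continuous_on)
next
  case (Suc k)
  show ?case
    by (rule Ck_on_SucI[OF \<open>open S\<close> bounded_linear.has_derivative[OF assms(1) Ck_on_SucD[OF Suc.prems]]])
       (use Suc in auto)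
qed

lemma Ck_on_add:
  assumes "open S"
  shows "Ck_on k S f \<Longrightarrow> Ck_on k S g \<Longrightarrow> Ck_on k S (\<lambda>x. f x + g x)"
proof (induction k arbitrary: f g)
  case 0
  then show ?case by (simp add: continuous_on_add)
next
  case (Suc k)
  show ?case
    by (rule Ck_on_SucI[OF \<open>open S\<close> has_derivative_add[OF Ck_on_SucD[OF Suc.prems(1)] Ck_on_SucD[OF Suc.prems(2)]]])
       (use Suc in auto)
qed

lemma Ck_on_sum:
  assumes "open S"
  shows "(\<And>i. i \<in> I \<Longrightarrow> Ck_on k S (f i)) \<Longrightarrow> Ck_on k S (\<lambda>x. \<Sum>i\<in>I. f i x)"
  by (induction I rule: infinite_finite_induct) (auto intro: Ck_on_const Ck_on_add assms)

lemma (in bounded_bilinear) Ck_on_prod: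
  assumes "open S"
  shows "Ck_on k S f \<Longrightarrow> Ck_on k S g \<Longrightarrow> Ck_on k S (\<lambda>x. prod (f x) (g x))"
proof (induction k arbitrary: f g)
  case 0
  then show ?case by (simp add: continuous_on)
next
  case (Suc k)
  have "Ck_on k S f" "Ck_on k S g"
    using Suc.prems Ck_on_Suc_imp_Ck_on by blast+
  then show ?case
    by (intro Ck_on_SucI[OF \<open>open S\<close> FDERIV[OF Ck_on_SucD[OF Suc.prems(1)] Ck_on_SucD[OF Suc.prems(2)]]]
        Ck_on_add[OF \<open>open S\<close>] Suc.IH) (use Suc.prems in auto)
qed

lemma linear_sum_Basis:
  fixes l :: "'a::euclidean_space \<Rightarrow> 'b::real_vector"
  assumes "linear l"
  shows "l x = (\<Sum>b\<in>Basis. inner x b *\<^sub>R l b)"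
  by (subst euclidean_representation[symmetric]) (simp add: linear_sum[OF assms] linear_scale[OF assms])

lemma Ck_on_compose:
  fixes f :: "'b::euclidean_space \<Rightarrow> 'c::real_normed_vector" and g :: "'a::euclidean_space \<Rightarrow> 'b"
  assumes "open S" "g ` S \<subseteq> S'"
  shows "Ck_on k S' f \<Longrightarrow> Ck_on k S g \<Longrightarrow> Ck_on k S (\<lambda>x. f (g x))"
proof (induction k arbitrary: f)
  case 0
  then show ?case using continuous_on_compose2[of S' f S g] assms by simp
next
  case (Suc k)
  let ?f = "\<lambda>x. frechet_derivative f (at (g x))" and ?g = "\<lambda>x. frechet_derivative g (at x)"
  have g: "Ck_on k S g" using Suc.prems Ck_on_Suc_imp_Ck_on by blast
  have f': "(f has_derivative ?f x) (at (g x))" if "x \<in> S" for x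
    using Ck_on_SucD[OF Suc.prems(1)] that assms by blast
  show ?case
  proof (rule Ck_on_SucI[OF \<open>open S\<close>])
    fix x assume "x \<in> S"
    show "((\<lambda>x. f (g x)) has_derivative (\<lambda>w. ?f x (?g x w))) (at x)"
      using has_derivative_compose[OF Ck_on_SucD[OF Suc.prems(2) \<open>x \<in> S\<close>] f'[OF \<open>x \<in> S\<close>]] .
  next
    fix w
    \<comment> \<open>In the chain rule the direction fed to the derivative of \<open>f\<close>
      varies with \<open>x\<close>, while \<open>Ck_on\<close> speaks of fixed directions. Expanding
      in \<open>Basis\<close> leaves only fixed ones.\<close>
    have "Ck_on k S (\<lambda>x. \<Sum>b\<in>Basis. inner (?g x w) b *\<^sub>R ?f x b)"
      using Suc.prems g \<open>open S\<close>
      by (intro Ck_on_sum bounded_bilinear.Ck_on_prod[OF bounded_bilinear_scaleR]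
          Ck_on_bounded_linear[OF bounded_linear_inner_left] Suc.IH) auto
    moreover have "?f x (?g x w) = (\<Sum>b\<in>Basis. inner (?g x w) b *\<^sub>R ?f x b)" if "x \<in> S" for x
      using linear_sum_Basis has_derivative_linear[OF f'[OF that]] by blast
    ultimately show "Ck_on k S (\<lambda>x. ?f x (?g x w))"
      using Ck_on_cong[OF \<open>open S\<close>] by (metis (no_types, lifting))
  qed
qed

lemma smooth_on_imp_continuous_on: "smooth_on S f \<Longrightarrow> continuous_on S f"
  unfolding smooth_on_def using Ck_on_imp_continuous_on by blast

lemma smooth_on_derivative:
  assumes "smooth_on S f"
  shows "x \<in> S \<Longrightarrow> (f has_derivative frechet_derivative f (at x)) (at x)"
    and "smooth_on S (\<lambda>x. frechet_derivative f (at x) w)"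
proof -
  have *: "Ck_on (Suc k) S f" for k using assms smooth_on_def by blast
  show "x \<in> S \<Longrightarrow> (f has_derivative frechet_derivative f (at x)) (at x)"
    using Ck_on_SucD[OF *] .
  show "smooth_on S (\<lambda>x. frechet_derivative f (at x) w)"
    using * unfolding smooth_on_def by simp
qed

lemma smooth_on_subset: "smooth_on S f \<Longrightarrow> S' \<subseteq> S \<Longrightarrow> smooth_on S' f"
  unfolding smooth_on_def using Ck_on_subset by blast

lemma smooth_on_cong:
  "open S \<Longrightarrow> (\<And>x. x \<in> S \<Longrightarrow> f x = g x) \<Longrightarrow> smooth_on S f \<Longrightarrow> smooth_on S g"
  unfolding smooth_on_def using Ck_on_cong by blast

lemma smooth_on_const: "open S \<Longrightarrow> smooth_on S (\<lambda>x. c)"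
  unfolding smooth_on_def using Ck_on_const by blast

lemma smooth_on_bounded_linear:
  "bounded_linear l \<Longrightarrow> open S \<Longrightarrow> smooth_on S f \<Longrightarrow> smooth_on S (\<lambda>x. l (f x))"
  unfolding smooth_on_def using Ck_on_bounded_linear by blast

lemma smooth_on_add:
  "open S \<Longrightarrow> smooth_on S f \<Longrightarrow> smooth_on S g \<Longrightarrow> smooth_on S (\<lambda>x. f x + g x)"
  unfolding smooth_on_def using Ck_on_add by blast

lemma (in bounded_bilinear) smooth_on_prod:
  "open S \<Longrightarrow> smooth_on S f \<Longrightarrow> smooth_on S g \<Longrightarrow> smooth_on S (\<lambda>x. prod (f x) (g x))"
  unfolding smooth_on_def using Ck_on_prod by blast

lemma smooth_on_compose:
  fixes f :: "'b::euclidean_space \<Rightarrow> 'c::real_normed_vector" and g :: "'a::euclidean_space \<Rightarrow> 'b"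
  shows "open S \<Longrightarrow> g ` S \<subseteq> S' \<Longrightarrow> smooth_on S' f \<Longrightarrow> smooth_on S g \<Longrightarrow> smooth_on S (\<lambda>x. f (g x))"
  unfolding smooth_on_def using Ck_on_compose by blast

lemma smooth_on_ident: "open S \<Longrightarrow> smooth_on S (\<lambda>x. x)"
  unfolding smooth_on_def
proof
  fix k assume "open S"
  then show "Ck_on k S (\<lambda>x. x)"
    by (cases k) (auto intro!: Ck_on_SucI Ck_on_const has_derivative_ident simp del: Ck_on.simps(2))
qed

lemma smooth_on_linear:
  fixes l :: "'a::euclidean_space \<Rightarrow> 'b::real_normed_vector"
  shows "linear l \<Longrightarrow> open S \<Longrightarrow> smooth_on S l"
  using smooth_on_bounded_linear[OF _ _ smooth_on_ident] linear_conv_bounded_linear by blast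

text \<open>A product rule in which one factor is merely continuous: the other factor vanishes at
  \<open>x\<close>, so the increment of \<open>c\<close> only contributes an error of second order.
  It serves to differentiate an inverse Jacobian before it is known to be differentiable.\<close>

lemma has_derivative_mult_diff:
  fixes c :: "'a::real_normed_vector \<Rightarrow> real" and r :: "'a \<Rightarrow> real"
  assumes c: "isCont c x" and r: "(r has_derivative r') (at x)"
  shows "((\<lambda>y. c y * (r y - r x)) has_derivative (\<lambda>h. c x * r' h)) (at x)"
proof -
  have lin: "bounded_linear r'" using r has_derivative_bounded_linear by blast
  then obtain K where K: "\<And>h. norm (r' h) \<le> norm h * K" "K > 0"
    using bounded_linear.pos_bounded by blast
  have lim: "((\<lambda>y. norm (r y - r x - r' (y - x)) / norm (y - x)) \<longlongrightarrow> 0) (at x)"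
    using r unfolding has_derivative_iff_norm by simp
  have "((\<lambda>y. \<bar>c y\<bar> * (norm (r y - r x - r' (y - x)) / norm (y - x)) + \<bar>c y - c x\<bar> * K)
      \<longlongrightarrow> \<bar>c x\<bar> * 0 + \<bar>c x - c x\<bar> * K) (at x)"
    using c lim unfolding isCont_def by (intro tendsto_intros)
  then have lim2: "((\<lambda>y. \<bar>c y\<bar> * (norm (r y - r x - r' (y - x)) / norm (y - x)) + \<bar>c y - c x\<bar> * K) \<longlongrightarrow> 0) (at x)"
    by simp
  have "((\<lambda>y. norm (c y * (r y - r x) - c x * (r x - r x) - c x * r' (y - x)) / norm (y - x)) \<longlongrightarrow> 0) (at x)"
  proof (rule tendsto_sandwich[OF _ _ tendsto_const lim2])
    show "\<forall>\<^sub>F y in at x. norm (c y * (r y - r x) - c x * (r x - r x) - c x * r' (y - x)) / norm (y - x)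
      \<le> \<bar>c y\<bar> * (norm (r y - r x - r' (y - x)) / norm (y - x)) + \<bar>c y - c x\<bar> * K"
    proof (rule eventually_mono[OF eventually_neq_at_within[of x]])
      fix y assume "y \<noteq> x"
      then have pos: "norm (y - x) > 0" by simp
      have "c y * (r y - r x) - c x * (r x - r x) - c x * r' (y - x)
          = c y * (r y - r x - r' (y - x)) + (c y - c x) * r' (y - x)" by (simp add: algebra_simps)
      then have "norm (c y * (r y - r x) - c x * (r x - r x) - c x * r' (y - x))
          \<le> \<bar>c y\<bar> * norm (r y - r x - r' (y - x)) + \<bar>c y - c x\<bar> * \<bar>r' (y - x)\<bar>"
        by (metis abs_mult norm_triangle_ineq real_norm_def)
      also have "\<dots> \<le> \<bar>c y\<bar> * norm (r y - r x - r' (y - x)) + \<bar>c y - c x\<bar> * (norm (y - x) * K)"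
        using K by (intro add_left_mono mult_left_mono) auto
      finally show "norm (c y * (r y - r x) - c x * (r x - r x) - c x * r' (y - x)) / norm (y - x)
      \<le> \<bar>c y\<bar> * (norm (r y - r x - r' (y - x)) / norm (y - x)) + \<bar>c y - c x\<bar> * K"
        using pos by (simp add: field_simps)
    qed
  qed auto
  then show ?thesis
    unfolding has_derivative_iff_norm
    using bounded_linear_const_mult[OF lin, of "c x"] by simp
qed

text \<open>
  With \<open>J q = D\<psi> q = (D\<Phi> (\<psi> q))\<inverse>\<close> one has \<open>J q' w - J q w = - J q' (D\<Phi> (\<psi> q') (J q w) - w)\<close>, which gives the
  derivative of \<open>J\<close> as a polynomial in \<open>J\<close> and the second derivatives of \<open>\<Phi>\<close> along \<open>\<psi>\<close>.
\<close>

lemma smooth_on_local_inverse: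
  fixes \<Phi> \<psi> :: "'a::euclidean_space \<Rightarrow> 'a"
  assumes "open U" "open G" and \<Phi>: "smooth_on U \<Phi>" and \<psi>: "\<psi> ` G \<subseteq> U"
    and J: "\<And>q. q \<in> G \<Longrightarrow> (\<psi> has_derivative J q) (at q)"
    and inv1: "\<And>q w. q \<in> G \<Longrightarrow> frechet_derivative \<Phi> (at (\<psi> q)) (J q w) = w"
    and inv2: "\<And>q w. q \<in> G \<Longrightarrow> J q (frechet_derivative \<Phi> (at (\<psi> q)) w) = w"
    and J_cont: "\<And>w. continuous_on G (\<lambda>q. J q w)"
  shows "smooth_on G \<psi>"
proof -
  let ?D = "\<lambda>q w. frechet_derivative \<Phi> (at (\<psi> q)) w"
  let ?D2 = "\<lambda>q b c. frechet_derivative (\<lambda>x. frechet_derivative \<Phi> (at x) b) (at (\<psi> q)) c"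
  have linJ: "linear (J q)" if "q \<in> G" for q using J[OF that] has_derivative_linear by blast
  have linD: "linear (?D q)" if "q \<in> G" for q
    using smooth_on_derivative(1)[OF \<Phi>] \<psi> that has_derivative_linear by blast
  have D2: "((\<lambda>q. ?D q b) has_derivative (\<lambda>u. ?D2 q b (J q u))) (at q)" if "q \<in> G" for q b
  proof (rule has_derivative_compose[OF J[OF that], of "\<lambda>x. frechet_derivative \<Phi> (at x) b"])
    show "((\<lambda>x. frechet_derivative \<Phi> (at x) b) has_derivative ?D2 q b) (at (\<psi> q))"
      using smooth_on_derivative(1)[OF smooth_on_derivative(2)[OF \<Phi>]] \<psi> that by blast
  qed
  have DJ: "((\<lambda>q. J q w) has_derivative (\<lambda>u. - (\<Sum>d\<in>Basis. inner (?D2 q (J q w) (J q u)) d *\<^sub>R J q d))) (at q)"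
    if q: "q \<in> G" for q w
  proof -
    let ?w = "J q w"
    \<comment> \<open>In components, the increment of \<open>J\<close> is a sum of products of an
      entry of \<open>J y\<close>, so far only known to be continuous, and an increment of the
      differentiable \<open>?D\<close>. This is the situation of
      \<open>has_derivative_mult_diff\<close>.\<close>
    have "((\<lambda>y. inner (J y d) e * (inner (?D y ?w) d - inner (?D q ?w) d)) has_derivative
       (\<lambda>u. inner (J q d) e * inner (?D2 q ?w (J q u)) d)) (at q)" for d e
    proof (rule has_derivative_mult_diff)
      show "isCont (\<lambda>y. inner (J y d) e) q"
        using J_cont[of d] q \<open>open G\<close> by (intro continuous_intros) (simp add: continuous_on_eq_continuous_at)
      show "((\<lambda>y. inner (?D y ?w) d) has_derivative (\<lambda>u. inner (?D2 q ?w (J q u)) d)) (at q)"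
        using D2[OF q, of ?w] by (rule has_derivative_inner_left)
    qed
    then have *: "((\<lambda>y. J q w - (\<Sum>e\<in>Basis. (\<Sum>d\<in>Basis. inner (J y d) e * (inner (?D y ?w) d - inner (?D q ?w) d)) *\<^sub>R e))
        has_derivative (\<lambda>u. 0 - (\<Sum>e\<in>Basis. (\<Sum>d\<in>Basis. inner (J q d) e * inner (?D2 q ?w (J q u)) d) *\<^sub>R e))) (at q)"
      by (intro has_derivative_diff has_derivative_const has_derivative_sum has_derivative_scaleR_left)
    have sum: "(\<Sum>e\<in>Basis. (\<Sum>d\<in>Basis. inner (J y d) e * x d) *\<^sub>R e) = (\<Sum>d\<in>Basis. x d *\<^sub>R J y d)"
      for y and x :: "'a \<Rightarrow> real"
    proof -
      have "(\<Sum>d\<in>Basis. x d *\<^sub>R J y d) = (\<Sum>e\<in>Basis. inner (\<Sum>d\<in>Basis. x d *\<^sub>R J y d) e *\<^sub>R e)"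
        by (rule euclidean_representation[symmetric])
      then show ?thesis by (simp add: inner_sum_left mult.commute)
    qed
    have eq: "J q w - (\<Sum>d\<in>Basis. (inner (?D y ?w) d - inner (?D q ?w) d) *\<^sub>R J y d) = J y w" if y: "y \<in> G" for y
    proof -
      have "(\<Sum>d\<in>Basis. (inner (?D y ?w) d - inner (?D q ?w) d) *\<^sub>R J y d) = J y (?D y ?w - ?D q ?w)"
        using linear_sum_Basis[OF linJ[OF y], of "?D y ?w - ?D q ?w"] by (simp add: inner_diff_left)
      also have "\<dots> = J q w - J y w"
        using linear_diff[OF linJ[OF y]] inv1[OF q] inv2[OF y] by simp
      finally show ?thesis by simp
    qed
    from * have "((\<lambda>y. J q w - (\<Sum>d\<in>Basis. (inner (?D y ?w) d - inner (?D q ?w) d) *\<^sub>R J y d))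
        has_derivative (\<lambda>u. 0 - (\<Sum>d\<in>Basis. inner (?D2 q ?w (J q u)) d *\<^sub>R J q d))) (at q)"
      unfolding sum .
    then show ?thesis
      unfolding diff_0 by (rule has_derivative_transform_within_open[OF _ \<open>open G\<close> q eq])
  qed
  have "Ck_on k G \<psi>" for k
  proof (induction k)
    case 0
    then show ?case
      using J by (auto intro!: continuous_at_imp_continuous_on has_derivative_continuous)
  next
    case (Suc k)
    \<comment> \<open>The derivative of \<open>J\<close> contains \<open>J\<close> itself and
      derivatives of \<open>\<Phi>\<close> along \<open>\<psi>\<close>. With \<open>\<psi>\<close>
      of class \<open>k\<close> fixed, the order of \<open>J\<close> therefore climbs one step at a
      time from continuity to \<open>k\<close>, which raises \<open>\<psi>\<close> to order
      \<open>Suc k\<close>.\<close>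
    have "j \<le> k \<Longrightarrow> \<forall>w. Ck_on j G (\<lambda>q. J q w)" for j
    proof (induction j)
      case 0
      then show ?case using J_cont by simp
    next
      case (Suc j)
      have j: "Ck_on j G \<psi>"
        using \<open>Ck_on k G \<psi>\<close> Suc.prems by (induction k) (auto simp: le_Suc_eq simp del: Ck_on.simps(2) dest: Ck_on_Suc_imp_Ck_on)
      have D2s: "Ck_on j G (\<lambda>q. ?D2 q b c)" for b c
        using smooth_on_derivative(2)[OF smooth_on_derivative(2)[OF \<Phi>]]
        by (intro Ck_on_compose[OF \<open>open G\<close> \<psi> _ j]) (auto simp: smooth_on_def)
      have "Ck_on (Suc j) G (\<lambda>q. J q w)" for w
      proof (rule Ck_on_SucI[OF \<open>open G\<close> DJ])
        fix u
        have "Ck_on j G (\<lambda>q. - (\<Sum>d\<in>Basis. (\<Sum>c\<in>Basis. \<Sum>b\<in>Basis. (inner (J q w) b * inner (J q u) c) *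
          inner (?D2 q b c) d) *\<^sub>R J q d))"
          using Suc.prems
          by (intro Ck_on_bounded_linear[OF bounded_linear_minus[OF bounded_linear_ident]] Ck_on_sum
              bounded_bilinear.Ck_on_prod[OF bounded_bilinear_scaleR]
              bounded_bilinear.Ck_on_prod[OF bounded_bilinear_mult]
              Ck_on_bounded_linear[OF bounded_linear_inner_left] Suc.IH[rule_format] D2s \<open>open G\<close>) auto
        \<comment> \<open>The second derivative is linear in both directions, so its value at the
          varying vectors \<open>J q w\<close> and \<open>J q u\<close> reduces to fixed basis
          directions, where it is of class \<open>j\<close>.\<close>
        moreover have "?D2 q (J q w) (J q u) = (\<Sum>c\<in>Basis. \<Sum>b\<in>Basis. (inner (J q w) b * inner (J q u) c) *\<^sub>R ?D2 q b c)"
          if q: "q \<in> G" for q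
        proof -
          have s: "(\<psi> q) \<in> U" using q \<psi> by blast
          have l1: "linear (?D2 q b)" for b
            using smooth_on_derivative(1)[OF smooth_on_derivative(2)[OF \<Phi>] s] has_derivative_linear by blast
          have *: "((\<lambda>x. \<Sum>b\<in>Basis. inner (J q w) b *\<^sub>R frechet_derivative \<Phi> (at x) b)
            has_derivative (\<lambda>c. \<Sum>b\<in>Basis. inner (J q w) b *\<^sub>R ?D2 q b c)) (at (\<psi> q))"
            by (intro has_derivative_sum has_derivative_scaleR_right
                smooth_on_derivative(1)[OF smooth_on_derivative(2)[OF \<Phi>] s])
          have eq: "(\<Sum>b\<in>Basis. inner (J q w) b *\<^sub>R frechet_derivative \<Phi> (at x) b) = frechet_derivative \<Phi> (at x) (J q w)"
            if "x \<in> U" for x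
            by (rule linear_sum_Basis[OF has_derivative_linear[OF smooth_on_derivative(1)[OF \<Phi> that]], symmetric])
          have "((\<lambda>x. frechet_derivative \<Phi> (at x) (J q w))
            has_derivative (\<lambda>c. \<Sum>b\<in>Basis. inner (J q w) b *\<^sub>R ?D2 q b c)) (at (\<psi> q))"
            by (rule has_derivative_transform_within_open[OF * \<open>open U\<close> s eq])
          then have "?D2 q (J q w) = (\<lambda>c. \<Sum>b\<in>Basis. inner (J q w) b *\<^sub>R ?D2 q b c)"
            by (rule frechet_derivative_at[symmetric])
          then have "?D2 q (J q w) (J q u) = (\<Sum>b\<in>Basis. inner (J q w) b *\<^sub>R ?D2 q b (J q u))" by simp
          also have "\<dots> = (\<Sum>b\<in>Basis. inner (J q w) b *\<^sub>R (\<Sum>c\<in>Basis. inner (J q u) c *\<^sub>R ?D2 q b c))"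
            by (intro sum.cong refl arg_cong2[where f = scaleR] linear_sum_Basis l1)
          also have "\<dots> = (\<Sum>c\<in>Basis. \<Sum>b\<in>Basis. (inner (J q w) b * inner (J q u) c) *\<^sub>R ?D2 q b c)"
            by (subst sum.swap) (simp add: scaleR_sum_right)
          finally show ?thesis .
        qed
        ultimately show "Ck_on j G (\<lambda>q. - (\<Sum>d\<in>Basis. inner (?D2 q (J q w) (J q u)) d *\<^sub>R J q d))"
          by (elim Ck_on_cong[OF \<open>open G\<close>, rotated]) (simp add: inner_sum_left)
      qed
      then show ?case by blast
    qed
    then show ?case
      by (intro Ck_on_SucI[OF \<open>open G\<close> J]) auto
  qed
  then show ?thesis unfolding smooth_on_def by blast
qed

text \<open>The inverse function theorem for continuously differentiable maps supplies an inverse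
  \<open>\<psi>\<close> with derivative \<open>J\<close>. Once \<open>J\<close> is shown to be
  continuous, the bootstrap in \<open>smooth_on_local_inverse\<close> makes \<open>\<psi>\<close>
  smooth.\<close>

lemma smooth_local_diffeomorphism:
  fixes \<Phi> :: "'a::euclidean_space \<Rightarrow> 'a"
  assumes "open U" "smooth_on U \<Phi>" "x \<in> U" "inj (frechet_derivative \<Phi> (at x))"
  obtains U' \<psi> where "open U'" "U' \<subseteq> U" "x \<in> U'" "open (\<Phi> ` U')" "smooth_on (\<Phi> ` U') \<psi>"
    "\<And>y. y \<in> U' \<Longrightarrow> \<psi> (\<Phi> y) = y"
proof -
  define f' where "f' y = Blinfun (frechet_derivative \<Phi> (at y))" for y
  have f': "blinfun_apply (f' y) = frechet_derivative \<Phi> (at y)" if "y \<in> U" for y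
    unfolding f'_def using smooth_on_derivative(1)[OF assms(2) that]
    by (simp add: bounded_linear_Blinfun_apply has_derivative_bounded_linear)
  have der: "(\<Phi> has_derivative blinfun_apply (f' y)) (at y)" if "y \<in> U" for y
    using f' smooth_on_derivative(1)[OF assms(2) that] that by simp
  have cont: "continuous_on U f'"
  proof (rule continuous_on_blinfun_componentwise)
    fix i :: 'a
    have "continuous_on U (\<lambda>y. frechet_derivative \<Phi> (at y) i)"
      using smooth_on_imp_continuous_on smooth_on_derivative(2)[OF assms(2)] by blast
    then show "continuous_on U (\<lambda>y. blinfun_apply (f' y) i)"
      by (simp add: f' cong: continuous_on_cong)
  qed
  have lin: "linear (frechet_derivative \<Phi> (at x))"
    using smooth_on_derivative(1)[OF assms(2,3)] has_derivative_linear by blast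
  obtain l where l: "linear l" "l \<circ> frechet_derivative \<Phi> (at x) = id"
    using linear_injective_left_inverse[OF lin assms(4)] by blast
  have "Blinfun l o\<^sub>L f' x = id_blinfun"
    using l f'[OF \<open>x \<in> U\<close>]
    by (intro blinfun_eqI) (simp add: bounded_linear_Blinfun_apply linear_conv_bounded_linear[symmetric] pointfree_idE)
  from inverse_function_theorem[OF \<open>open U\<close> der cont \<open>x \<in> U\<close> this]
  obtain U' V \<psi> J where *: "open U'" "U' \<subseteq> U" "x \<in> U'" "open V" "\<Phi> x \<in> V" and hom: "homeomorphism U' V \<Phi> \<psi>"
    and J: "\<And>y. y \<in> V \<Longrightarrow> (\<psi> has_derivative (J y)) (at y)"
      "\<And>y. y \<in> V \<Longrightarrow> J y = inv_into UNIV (blinfun_apply (f'(\<psi> y)))"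
      "\<And>y. y \<in> V \<Longrightarrow> bij (blinfun_apply (f'(\<psi> y)))"
    by metis
  have V: "\<Phi> ` U' = V" "\<psi> ` V = U'" and \<psi>: "\<And>y. y \<in> U' \<Longrightarrow> \<psi> (\<Phi> y) = y"
    using hom unfolding homeomorphism_def by auto
  have sub: "\<psi> ` V \<subseteq> U" using V * by simp
  have inv1: "frechet_derivative \<Phi> (at (\<psi> q)) (J q w) = w"
    and inv2: "J q (frechet_derivative \<Phi> (at (\<psi> q)) w) = w" if "q \<in> V" for q w
    using J(2,3)[OF that] f'[of "\<psi> q"] sub that
    by (auto simp: bij_is_surj surj_f_inv_f bij_is_inj image_subset_iff)
  have linJ: "linear (J q)" if "q \<in> V" for q using J(1)[OF that] has_derivative_linear by blast
  have "continuous_on V (\<lambda>q. J q w)" for w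
  proof (rule continuous_at_imp_continuous_on, rule ballI)
    fix p assume p: "p \<in> V"
    define A where "A q = f' (\<psi> q)" for q
    have AJ: "A q (J q z) = z" and JA: "J q (A q z) = z" if "q \<in> V" for q z
      using inv1[OF that] inv2[OF that] f'[of "\<psi> q"] sub that unfolding A_def by auto
    have A: "(A \<longlongrightarrow> A p) (at p)"
    proof -
      have "continuous_on V A"
        unfolding A_def using hom sub cont
        by (intro continuous_on_compose2[OF cont]) (auto simp: homeomorphism_def)
      then show ?thesis using p \<open>open V\<close> by (simp add: continuous_on_eq_continuous_at isCont_def)
    qed
    obtain K where K: "K > 0" "\<And>z. norm (J p z) \<le> norm z * K"
      using bounded_linear.pos_bounded[OF has_derivative_bounded_linear[OF J(1)[OF p]]] by blast
    \<comment> \<open>Perturbation of an inverse: \<open>K\<close> bounds \<open>J p\<close>, and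
      \<open>A q\<close> is so close to \<open>A p\<close> that replacing one by the other costs at
      most half of \<open>norm (J q w - J p w)\<close>. Absorbing that half on the left produces the
      factor 2.\<close>
    have "\<forall>\<^sub>F q in at p. norm (J q w - J p w) \<le> 2 * K * norm (A q (J p w) - w)"
    proof -
      have "\<forall>\<^sub>F q in at p. dist (A q) (A p) < 1 / (2 * K)"
        using A K by (intro tendstoD) auto
      moreover have "\<forall>\<^sub>F q in at p. q \<in> V"
        using p \<open>open V\<close> by (simp add: eventually_at_in_open')
      ultimately show ?thesis
      proof eventually_elim
        fix q assume q: "dist (A q) (A p) < 1 / (2 * K)" "q \<in> V"
        let ?z = "J q w - J p w"
        have "norm ?z \<le> norm (A p ?z) * K" using K(2)[of "A p ?z"] JA[OF p] by simp
        also have "A p ?z = A q ?z - (A q - A p) ?z" by (simp add: blinfun.diff_left)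
        also have "norm \<dots> \<le> norm (A q ?z) + norm (A q - A p) * norm ?z"
          using norm_triangle_ineq4 norm_blinfun by (smt (verit, best))
        also have "\<dots> \<le> norm (A q ?z) + 1 / (2 * K) * norm ?z"
          using q by (intro add_left_mono mult_right_mono) (auto simp: dist_norm)
        finally have "norm ?z \<le> norm (A q ?z) * K + norm ?z / 2"
          using K(1) by (simp add: field_simps)
        moreover have "norm (A q ?z) = norm (A q (J p w) - w)"
          using AJ[OF q(2)] by (simp add: blinfun.diff_right norm_minus_commute)
        ultimately show "norm ?z \<le> 2 * K * norm (A q (J p w) - w)"
          by (simp add: mult.commute)
      qed
    qed
    moreover have "((\<lambda>q. 2 * K * norm (A q (J p w) - w)) \<longlongrightarrow> 0) (at p)"
    proof -
      have "((\<lambda>q. 2 * K * norm (A q (J p w) - w)) \<longlongrightarrow> 2 * K * norm (A p (J p w) - w)) (at p)"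
        by (intro tendsto_intros A)
      moreover have "A p (J p w) - w = 0" by (simp only: AJ[OF p] diff_self)
      ultimately show ?thesis by (simp only: norm_zero mult_zero_right)
    qed
    ultimately have "((\<lambda>q. J q w - J p w) \<longlongrightarrow> 0) (at p)"
      by (rule Lim_null_comparison)
    then show "isCont (\<lambda>q. J q w) p"
      unfolding isCont_def by (rule LIM_zero_cancel)
  qed
  then have "smooth_on V \<psi>"
    using smooth_on_local_inverse[OF \<open>open U\<close> \<open>open V\<close> assms(2) sub J(1) inv1 inv2] by blast
  then show ?thesis using that[of U' \<psi>] * V \<psi> by auto
qed

subsection \<open>Alternating forms and orthonormal bases\<close>

lemma alternating_form_linear:
  assumes "alternating_form k \<omega>" "length us + Suc (length vs) = k"
  shows "linear (\<lambda>x. \<omega> (us @ x # vs))"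
proof -
  have "linear (\<lambda>x. \<omega> ((us @ 0 # vs)[length us := x]))"
  proof -
    have "length (us @ 0 # vs) = k" "length us < k" using assms(2) by auto
    then show ?thesis using assms(1) unfolding alternating_form_def by blast
  qed
  then show ?thesis by (simp add: list_update_append)
qed

lemma alternating_form_eq_0:
  assumes "alternating_form k \<omega>" "length ws = k" "\<not> distinct ws"
  shows "\<omega> ws = 0"
proof -
  obtain i j where "i < j" "j < k" "ws ! i = ws ! j"
    using assms(2,3) unfolding distinct_conv_nth by (metis nat_neq_iff)
  then show ?thesis using assms unfolding alternating_form_def by blast
qed

text \<open>Polarization: the form vanishes with \<open>x + y\<close> in both slots, and so do the
  two pure terms of the expansion.\<close>

lemma alternating_form_swap:
  assumes "alternating_form k \<omega>" "length us + Suc (Suc (length vs)) = k"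
  shows "\<omega> (us @ x # y # vs) = - \<omega> (us @ y # x # vs)"
proof -
  have l1: "linear (\<lambda>x. \<omega> (us @ x # y # vs))" for y
    using assms by (intro alternating_form_linear) auto
  have l2: "linear (\<lambda>y. \<omega> (us @ x # y # vs))" for x
    using alternating_form_linear[of k \<omega> "us @ [x]" vs] assms by simp
  have "\<omega> (us @ (x + y) # (x + y) # vs) = 0" "\<omega> (us @ x # x # vs) = 0" "\<omega> (us @ y # y # vs) = 0"
    by (rule alternating_form_eq_0[OF assms(1)]; use assms(2) in simp)+
  then show ?thesis
    using linear_add[OF l1] linear_add[OF l2] by simp
qed

lemma alternating_form_move:
  assumes "alternating_form k \<omega>" "length ps + Suc (length us + length vs) = k"
  shows "\<omega> (ps @ x # us @ vs) = (-1) ^ length us * \<omega> (ps @ us @ x # vs)"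
  using assms(2)
proof (induction us arbitrary: ps)
  case (Cons u us)
  have "\<omega> (ps @ x # (u # us) @ vs) = - \<omega> (ps @ u # x # us @ vs)"
    using alternating_form_swap[OF assms(1), of ps "us @ vs" x u] Cons.prems by simp
  also have "\<omega> (ps @ u # x # us @ vs) = (-1) ^ length us * \<omega> (ps @ (u # us) @ x # vs)"
    using Cons.IH[of "ps @ [u]"] Cons.prems by simp
  finally show ?case by simp
qed simp

text \<open>Moving one vector at a time into place changes at most the sign; with absolute values no
  sign of a permutation has to be computed.\<close>

lemma alternating_form_abs_perm:
  assumes "alternating_form k \<omega>" "length ps + length us = k" "mset us = mset vs"
  shows "\<bar>\<omega> (ps @ us)\<bar> = \<bar>\<omega> (ps @ vs)\<bar>"
  using assms(2,3)
proof (induction us arbitrary: ps vs)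
  case (Cons u us)
  have "u \<in> set vs" using Cons.prems(2) by (metis list.set_intros(1) mset_eq_setD)
  then obtain a b where vs: "vs = a @ u # b" by (meson split_list)
  then have ms: "mset us = mset (a @ b)" using Cons.prems(2) by simp
  then have len: "length us = length a + length b" by (metis mset_eq_length length_append)
  have "\<bar>\<omega> (ps @ u # us)\<bar> = \<bar>\<omega> (ps @ u # a @ b)\<bar>"
    using Cons.IH[of "ps @ [u]" "a @ b"] Cons.prems ms by simp
  also have "\<dots> = \<bar>\<omega> (ps @ vs)\<bar>"
    using alternating_form_move[OF assms(1), of ps a b u] Cons.prems len
    by (simp add: vs abs_mult power_abs)
  finally show ?case .
qed simp

text \<open>Induction on the number of entries outside \<open>gs\<close>: linearity in one slot
  replaces such an entry by members of \<open>gs\<close>. When none is left, the list either repeats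
  an entry or is a permutation of \<open>gs\<close>.\<close>

lemma alternating_form_vanish:
  assumes \<omega>: "alternating_form k \<omega>" and gs: "length gs = k" "\<omega> gs = 0"
    and "length xs = k" "set xs \<subseteq> span (set gs)"
  shows "\<omega> xs = 0"
proof -
  have "length (filter (\<lambda>x. x \<notin> set gs) xs) \<le> n \<Longrightarrow> length xs = k \<Longrightarrow> set xs \<subseteq> span (set gs) \<Longrightarrow> \<omega> xs = 0" for n xs
  proof (induction n arbitrary: xs)
    case 0
    then have sub: "set xs \<subseteq> set gs" by (auto simp: filter_empty_conv)
    show ?case
    proof (cases "distinct xs")
      case True
      have "card (set xs) = k" using distinct_card[OF True] 0 by simp
      moreover have "card (set gs) \<le> k" using card_length gs by metis
      ultimately have "set xs = set gs" "card (set gs) = k"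
        using sub card_seteq[of "set gs" "set xs"] by auto
      moreover from this have "distinct gs" using gs card_distinct by metis
      ultimately have "mset xs = mset gs"
        using True set_eq_iff_mset_eq_distinct by blast
      then show ?thesis
        using alternating_form_abs_perm[OF \<omega>, of "[]" xs gs] 0 gs by simp
    next
      case False
      then show ?thesis using alternating_form_eq_0[OF \<omega>] 0 by blast
    qed
  next
    case (Suc n)
    show ?case
    proof (cases "set xs \<subseteq> set gs")
      case True
      then have "filter (\<lambda>x. x \<notin> set gs) xs = []" by (auto simp: filter_empty_conv)
      then show ?thesis using Suc by simp
    next
      case False
      then obtain y where "y \<in> set xs" "y \<notin> set gs" by blast
      then obtain us vs where xs: "xs = us @ y # vs" by (meson split_list)
      have "linear (\<lambda>x. \<omega> (us @ x # vs))"
        using alternating_form_linear[OF \<omega>] Suc.prems xs by simp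
      moreover have "\<omega> (us @ x # vs) = 0" if "x \<in> set gs" for x
        using Suc.IH[of "us @ x # vs"] Suc.prems \<open>y \<notin> set gs\<close> that xs by (auto simp: span_base)
      ultimately show ?thesis
        using linear_eq_0_on_span[of "\<lambda>x. \<omega> (us @ x # vs)" "set gs" y] Suc.prems xs by auto
    qed
  qed
  then show ?thesis using assms by blast
qed

text \<open>Linearity in row \<open>i\<close> is the Laplace expansion along that row, whose
  cofactors do not involve it. This determinant is the reference form against which other top-degree
  forms are measured.\<close>

lemma alternating_form_gram_det:
  assumes "bilinear b"
  shows "alternating_form k (\<lambda>xs. Determinant.det (Matrix.mat k k (\<lambda>(i, j). b (xs ! i) (ys ! j))))"
    (is "alternating_form k (\<lambda>xs. Determinant.det (?M xs))")
  unfolding alternating_form_def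
proof (intro allI impI conjI)
  fix ws :: "'a list" and i assume ws: "length ws = k" and i: "i < k"
  let ?c = "\<lambda>j. cofactor (?M ws) i j"
  have "Determinant.det (?M (ws[i := x])) = (\<Sum>j<k. b x (ys ! j) * ?c j)" for x
  proof -
    have "Determinant.det (?M (ws[i := x])) = (\<Sum>j<k. ?M (ws[i := x]) $$ (i, j) * cofactor (?M (ws[i := x])) i j)"
      by (rule laplace_expansion_row) (use i in auto)
    also have "cofactor (?M (ws[i := x])) i j = ?c j" if "j < k" for j
    proof -
      have "mat_delete (?M (ws[i := x])) i j = mat_delete (?M ws) i j"
        unfolding mat_delete_def by (rule eq_matI) auto
      then show ?thesis unfolding cofactor_def by simp
    qed
    then have "(\<Sum>j<k. ?M (ws[i := x]) $$ (i, j) * cofactor (?M (ws[i := x])) i j) = (\<Sum>j<k. b x (ys ! j) * ?c j)"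
      using i ws by (intro sum.cong) auto
    finally show ?thesis .
  qed
  moreover have "linear (\<lambda>x. \<Sum>j<k. b x (ys ! j) * ?c j)"
  proof (intro linear_compose_sum ballI)
    fix j
    have l: "linear (\<lambda>x. b x (ys ! j))" using assms unfolding bilinear_def by blast
    show "linear (\<lambda>x. b x (ys ! j) * ?c j)"
      by (rule linearI) (simp_all only: linear_add[OF l] linear_scale[OF l] real_scaleR_def distrib_right mult.assoc)
  qed
  ultimately show "linear (\<lambda>x. Determinant.det (?M (ws[i := x])))" by simp
next
  fix ws :: "'a list" and i j assume "length ws = k" "i < j" "j < k" "ws ! i = ws ! j"
  then show "Determinant.det (?M ws) = 0"
    by (intro det_identical_rows[of _ k i j]) (auto intro!: eq_vecI)
qed

text \<open>Forms of top degree on the span of \<open>k\<close> vectors are determined by one value: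
  the combination of \<open>\<omega>\<close> and \<open>\<omega>'\<close> below is alternating and
  vanishes at \<open>gs\<close>.\<close>

lemma alternating_form_proportional:
  assumes "alternating_form k \<omega>" "alternating_form k \<omega>'" "length gs = k" "length xs = k" "set xs \<subseteq> span (set gs)"
  shows "\<omega> xs * \<omega>' gs = \<omega>' xs * \<omega> gs"
proof -
  have "alternating_form k (\<lambda>xs. \<omega> xs * \<omega>' gs - \<omega>' xs * \<omega> gs)"
    unfolding alternating_form_def
  proof (intro allI impI conjI)
    fix ws :: "'a list" and i assume "length ws = k" "i < k"
    then have l: "linear (\<lambda>x. \<omega> (ws[i := x]))" "linear (\<lambda>x. \<omega>' (ws[i := x]))"
      using assms(1,2) unfolding alternating_form_def by blast+
    show "linear (\<lambda>x. \<omega> (ws[i := x]) * \<omega>' gs - \<omega>' (ws[i := x]) * \<omega> gs)"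
      by (rule linearI) (simp_all add: linear_add[OF l(1)] linear_add[OF l(2)]
        linear_scale[OF l(1)] linear_scale[OF l(2)] algebra_simps)
  next
    fix ws :: "'a list" and i j assume "length ws = k" "i < j" "j < k" "ws ! i = ws ! j"
    then have "\<omega> ws = 0" "\<omega>' ws = 0" using assms(1,2) unfolding alternating_form_def by blast+
    then show "\<omega> ws * \<omega>' gs - \<omega>' ws * \<omega> gs = 0" by simp
  qed
  from alternating_form_vanish[OF this, of gs xs] assms show ?thesis by simp
qed

text \<open>Bilinearity and symmetry are global, positivity is confined to \<open>W\<close>: the
  form of interest is minus a Lorentzian product, which is definite on the hyperplane only.\<close>

definition pos_def_on :: "('a::real_vector \<Rightarrow> 'a \<Rightarrow> real) \<Rightarrow> 'a set \<Rightarrow> bool" where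
  "pos_def_on b W \<longleftrightarrow> bilinear b \<and> (\<forall>x y. b x y = b y x) \<and> subspace W \<and> (\<forall>x\<in>W. x \<noteq> 0 \<longrightarrow> b x x > 0)"

lemma pos_def_on_subset: "pos_def_on b W \<Longrightarrow> W' \<subseteq> W \<Longrightarrow> subspace W' \<Longrightarrow> pos_def_on b W'"
  by (simp add: pos_def_on_def subset_iff)

text \<open>Gram-Schmidt as an induction on the dimension: normalize one vector and pass to its
  \<open>b\<close>-orthogonal complement inside \<open>W\<close>.\<close>

lemma orthonormal_basis_exists:
  fixes b :: "'a::euclidean_space \<Rightarrow> 'a \<Rightarrow> real"
  assumes "pos_def_on b W"
  shows "\<exists>fs. orthonormal_basis b W fs"
  using assms
proof (induction "dim W" arbitrary: W rule: less_induct)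
  case less
  note W = less.prems[unfolded pos_def_on_def]
  have l: "linear (\<lambda>x. b x y)" "linear (\<lambda>x. b y x)" for y using W unfolding bilinear_def by auto
  show ?case
  proof (cases "W \<subseteq> {0}")
    case True
    then have "W = {0}" using W subspace_0 by blast
    then show ?thesis unfolding orthonormal_basis_def by (intro exI[of _ "[]"]) auto
  next
    case False
    then obtain w where w: "w \<in> W" "w \<noteq> 0" by blast
    define f where "f = (1 / sqrt (b w w)) *\<^sub>R w"
    have fW: "f \<in> W" using w W unfolding f_def by (simp add: subspace_scale)
    have bww: "b w w > 0" using w W by blast
    have ff: "b f f = 1" unfolding f_def using bww
      by (simp add: linear_scale[OF l(1)] linear_scale[OF l(2)])
    define W' where "W' = {x \<in> W. b f x = 0}"
    have sub: "subspace W'"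
      using W unfolding W'_def subspace_def
      by (auto simp: linear_add[OF l(2)] linear_scale[OF l(2)] linear_0[OF l(1)] linear_0[OF l(2)])
    have "f \<notin> W'" using ff unfolding W'_def by simp
    then have "W' \<subset> W" using fW unfolding W'_def by blast
    then have "dim W' < dim W"
      using sub W by (intro dim_psubset) (simp add: span_eq_iff[THEN iffD2])
    moreover have "pos_def_on b W'" using pos_def_on_subset[OF less.prems _ sub] unfolding W'_def by blast
    ultimately obtain fs where fs: "orthonormal_basis b W' fs" using less.hyps by blast
    have span: "span (set fs) = W'" and on: "\<And>i j. i < length fs \<Longrightarrow> j < length fs \<Longrightarrow> b (fs ! i) (fs ! j) = (if i = j then 1 else 0)"
      using fs unfolding orthonormal_basis_def by auto
    have bf: "b f x = 0" if "x \<in> set fs" for x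
      using span_base[OF that] span unfolding W'_def by auto
    have "span (set (f # fs)) = W"
    proof
      have "set (f # fs) \<subseteq> W" using fW span_superset[of "set fs"] span unfolding W'_def by auto
      then show "span (set (f # fs)) \<subseteq> W" using W span_minimal by blast
      show "W \<subseteq> span (set (f # fs))"
      proof
        fix x assume x: "x \<in> W"
        have "x - b f x *\<^sub>R f \<in> W'"
          using x fW W ff unfolding W'_def
          by (simp add: subspace_diff subspace_scale linear_diff[OF l(2)] linear_scale[OF l(2)])
        then have "x - b f x *\<^sub>R f \<in> span (set fs)" using span by simp
        then show "x \<in> span (set (f # fs))"
          using span_breakdown_eq[of x f "set fs"] by auto
      qed
    qed
    moreover have "b ((f # fs) ! i) ((f # fs) ! j) = (if i = j then 1 else 0)"
      if "i < length (f # fs)" "j < length (f # fs)" for i j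
    proof -
      have "b (fs ! a) f = 0" "b f (fs ! a) = 0" if "a < length fs" for a using bf[of "fs ! a"] W that by auto
      then show ?thesis using that on ff by (cases i; cases j) auto
    qed
    ultimately have "orthonormal_basis b W (f # fs)" unfolding orthonormal_basis_def by blast
    then show ?thesis by blast
  qed
qed

locale orthonormal =
  fixes b :: "'a::euclidean_space \<Rightarrow> 'a \<Rightarrow> real" and W fs
  assumes pos_def: "pos_def_on b W" and basis: "orthonormal_basis b W fs"
begin

lemma lin2: "linear (\<lambda>x. b y x)"
  using pos_def unfolding pos_def_on_def bilinear_def by auto

lemma symm: "b x y = b y x"
  using pos_def unfolding pos_def_on_def by auto

lemma on: "i < length fs \<Longrightarrow> j < length fs \<Longrightarrow> b (fs ! i) (fs ! j) = (if i = j then 1 else 0)"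
  using basis unfolding orthonormal_basis_def by auto

lemma span_fs: "span (set fs) = W"
  using basis unfolding orthonormal_basis_def by auto

lemma fs_in: "i < length fs \<Longrightarrow> fs ! i \<in> W"
  using span_fs span_base nth_mem by blast

lemma b_sum_fs: "j < length fs \<Longrightarrow> b (fs ! j) (\<Sum>i<length fs. c i *\<^sub>R fs ! i) = c j"
  by (simp add: linear_sum[OF lin2] linear_scale[OF lin2] on if_distrib cong: if_cong)

lemma expansion:
  assumes "x \<in> W"
  shows "x = (\<Sum>i<length fs. b (fs ! i) x *\<^sub>R fs ! i)"
proof -
  let ?P = "\<lambda>x. \<Sum>i<length fs. b (fs ! i) x *\<^sub>R fs ! i"
  have "linear ?P"
    by (intro linear_compose_sum ballI) (auto intro!: linearI simp: linear_add[OF lin2] linear_scale[OF lin2] algebra_simps)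
  moreover have "?P f = f" if f: "f \<in> set fs" for f
  proof -
    obtain k where k: "k < length fs" "f = fs ! k" using f by (metis in_set_conv_nth)
    have "?P f = (\<Sum>i<length fs. if i = k then fs ! i else 0)"
      using k by (intro sum.cong refl) (auto simp: on)
    then show ?thesis using k by simp
  qed
  ultimately have "?P x = x"
    using linear_eq_on[of ?P "\<lambda>x. x" x "set fs"] assms span_fs linear_ident by blast
  then show ?thesis by (rule sym)
qed

lemma distinct_fs: "distinct fs"
  unfolding distinct_conv_nth using on by (metis zero_neq_one)

lemma independent_fs: "independent (set fs)"
proof (rule independent_if_scalars_zero)
  fix c x assume z: "(\<Sum>x\<in>set fs. c x *\<^sub>R x) = 0" and "x \<in> set fs"
  then obtain k where k: "k < length fs" "x = fs ! k" by (metis in_set_conv_nth)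
  have "(\<Sum>x\<in>set fs. c x *\<^sub>R x) = (\<Sum>i<length fs. c (fs ! i) *\<^sub>R fs ! i)"
    by (rule sum.reindex_bij_betw[OF bij_betw_nth[OF distinct_fs refl refl], symmetric])
  then have "b (fs ! k) (\<Sum>i<length fs. c (fs ! i) *\<^sub>R fs ! i) = 0" using z linear_0[OF lin2] by simp
  then show "c x = 0" using b_sum_fs[OF k(1), of "\<lambda>i. c (fs ! i)"] k by simp
qed simp

lemma length_fs: "length fs = dim W"
  using dim_eq_card_independent[OF independent_fs] distinct_card[OF distinct_fs] dim_span[of "set fs"] span_fs
  by simp

text \<open>The transition matrix between two orthonormal bases is orthogonal, so its determinant is
  1 or -1. This is why the choice operator in \<open>form_coefficient\<close> does no harm.\<close>

lemma abs_alternating_form: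
  assumes "orthonormal_basis b W gs" "alternating_form (dim W) \<omega>"
  shows "\<bar>\<omega> gs\<bar> = \<bar>\<omega> fs\<bar>"
proof -
  interpret g: orthonormal b W gs using assms pos_def by unfold_locales
  let ?k = "dim W"
  let ?M = "\<lambda>xs. Matrix.mat ?k ?k (\<lambda>(i, j). b (xs ! i) (fs ! j))"
  have "bilinear b" using pos_def unfolding pos_def_on_def by blast
  have "?M fs = 1\<^sub>m ?k" using on length_fs by (intro eq_matI) auto
  moreover have "\<bar>Determinant.det (?M gs)\<bar> = 1"
  proof -
    have "?M gs * transpose_mat (?M gs) = 1\<^sub>m ?k"
    proof (rule eq_matI)
      fix i j assume "i < dim_row (1\<^sub>m ?k)" "j < dim_col (1\<^sub>m ?k)"
      then have ij: "i < ?k" "j < ?k" by auto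
      have "b (gs ! i) (gs ! j) = (\<Sum>l<?k. b (gs ! i) (fs ! l) * b (fs ! l) (gs ! j))"
      proof -
        have "gs ! j \<in> W" using g.fs_in ij g.length_fs by simp
        have "b (gs ! i) (gs ! j) = b (gs ! i) (\<Sum>l<?k. b (fs ! l) (gs ! j) *\<^sub>R fs ! l)"
          using arg_cong[OF expansion[OF \<open>gs ! j \<in> W\<close>], of "b (gs ! i)"] unfolding length_fs .
        then show ?thesis by (simp only: linear_sum[OF lin2] linear_scale[OF lin2] real_scaleR_def mult.commute)
      qed
      also have "\<dots> = row (?M gs) i \<bullet> row (?M gs) j"
        using ij unfolding scalar_prod_def
        by (intro sum.cong) (auto simp: symm[of "fs ! _"] lessThan_atLeast0)
      finally show "(?M gs * transpose_mat (?M gs)) $$ (i, j) = 1\<^sub>m ?k $$ (i, j)"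
        using ij g.on g.length_fs by simp
    qed simp_all
    then have "Determinant.det (?M gs) * Determinant.det (?M gs) = 1"
      using det_mult[of "?M gs" ?k "transpose_mat (?M gs)"] det_transpose[of "?M gs" ?k] by simp
    then show ?thesis by (simp add: square_eq_1_iff) (auto)
  qed
  moreover have "\<omega> gs * Determinant.det (?M fs) = Determinant.det (?M gs) * \<omega> fs"
    using length_fs g.length_fs span_fs g.span_fs span_superset[of "set gs"]
    by (intro alternating_form_proportional[OF assms(2) alternating_form_gram_det[OF \<open>bilinear b\<close>]]) auto
  ultimately show ?thesis by (simp add: abs_mult)
qed

lemma alternating_form_nonzero:
  assumes "alternating_form (dim W) \<omega>" "length ws = dim W" "set ws \<subseteq> W" "\<omega> ws \<noteq> 0"
  shows "\<omega> fs \<noteq> 0"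
  using alternating_form_vanish[OF assms(1), of fs ws] assms length_fs span_fs by auto

end

subsection \<open>Lorentzian scalar products and traces\<close>

text \<open>Euler's relation: on the ray through \<open>v\<close>, homogeneity turns
  \<open>L\<close> into \<open>(1 + s + t)\<^sup>2 * L v\<close> as long as the factor stays
  positive, which suffices for derivatives at 0. It makes \<open>v\<close> a unit vector of its own
  scalar product.\<close>

lemma fund_tensor_self:
  assumes "lorentz_norm A L" "v \<in> A"
  shows "fund_tensor L v v v = L v"
proof -
  have L: "L (c *\<^sub>R v) = c\<^sup>2 * L v" if "c > 0" for c
    using assms that unfolding lorentz_norm_def by blast
  have 1: "deriv (\<lambda>t. L (v + s *\<^sub>R v + t *\<^sub>R v)) 0 = 2 * (1 + s) * L v" if s: "s > -1" for s
  proof (rule DERIV_imp_deriv)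
    have "((\<lambda>t. (1 + s + t)\<^sup>2 * L v) has_real_derivative 2 * (1 + s) * L v) (at 0)"
      by (auto intro!: derivative_eq_intros)
    then show "((\<lambda>t. L (v + s *\<^sub>R v + t *\<^sub>R v)) has_real_derivative 2 * (1 + s) * L v) (at 0)"
    proof (rule has_field_derivative_transform_within_open[where S = "{- (1 + s)<..}"])
      fix t assume "t \<in> {- (1 + s)<..}"
      then show "(1 + s + t)\<^sup>2 * L v = L (v + s *\<^sub>R v + t *\<^sub>R v)"
        using L[of "1 + s + t"] by (simp add: scaleR_add_left)
    qed (use s in auto)
  qed
  have "deriv (\<lambda>s. deriv (\<lambda>t. L (v + s *\<^sub>R v + t *\<^sub>R v)) 0) 0 = 2 * L v"
  proof (rule DERIV_imp_deriv)
    have "((\<lambda>s. 2 * (1 + s) * L v) has_real_derivative 2 * L v) (at 0)"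
      by (auto intro!: derivative_eq_intros)
    then show "((\<lambda>s. deriv (\<lambda>t. L (v + s *\<^sub>R v + t *\<^sub>R v)) 0) has_real_derivative 2 * L v) (at 0)"
      by (rule has_field_derivative_transform_within_open[where S = "{-1<..}"]) (auto simp: 1)
  qed
  then show ?thesis unfolding fund_tensor_def by simp
qed

text \<open>
  A combination of \<open>v\<close> and \<open>w\<close> without component along the positive basis vector is negative, which
  forces it to vanish unless \<open>b w w < 0\<close>.
\<close>

lemma lorentzian_form_orthogonal_neg:
  assumes b: "lorentzian_form b" and v: "b v v > 0" and w: "b v w = 0" "w \<noteq> 0"
  shows "b w w < 0"
proof (rule ccontr)
  assume nn: "\<not> b w w < 0"
  obtain B e where B: "independent B" "span B = UNIV" "e \<in> B" "b e e > 0"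
      and neg: "\<And>x. x \<in> B - {e} \<Longrightarrow> b x x < 0" and orth: "\<And>x y. x \<in> B \<Longrightarrow> y \<in> B \<Longrightarrow> x \<noteq> y \<Longrightarrow> b x y = 0"
    using b unfolding lorentzian_form_def by blast
  have l1: "linear (\<lambda>x. b x y)" and l2: "linear (\<lambda>x. b y x)" for y
    using b unfolding lorentzian_form_def bilinear_def by auto
  have symm: "b x y = b y x" for x y using b unfolding lorentzian_form_def by blast
  have fin: "finite B" using independent_imp_finite B(1) by blast
  have neg_def: "b x x < 0" if x: "b e x = 0" "x \<noteq> 0" for x
  proof -
    define r where "r = representation B x"
    have xr: "x = (\<Sum>y\<in>B. r y *\<^sub>R y)"
      unfolding r_def using sum_representation_eq[OF B(1) _ fin order_refl, of x] B(2) by simp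
    have comp: "b y x = r y * b y y" if "y \<in> B" for y
    proof -
      have "b y x = (\<Sum>z\<in>B. r z * b y z)"
        by (subst xr) (simp add: linear_sum[OF l2] linear_scale[OF l2])
      also have "\<dots> = (\<Sum>z\<in>B. if z = y then r y * b y y else 0)"
        by (rule sum.cong) (use orth that in auto)
      finally show ?thesis using fin that by simp
    qed
    have "b x x = (\<Sum>y\<in>B. r y * b y x)"
    proof -
      have "b x x = b (\<Sum>y\<in>B. r y *\<^sub>R y) x" using arg_cong[OF xr, of "\<lambda>z. b z x"] .
      then show ?thesis by (simp add: linear_sum[OF l1] linear_scale[OF l1])
    qed
    then have bxx: "b x x = (\<Sum>y\<in>B. (r y)\<^sup>2 * b y y)"
      by (simp add: comp power2_eq_square mult.assoc)
    have re: "r e = 0" using comp[OF B(3)] x B(4) by simp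
    obtain y where y: "y \<in> B" "r y \<noteq> 0" using x(2) xr by (metis (no_types, lifting) scaleR_eq_0_iff sum.neutral)
    have "0 < (\<Sum>y\<in>B. - ((r y)\<^sup>2 * b y y))"
    proof (rule sum_pos2[OF fin y(1)])
      show "0 < - ((r y)\<^sup>2 * b y y)"
      proof -
        have "y \<noteq> e" using y re by auto
        then show ?thesis using y neg[of y] by (simp add: mult_pos_neg)
      qed
      show "0 \<le> - ((r z)\<^sup>2 * b z z)" if "z \<in> B" for z
        using re neg[of z] that by (cases "z = e") (auto simp: mult_nonneg_nonpos less_imp_le)
    qed
    then show ?thesis using bxx by (simp add: sum_negf)
  qed
  define x where "x = b e w *\<^sub>R v - b e v *\<^sub>R w"
  have "b e x = 0" unfolding x_def by (simp add: linear_diff[OF l2] linear_scale[OF l2])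
  moreover have "b x x \<ge> 0"
  proof -
    have "b x x = (b e w)\<^sup>2 * b v v + (b e v)\<^sup>2 * b w w"
      unfolding x_def using w symm[of w v]
      by (simp add: linear_diff[OF l1] linear_scale[OF l1] linear_diff[OF l2] linear_scale[OF l2] power2_eq_square)
    then show ?thesis using v nn by simp
  qed
  ultimately have x0: "x = 0" using neg_def by force
  \<comment> \<open>Otherwise \<open>v\<close> would lie in the complement of \<open>e\<close>,
    where \<open>b\<close> is negative definite. Pairing \<open>x = 0\<close> with \<open>v\<close>
    then gives \<open>b e w = 0\<close>, so that \<open>x\<close> is a nonzero multiple of
    \<open>w\<close>.\<close>
  have ev: "b e v \<noteq> 0" using neg_def[of v] v linear_0[OF l1, of 0] by (cases "v = 0") auto
  have "b v x = b e w * b v v" unfolding x_def using w by (simp add: linear_diff[OF l2] linear_scale[OF l2])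
  then have "b e w = 0" using x0 v linear_0[OF l2] by simp
  then show False using x0 ev w unfolding x_def by simp
qed

locale lorentz_split =
  fixes b :: "'a::euclidean_space \<Rightarrow> 'a \<Rightarrow> real" and v :: 'a
  assumes lor: "lorentzian_form b" and bvv: "b v v = 1"
begin

definition "W = {w. b v w = 0}"

definition h where "h x y = - b x y"

lemma l1: "linear (\<lambda>x. b x y)" and l2: "linear (\<lambda>x. b y x)"
  using lor unfolding lorentzian_form_def bilinear_def by auto

lemma bl2: "bounded_linear (\<lambda>x. b y x)"
  using l2 linear_conv_bounded_linear by blast

lemma bsymm: "b x y = b y x"
  using lor unfolding lorentzian_form_def by blast

lemma subspace_W: "subspace W"
  unfolding W_def subspace_def by (auto simp: linear_add[OF l2] linear_scale[OF l2] linear_0[OF l2])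

lemma bilinear_h: "bilinear h"
  unfolding bilinear_def h_def using linear_compose_neg[OF l1] linear_compose_neg[OF l2] by blast

lemma pos_def_h: "pos_def_on h W"
  unfolding pos_def_on_def
proof (intro conjI allI ballI impI bilinear_h subspace_W)
  show "h x y = h y x" for x y unfolding h_def using bsymm[of x y] by simp
  show "0 < h x x" if "x \<in> W" "x \<noteq> 0" for x
    using lorentzian_form_orthogonal_neg[OF lor, of v x] bvv that unfolding h_def W_def by simp
qed

lemma minus_component_in_W: "x - b v x *\<^sub>R v \<in> W"
  unfolding W_def using bvv by (simp add: linear_diff[OF l2] linear_scale[OF l2])

lemma v_notin_W: "v \<notin> W"
  unfolding W_def using bvv by simp

lemma dim_W: "dim W = DIM('a) - 1"
proof -
  have "x \<in> span (insert v W)" for x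
  proof -
    have "x - b v x *\<^sub>R v \<in> span W" using minus_component_in_W span_base by blast
    then show ?thesis using span_breakdown_eq[of x v W] by blast
  qed
  then have "span (insert v W) = UNIV" by blast
  then have "dim (insert v W) = DIM('a)" by (simp add: dim_eq_full)
  moreover have "v \<notin> span W" using v_notin_W subspace_W span_eq_iff by blast
  ultimately show ?thesis by (simp add: dim_insert)
qed

end

text \<open>Taken in the fixed affine coordinates, to match \<open>div_tensor\<close>; the passage
  to frames adapted to the Lorentzian product is \<open>trace_of_eq\<close>.\<close>

definition trace_of :: "('a::euclidean_space \<Rightarrow> 'a) \<Rightarrow> real" where
  "trace_of F = (\<Sum>e\<in>Basis. inner (F e) e)"

lemma trace_of_commute:
  fixes F G :: "'a::euclidean_space \<Rightarrow> 'a"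
  assumes "linear F" "linear G"
  shows "trace_of (\<lambda>x. F (G x)) = trace_of (\<lambda>x. G (F x))"
proof -
  have *: "trace_of (\<lambda>x. F (G x)) = (\<Sum>e\<in>Basis. \<Sum>f\<in>Basis. inner (G e) f * inner (F f) e)" if "linear F" for F G :: "'a \<Rightarrow> 'a"
    unfolding trace_of_def
    by (intro sum.cong refl) (subst linear_sum_Basis[OF that], simp add: inner_sum_left)
  show ?thesis
    unfolding *[OF assms(1)] *[OF assms(2)] by (subst sum.swap) (simp add: mult.commute)
qed

locale lorentz_basis = lorentz_split +
  fixes gs
  assumes gs: "orthonormal_basis h W gs"

sublocale lorentz_basis \<subseteq> G: orthonormal h W gs
  using pos_def_h gs by unfold_locales

context lorentz_basis
begin

text \<open>The minus sign appears because the vectors \<open>gs ! i\<close> have square -1 with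
  respect to \<open>b\<close>.\<close>

lemma full_expansion: "x = b v x *\<^sub>R v - (\<Sum>i<length gs. b (gs ! i) x *\<^sub>R gs ! i)"
proof -
  have bg: "b (gs ! i) v = 0" if "i < length gs" for i
    using G.fs_in[OF that] bsymm[of v] unfolding W_def by simp
  have "x - b v x *\<^sub>R v = (\<Sum>i<length gs. h (gs ! i) (x - b v x *\<^sub>R v) *\<^sub>R gs ! i)"
    using G.expansion[OF minus_component_in_W] .
  also have "\<dots> = (\<Sum>i<length gs. (- b (gs ! i) x) *\<^sub>R gs ! i)"
    by (intro sum.cong refl) (simp add: h_def linear_diff[OF l2] linear_scale[OF l2] bg)
  also have "\<dots> = - (\<Sum>i<length gs. b (gs ! i) x *\<^sub>R gs ! i)"
    by (simp add: sum_negf)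
  finally show ?thesis by (simp add: algebra_simps)
qed

text \<open>Expand each \<open>F e\<close> in the frame of \<open>v\<close> and \<open>gs\<close>;
  summing over \<open>Basis\<close> then reassembles the argument, since the sum of
  \<open>inner u e\<close> times \<open>b u (F e)\<close> is \<open>b u (F u)\<close>.\<close>

lemma trace_of_eq:
  assumes "linear F"
  shows "trace_of F = b v (F v) - (\<Sum>i<length gs. b (gs ! i) (F (gs ! i)))"
proof -
  have *: "(\<Sum>e\<in>Basis. b u (F e) * inner u e) = b u (F u)" for u
  proof -
    have "linear (\<lambda>x. b u (F x))" using linear_compose[OF assms l2] by (simp add: o_def)
    from linear_sum_Basis[OF this, of u] show ?thesis by (simp add: mult.commute)
  qed
  have "trace_of F = (\<Sum>e\<in>Basis. b v (F e) * inner v e - (\<Sum>i<length gs. b (gs ! i) (F e) * inner (gs ! i) e))"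
    unfolding trace_of_def
  proof (intro sum.cong refl)
    fix e :: 'a
    show "inner (F e) e = b v (F e) * inner v e - (\<Sum>i<length gs. b (gs ! i) (F e) * inner (gs ! i) e)"
      using arg_cong[OF full_expansion[of "F e"], of "\<lambda>x. inner x e"]
      by (simp only: inner_diff_left inner_sum_left inner_scaleR_left)
  qed
  also have "\<dots> = b v (F v) - (\<Sum>i<length gs. b (gs ! i) (F (gs ! i)))"
    unfolding sum_subtractf * by (subst sum.swap) (simp add: *)
  finally show ?thesis .
qed

lemma trace_of_antisymmetric:
  assumes "linear F" "\<And>x y. b x (F y) = - b y (F x)"
  shows "trace_of F = 0"
proof -
  have "b x (F x) = 0" for x using assms(2)[of x x] by simp
  then show ?thesis using trace_of_eq[OF assms(1)] by simp
qed

text \<open>Moving \<open>F\<close> and then \<open>G\<close> across \<open>b\<close> shows that the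
  trace of \<open>F G\<close> is minus the trace of \<open>G F\<close>; the two traces also
  coincide, so both vanish.\<close>

lemma trace_of_symmetric_antisymmetric:
  assumes F: "linear F" "\<And>x y. b x (F y) = b y (F x)" and G: "linear G" "\<And>x y. b (G x) y + b x (G y) = 0"
  shows "trace_of (\<lambda>x. F (G x)) = 0"
proof -
  have FG: "linear (\<lambda>x. F (G x))" "linear (\<lambda>x. G (F x))"
    using linear_compose[OF F(1) G(1)] linear_compose[OF G(1) F(1)] by (simp_all add: o_def)
  have "b x (F (G x)) = - b x (G (F x))" for x
    using F(2)[of x "G x"] G(2)[of x "F x"] by simp
  then have "trace_of (\<lambda>x. F (G x)) = - trace_of (\<lambda>x. G (F x))"
    using trace_of_eq[OF FG(1)] trace_of_eq[OF FG(2)] by (simp add: sum_negf)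
  then show ?thesis using trace_of_commute[OF F(1) G(1)] by simp
qed

lemma ori_const:
  assumes "alternating_form (DIM('a) - 1) ori"
    and "\<exists>ws. length ws = DIM('a) - 1 \<and> set ws \<subseteq> W \<and> ori ws \<noteq> 0"
  shows "ori gs \<noteq> 0" and "orthonormal_basis h W fs \<Longrightarrow> \<bar>ori fs\<bar> = \<bar>ori gs\<bar>"
  using G.alternating_form_nonzero[of ori] G.abs_alternating_form[of fs ori] assms dim_W by auto

end

text \<open>\<open>\<nabla>(T X) = (\<nabla>T) X + T (\<nabla>X)\<close>, and the trace of the first term is the divergence of \<open>T\<close>.\<close>

lemma trace_of_derivative_apply:
  fixes \<tau> :: "'a::euclidean_space \<Rightarrow> ('a \<Rightarrow>\<^sub>L 'a)"
  assumes \<tau>: "(\<tau> has_derivative \<tau>') (at p)" and \<xi>: "(\<xi> has_derivative \<xi>') (at p)"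
    and Y: "((\<lambda>q. blinfun_apply (\<tau> q) (\<xi> q)) has_derivative Y') (at p)"
  shows "trace_of Y' = div_tensor \<tau> p (\<xi> p) + trace_of (\<lambda>x. \<tau> p (\<xi>' x))"
proof -
  have "((\<lambda>q. blinfun_apply (\<tau> q) (\<xi> q)) has_derivative (\<lambda>x. \<tau> p (\<xi>' x) + \<tau>' x (\<xi> p))) (at p)"
    by (rule bounded_bilinear.FDERIV[OF bounded_bilinear_blinfun_apply \<tau> \<xi>])
  then have Y': "Y' = (\<lambda>x. \<tau> p (\<xi>' x) + \<tau>' x (\<xi> p))" using Y has_derivative_unique by blast
  have "((\<lambda>q. blinfun_apply (\<tau> q) (\<xi> p)) has_derivative (\<lambda>x. \<tau> p 0 + \<tau>' x (\<xi> p))) (at p)"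
    by (rule bounded_bilinear.FDERIV[OF bounded_bilinear_blinfun_apply \<tau> has_derivative_const])
  then have "frechet_derivative (\<lambda>q. blinfun_apply (\<tau> q) (\<xi> p)) (at p) = (\<lambda>x. \<tau>' x (\<xi> p))"
    using frechet_derivative_at by (metis (no_types, lifting) add_0 blinfun.zero_right ext)
  then show ?thesis
    unfolding trace_of_def div_tensor_def Y' by (simp add: inner_add_left sum.distrib)
qed

subsection \<open>Tangent spaces and coefficients of forms\<close>

lemma slice_chart_derivative:
  fixes S :: "'a::euclidean_space set"
  assumes "slice_chart m S e U \<phi>" "x \<in> U"
  shows "(\<phi> has_derivative frechet_derivative \<phi> (at x)) (at x)"
    and "linear (frechet_derivative \<phi> (at x))" and "inj (frechet_derivative \<phi> (at x))"
proof -
  note c = assms(1)[unfolded slice_chart_def]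
  show d: "(\<phi> has_derivative frechet_derivative \<phi> (at x)) (at x)"
    using smooth_on_derivative(1) c assms(2) by blast
  then show "linear (frechet_derivative \<phi> (at x))" using has_derivative_linear by blast
  let ?\<psi> = "inv_into U \<phi>"
  have "(?\<psi> has_derivative frechet_derivative ?\<psi> (at (\<phi> x))) (at (\<phi> x))"
    using smooth_on_derivative(1) c assms(2) by blast
  from has_derivative_compose[OF d this]
  have "((\<lambda>y. y) has_derivative (\<lambda>u. frechet_derivative ?\<psi> (at (\<phi> x)) (frechet_derivative \<phi> (at x) u))) (at x)"
    using c assms(2) by (elim has_derivative_transform_within_open[of _ _ _ _ U]) auto
  from has_derivative_unique[OF this has_derivative_ident]
  have "(\<lambda>u. frechet_derivative ?\<psi> (at (\<phi> x)) (frechet_derivative \<phi> (at x) u)) = (\<lambda>u. u)" .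
  then show "inj (frechet_derivative \<phi> (at x))" by (metis inj_on_inverseI)
qed

text \<open>The line through \<open>x\<close> in direction \<open>u\<close> stays in the slice, so
  \<open>\<phi>\<close> maps it into \<open>S\<close> near \<open>x\<close>, where \<open>l\<close>
  is constant; its derivative at 0 is the claim. Applied to \<open>b v\<close>, it puts tangent
  vectors into \<open>W\<close>.\<close>

lemma slice_chart_derivative_tangent:
  fixes S :: "'a::euclidean_space set"
  assumes "slice_chart m S e U \<phi>" "x \<in> U \<inter> span (e ` {..<m})" "u \<in> span (e ` {..<m})"
    and l: "bounded_linear l" "\<And>q. q \<in> S \<Longrightarrow> l q = c"
  shows "l (frechet_derivative \<phi> (at x) u) = 0"
proof -
  note ch = assms(1)[unfolded slice_chart_def]
  have x: "x \<in> U" using assms by blast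
  have "((\<lambda>s::real. x + s *\<^sub>R u) has_derivative (\<lambda>s. s *\<^sub>R u)) (at 0)"
    by (auto intro!: derivative_eq_intros)
  moreover have "(\<phi> has_derivative frechet_derivative \<phi> (at x)) (at (x + 0 *\<^sub>R u))"
    using slice_chart_derivative(1)[OF assms(1) x] by simp
  ultimately have "((\<lambda>s. \<phi> (x + s *\<^sub>R u)) has_derivative (\<lambda>s. frechet_derivative \<phi> (at x) (s *\<^sub>R u))) (at 0)"
    by (rule has_derivative_compose)
  from bounded_linear.has_derivative[OF l(1) this]
  have 1: "((\<lambda>s. l (\<phi> (x + s *\<^sub>R u))) has_derivative (\<lambda>s. l (frechet_derivative \<phi> (at x) (s *\<^sub>R u)))) (at 0)" .
  have "open ((\<lambda>s::real. x + s *\<^sub>R u) -` U)"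
    using ch by (intro open_vimage) (auto intro!: continuous_intros)
  moreover have "0 \<in> (\<lambda>s::real. x + s *\<^sub>R u) -` U" using x by simp
  moreover have "l (\<phi> (x + s *\<^sub>R u)) = c" if "s \<in> (\<lambda>s::real. x + s *\<^sub>R u) -` U" for s
  proof -
    have "x + s *\<^sub>R u \<in> U \<inter> span (e ` {..<m})"
      using assms that by (auto intro!: span_add span_scale)
    then show ?thesis using ch l(2) by blast
  qed
  ultimately have "((\<lambda>s::real. c) has_derivative (\<lambda>s. l (frechet_derivative \<phi> (at x) (s *\<^sub>R u)))) (at 0)"
    by (rule has_derivative_transform_within_open[OF 1])
  from has_derivative_unique[OF this has_derivative_const]
  have "(\<lambda>s. l (frechet_derivative \<phi> (at x) (s *\<^sub>R u))) = (\<lambda>s. 0)" .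
  from fun_cong[OF this, of 1] show ?thesis by simp
qed

lemma slice_chart_tangent_image:
  fixes S :: "'a::euclidean_space set"
  assumes "slice_chart m S e U \<phi>" "x \<in> U \<inter> span (e ` {..<m})"
  defines "V \<equiv> frechet_derivative \<phi> (at x) ` span (e ` {..<m})"
  shows "subspace V" "dim V = m" "V \<subseteq> tangent_space m S (\<phi> x)"
proof -
  note ch = assms(1)[unfolded slice_chart_def]
  have x: "x \<in> U" using assms by blast
  note d = slice_chart_derivative[OF assms(1) x]
  show "subspace V" unfolding V_def using linear_subspace_image[OF d(2)] subspace_span by blast
  have "dim V = dim (span (e ` {..<m}))" unfolding V_def
    using d(3) by (intro dim_image_eq[OF d(2)]) (auto intro: inj_on_subset)
  also have "\<dots> = card (e ` {..<m})" using ch dim_eq_card_independent by (metis dim_span)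
  also have "\<dots> = m" using ch by (simp add: card_image)
  finally show "dim V = m" .
  show "V \<subseteq> tangent_space m S (\<phi> x)"
    unfolding V_def tangent_space_def using assms(1,2) by blast
qed

text \<open>\<open>tangent_space\<close> is a union over all charts and not visibly a subspace. It
  is squeezed between the \<open>m\<close>-dimensional image of a single chart and an
  \<open>m\<close>-dimensional \<open>W\<close>.\<close>

lemma tangent_space_eqI:
  fixes S :: "'a::euclidean_space set"
  assumes "slice_chart m S e U \<phi>" "p \<in> S \<inter> \<phi> ` U" "tangent_space m S p \<subseteq> W" "subspace W" "dim W = m"
  shows "tangent_space m S p = W"
proof -
  obtain x where x: "x \<in> U \<inter> span (e ` {..<m})" "p = \<phi> x"
    using assms(1,2) unfolding slice_chart_def by blast
  let ?V = "frechet_derivative \<phi> (at x) ` span (e ` {..<m})"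
  have V: "subspace ?V" "dim ?V = m" "?V \<subseteq> tangent_space m S p"
    using slice_chart_tangent_image[OF assms(1) x(1)] x(2) by simp_all
  have "?V = W"
    by (rule subspace_dim_equal) (use V assms in auto)
  then show ?thesis using V assms(3) by blast
qed

lemma tangent_space_level:
  fixes S :: "'a::euclidean_space set"
  assumes "bounded_linear l" "\<And>q. q \<in> S \<Longrightarrow> l q = c" "w \<in> tangent_space m S p"
  shows "l w = 0"
  using assms slice_chart_derivative_tangent unfolding tangent_space_def by blast

text \<open>Here \<open>m\<close> is the dimension of the boundary of the domain: the slices and the
  lateral boundary have dimension \<open>Suc m\<close>, the whole space one more. The case
  \<open>m = 0\<close> is included.\<close>

locale oriented_lorentz = lorentz_basis +
  fixes ori :: "'a list \<Rightarrow> real" and m :: nat and p0 :: 'a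
  assumes ori: "alternating_form (DIM('a) - 1) ori"
    "\<exists>ws. length ws = DIM('a) - 1 \<and> set ws \<subseteq> W \<and> ori ws \<noteq> 0"
    and m: "DIM('a) = Suc (Suc m)"
begin

definition "R = {p0 + w | w. w \<in> W}"

lemma R_iff: "q \<in> R \<longleftrightarrow> b v q = b v p0"
proof -
  have "q \<in> R \<longleftrightarrow> q - p0 \<in> W" unfolding R_def by (auto simp: algebra_simps) (metis add.commute diff_add_cancel)
  then show ?thesis unfolding W_def by (simp add: linear_diff[OF l2])
qed

lemma length_gs: "length gs = Suc m"
  using G.length_fs dim_W m by simp

lemma ori': "alternating_form (Suc m) ori"
  using ori(1) m by simp

text \<open>On \<open>W\<close>, \<open>ori\<close> is up to sign \<open>c0\<close> times the volume
  form of \<open>h\<close>.\<close>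

definition "c0 = \<bar>ori gs\<bar>"

lemma c0_pos: "c0 > 0"
  unfolding c0_def using ori_const[OF ori] by simp

lemma abs_ori: "orthonormal_basis h W fs \<Longrightarrow> \<bar>ori fs\<bar> = c0"
  unfolding c0_def using ori_const[OF ori] by simp

lemma tangent_subset_W:
  assumes "S \<subseteq> R"
  shows "tangent_space k S p \<subseteq> W"
proof
  fix w assume "w \<in> tangent_space k S p"
  then have "b v w = 0"
    by (rule tangent_space_level[OF bl2, rotated]) (use assms R_iff in auto)
  then show "w \<in> W" unfolding W_def by simp
qed

lemma linear_hyperplane_form: "length ws = m \<Longrightarrow> linear (\<lambda>x. ori (x # ws))"
  using alternating_form_linear[OF ori', of "[]" ws] by simp

text \<open>The identity behind the divergence theorem: the exterior derivative of the contraction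
  of \<open>ori\<close> with \<open>Z\<close> is the divergence of \<open>Z\<close> times
  \<open>ori\<close>. In the summand of index \<open>i\<close>, all components of \<open>Z'\<close>
  except the one along \<open>fs ! i\<close> repeat an entry and drop out; moving
  \<open>fs ! i\<close> back to its place yields a sign that cancels the one in
  \<open>ext_deriv\<close>.\<close>

lemma hyperplane_ext_deriv:
  assumes Z: "(Z has_derivative Z') (at p)" and ZW: "\<And>q. Z q \<in> W" and fs: "orthonormal_basis h W fs"
  shows "ext_deriv (\<lambda>q ws. ori (Z q # ws)) p fs = ori fs * trace_of Z'"
proof -
  interpret F: lorentz_basis b v fs using fs by unfold_locales
  have len: "length fs = Suc m" using F.G.length_fs dim_W m by simp
  have Z'W: "Z' u \<in> W" for u
  proof -
    have "b v (Z q) = 0" for q using ZW unfolding W_def by blast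
    then have "((\<lambda>q. 0) has_derivative (\<lambda>u. b v (Z' u))) (at p)"
      using bounded_linear.has_derivative[OF bl2 Z, of v] by simp
    from fun_cong[OF has_derivative_unique[OF this has_derivative_const], of u]
    show ?thesis unfolding W_def by simp
  qed
  have summand: "(-1) ^ i * frechet_derivative (\<lambda>q. ori (Z q # take i fs @ drop (Suc i) fs)) (at p) (fs ! i)
      = ori fs * h (fs ! i) (Z' (fs ! i))" if i: "i < length fs" for i
  proof -
    let ?r = "take i fs @ drop (Suc i) fs"
    have lr: "length ?r = m" using i len by simp
    note lin = linear_hyperplane_form[OF lr]
    have "((\<lambda>q. ori (Z q # ?r)) has_derivative (\<lambda>u. ori (Z' u # ?r))) (at p)"
      using bounded_linear.has_derivative[OF _ Z] lin linear_conv_bounded_linear by blast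
    then have "frechet_derivative (\<lambda>q. ori (Z q # ?r)) (at p) = (\<lambda>u. ori (Z' u # ?r))"
      by (rule frechet_derivative_at[symmetric])
    then have "frechet_derivative (\<lambda>q. ori (Z q # ?r)) (at p) (fs ! i) = ori (Z' (fs ! i) # ?r)" by simp
    also have "\<dots> = (\<Sum>j<length fs. h (fs ! j) (Z' (fs ! i)) * ori (fs ! j # ?r))"
    proof -
      have "ori (Z' (fs ! i) # ?r) = ori ((\<Sum>j<length fs. h (fs ! j) (Z' (fs ! i)) *\<^sub>R fs ! j) # ?r)"
        using arg_cong[OF F.G.expansion[OF Z'W], of "\<lambda>x. ori (x # ?r)"] .
      then show ?thesis by (simp only: linear_sum[OF lin] linear_scale[OF lin] real_scaleR_def)
    qed
    also have "\<dots> = (\<Sum>j<length fs. if j = i then h (fs ! i) (Z' (fs ! i)) * ori (fs ! i # ?r) else 0)"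
    proof (intro sum.cong refl)
      fix j assume j: "j \<in> {..<length fs}"
      have "ori (fs ! j # ?r) = 0" if "j \<noteq> i"
      proof (rule alternating_form_eq_0[OF ori'])
        have "fs ! j \<in> set ?r"
        proof (cases "j < i")
          case True
          then have "take i fs ! j \<in> set (take i fs)" using i by (intro nth_mem) simp
          then show ?thesis using True by simp
        next
          case False
          then have "drop (Suc i) fs ! (j - Suc i) \<in> set (drop (Suc i) fs)"
            using j that by (intro nth_mem) auto
          moreover have "drop (Suc i) fs ! (j - Suc i) = fs ! j" using False j that by simp
          ultimately show ?thesis by simp
        qed
        then show "\<not> distinct (fs ! j # ?r)" by simp
      qed (use lr in simp)
      then show "h (fs ! j) (Z' (fs ! i)) * ori (fs ! j # ?r)
        = (if j = i then h (fs ! i) (Z' (fs ! i)) * ori (fs ! i # ?r) else 0)" by simp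
    qed
    also have "\<dots> = h (fs ! i) (Z' (fs ! i)) * ori (fs ! i # ?r)" using i by simp
    also have "ori (fs ! i # ?r) = (-1) ^ i * ori fs"
      using alternating_form_move[OF ori', of "[]" "take i fs" "drop (Suc i) fs" "fs ! i"] i len
      by (simp add: id_take_nth_drop[symmetric] min_def)
    finally have "frechet_derivative (\<lambda>q. ori (Z q # ?r)) (at p) (fs ! i) = (-1) ^ i * (ori fs * h (fs ! i) (Z' (fs ! i)))"
      by simp
    then show ?thesis by (simp add: mult.assoc[symmetric] power_mult_distrib[symmetric])
  qed
  have "ext_deriv (\<lambda>q ws. ori (Z q # ws)) p fs = (\<Sum>i<length fs. ori fs * h (fs ! i) (Z' (fs ! i)))"
    unfolding ext_deriv_def using summand by (intro sum.cong) auto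
  \<comment> \<open>As \<open>Z'\<close> takes values in \<open>W\<close>, the \<open>v\<close> term
    of the full trace vanishes; the minus signs in \<open>h\<close> and in
    \<open>trace_of_eq\<close> cancel.\<close>
  also have "\<dots> = ori fs * trace_of Z'"
    using F.trace_of_eq[of Z'] has_derivative_linear[OF Z] Z'W[of v]
    unfolding h_def W_def by (simp add: sum_distrib_left[symmetric] sum_negf)
  finally show ?thesis .
qed

lemma interior_coefficient:
  assumes Z: "(Z has_derivative Z') (at p)" and ZW: "\<And>q. Z q \<in> W"
  shows "form_coefficient h W ori (ext_deriv (\<lambda>q ws. ori (Z q # ws)) p) = c0 * trace_of Z'"
proof -
  let ?fs = "SOME fs. orthonormal_basis h W fs"
  have fs: "orthonormal_basis h W ?fs" using gs by (rule someI)
  have "form_coefficient h W ori (ext_deriv (\<lambda>q ws. ori (Z q # ws)) p) = sgn (ori ?fs) * (ori ?fs * trace_of Z')"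
    unfolding form_coefficient_def Let_def hyperplane_ext_deriv[OF assms fs] ..
  also have "\<dots> = \<bar>ori ?fs\<bar> * trace_of Z'" unfolding abs_sgn by (simp only: mult_ac)
  finally show ?thesis using abs_ori[OF fs] by simp
qed

definition normal_at :: "'a set \<Rightarrow> 'a \<Rightarrow> 'a \<Rightarrow> bool" where
  "normal_at S p \<nu> \<longleftrightarrow> \<nu> \<in> W \<and> h \<nu> \<nu> = 1 \<and> (\<forall>w\<in>tangent_space m S p. h \<nu> w = 0)"

lemma h_lin2: "linear (\<lambda>x. h y x)" by (rule G.lin2)

context
  fixes S p \<nu> e U \<phi>
  assumes S: "S \<subseteq> R" and ch: "slice_chart m S e U \<phi>" "p \<in> S \<inter> \<phi> ` U" and \<nu>: "normal_at S p \<nu>"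
begin

text \<open>Tangent vectors lie in \<open>W\<close> and are orthogonal to \<open>\<nu>\<close>, and
  splitting off \<open>\<nu>\<close> from \<open>W\<close> leaves exactly dimension
  \<open>m\<close>.\<close>

lemma tangent_space_boundary: "tangent_space m S p = {w \<in> W. h \<nu> w = 0}"
proof (rule tangent_space_eqI[OF ch])
  let ?T = "{w \<in> W. h \<nu> w = 0}"
  show "tangent_space m S p \<subseteq> ?T" using tangent_subset_W[OF S] \<nu> unfolding normal_at_def by blast
  show sub: "subspace ?T"
    using subspace_W unfolding subspace_def by (auto simp: linear_add[OF h_lin2] linear_scale[OF h_lin2] linear_0[OF h_lin2])
  have \<nu>W: "\<nu> \<in> W" "h \<nu> \<nu> = 1" using \<nu> unfolding normal_at_def by auto
  have "span (insert \<nu> ?T) = W"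
  proof
    show "span (insert \<nu> ?T) \<subseteq> W" using \<nu>W subspace_W by (intro span_minimal) auto
    show "W \<subseteq> span (insert \<nu> ?T)"
    proof
      fix x assume x: "x \<in> W"
      then have "x - h \<nu> x *\<^sub>R \<nu> \<in> ?T" using \<nu>W subspace_W
        by (simp add: subspace_diff subspace_scale linear_diff[OF h_lin2] linear_scale[OF h_lin2])
      then have "x - h \<nu> x *\<^sub>R \<nu> \<in> span ?T" by (rule span_base)
      then show "x \<in> span (insert \<nu> ?T)" using span_breakdown_eq[of x \<nu> ?T] by blast
    qed
  qed
  moreover have "\<nu> \<notin> span ?T" using \<nu>W unfolding span_eq_iff[THEN iffD2, OF sub] by simp
  ultimately have "dim W = Suc (dim ?T)" using dim_insert[of \<nu> ?T] by (metis Suc_eq_plus1 dim_span)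
  then show "dim ?T = m" using dim_W m by simp
qed

lemma boundary_basis:
  assumes "orthonormal_basis h {w \<in> W. h \<nu> w = 0} fs"
  shows "orthonormal_basis h W (\<nu> # fs)" and "length fs = m"
proof -
  let ?T = "{w \<in> W. h \<nu> w = 0}"
  have \<nu>W: "\<nu> \<in> W" "h \<nu> \<nu> = 1" using \<nu> unfolding normal_at_def by auto
  have span: "span (set fs) = ?T" and on: "\<And>i j. i < length fs \<Longrightarrow> j < length fs \<Longrightarrow> h (fs ! i) (fs ! j) = (if i = j then 1 else 0)"
    using assms unfolding orthonormal_basis_def by auto
  have f: "h \<nu> (fs ! i) = 0" "h (fs ! i) \<nu> = 0" if "i < length fs" for i
    using span_base[OF nth_mem[OF that]] span G.symm[of \<nu>] by auto
  have "span (set (\<nu> # fs)) = W"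
  proof
    have "set fs \<subseteq> W" using span span_superset by auto
    then show "span (set (\<nu> # fs)) \<subseteq> W" using \<nu>W subspace_W by (intro span_minimal) auto
    show "W \<subseteq> span (set (\<nu> # fs))"
    proof
      fix x assume x: "x \<in> W"
      then have "x - h \<nu> x *\<^sub>R \<nu> \<in> ?T" using \<nu>W subspace_W
        by (simp add: subspace_diff subspace_scale linear_diff[OF h_lin2] linear_scale[OF h_lin2])
      then show "x \<in> span (set (\<nu> # fs))" using span_breakdown_eq[of x \<nu> "set fs"] span by auto
    qed
  qed
  moreover have "h ((\<nu> # fs) ! i) ((\<nu> # fs) ! j) = (if i = j then 1 else 0)"
    if "i < length (\<nu> # fs)" "j < length (\<nu> # fs)" for i j
    using that on f \<nu>W by (cases i; cases j) auto
  ultimately show *: "orthonormal_basis h W (\<nu> # fs)" unfolding orthonormal_basis_def by blast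
  interpret F: lorentz_basis b v "\<nu> # fs" using * by unfold_locales
  show "length fs = m" using F.G.length_fs dim_W m by simp
qed

text \<open>Only the normal component of \<open>z\<close> survives, since its tangential components
  repeat an entry of the basis. Putting \<open>\<nu>\<close> first in the induced orientation makes
  the sign come out as plus.\<close>

lemma boundary_coefficient:
  assumes z: "z \<in> W"
  shows "form_coefficient h (tangent_space m S p) (\<lambda>fs. ori (\<nu> # fs)) (\<lambda>fs. ori (z # fs)) = c0 * h \<nu> z"
proof -
  let ?T = "{w \<in> W. h \<nu> w = 0}"
  let ?fs = "SOME fs. orthonormal_basis h ?T fs"
  have "subspace ?T"
    using subspace_W unfolding subspace_def by (auto simp: linear_add[OF h_lin2] linear_scale[OF h_lin2] linear_0[OF h_lin2])
  then have "pos_def_on h ?T" by (intro pos_def_on_subset[OF pos_def_h]) auto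
  then have fs: "orthonormal_basis h ?T ?fs" by (rule someI_ex[OF orthonormal_basis_exists])
  note bb = boundary_basis[OF fs]
  interpret F: lorentz_basis b v "\<nu> # ?fs" using bb(1) by unfold_locales
  note lin = linear_hyperplane_form[OF bb(2)]
  have "ori (z # ?fs) = (\<Sum>j<length (\<nu> # ?fs). h ((\<nu> # ?fs) ! j) z * ori ((\<nu> # ?fs) ! j # ?fs))"
  proof -
    have "ori (z # ?fs) = ori ((\<Sum>j<length (\<nu> # ?fs). h ((\<nu> # ?fs) ! j) z *\<^sub>R (\<nu> # ?fs) ! j) # ?fs)"
      using arg_cong[OF F.G.expansion[OF z], of "\<lambda>x. ori (x # ?fs)"] .
    then show ?thesis by (simp only: linear_sum[OF lin] linear_scale[OF lin] real_scaleR_def)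
  qed
  also have "\<dots> = (\<Sum>j<length (\<nu> # ?fs). if j = 0 then h \<nu> z * ori (\<nu> # ?fs) else 0)"
  proof (intro sum.cong refl)
    fix j assume j: "j \<in> {..<length (\<nu> # ?fs)}"
    show "h ((\<nu> # ?fs) ! j) z * ori ((\<nu> # ?fs) ! j # ?fs) = (if j = 0 then h \<nu> z * ori (\<nu> # ?fs) else 0)"
    proof (cases j)
      case (Suc i)
      then have "ori ((\<nu> # ?fs) ! j # ?fs) = 0"
        using j bb(2) by (intro alternating_form_eq_0[OF ori']) auto
      then show ?thesis using Suc by simp
    qed simp
  qed
  also have "\<dots> = h \<nu> z * ori (\<nu> # ?fs)" by simp
  finally have "ori (z # ?fs) = h \<nu> z * ori (\<nu> # ?fs)" .
  then have "form_coefficient h (tangent_space m S p) (\<lambda>fs. ori (\<nu> # fs)) (\<lambda>fs. ori (z # fs))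
    = \<bar>ori (\<nu> # ?fs)\<bar> * h \<nu> z"
    unfolding tangent_space_boundary form_coefficient_def Let_def abs_sgn by (simp only: mult_ac)
  then show ?thesis using abs_ori[OF bb(1)] by simp
qed

end

end

subsection \<open>Volume measures\<close>

text \<open>By Lindelof's theorem countably many of the open sets suffice. Made disjoint, they cut a
  Borel set into pieces on which the measures agree, and countable additivity does the rest without
  any finiteness.\<close>

lemma measure_eqI_open_cover:
  fixes M N :: "'a::second_countable_topology measure"
  assumes sets: "sets M = sets (restrict_space borel S)" "sets N = sets (restrict_space borel S)"
    and S: "S \<in> sets borel"
    and cover: "\<And>p. p \<in> S \<Longrightarrow> \<exists>G. open G \<and> p \<in> G \<and>
      (\<forall>B\<in>sets borel. B \<subseteq> S \<inter> G \<longrightarrow> emeasure M B = emeasure N B)"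
  shows "M = N"
proof (rule measure_eqI)
  show "sets M = sets N" using sets by simp
  fix B assume "B \<in> sets M"
  then have B: "B \<in> sets borel" "B \<subseteq> S"
    using S by (auto simp: sets sets_restrict_space_iff)
  define \<F> where "\<F> = {G. open G \<and> (\<forall>B\<in>sets borel. B \<subseteq> S \<inter> G \<longrightarrow> emeasure M B = emeasure N B)}"
  have "open G" if "G \<in> \<F>" for G using that unfolding \<F>_def by simp
  then obtain \<F>' where \<F>': "\<F>' \<subseteq> \<F>" "countable \<F>'" "\<Union>\<F>' = \<Union>\<F>"
    by (rule Lindelof)
  \<comment> \<open>Inserting the empty set guarantees a nonempty family, so that it can be
    enumerated even when \<open>S\<close> is empty.\<close>
  define G where "G = from_nat_into (insert {} \<F>')"
  have empty: "{} \<in> \<F>" unfolding \<F>_def by auto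
  have G: "G k \<in> \<F>" for k
  proof -
    have "G k \<in> insert {} \<F>'" unfolding G_def by (rule from_nat_into) simp
    then show ?thesis using empty \<F>'(1) by (rule_tac subsetD[of "insert {} \<F>'"]) simp_all
  qed
  have G_open: "open (G k)"
    and G_eq: "\<And>B. B \<in> sets borel \<Longrightarrow> B \<subseteq> S \<inter> G k \<Longrightarrow> emeasure M B = emeasure N B" for k
    using G[of k] unfolding \<F>_def by simp_all
  have rG: "range G = insert {} \<F>'"
    unfolding G_def using \<F>'(2) by (intro range_from_nat_into) auto
  have UG: "S \<subseteq> (\<Union>k. G k)"
  proof
    fix p assume "p \<in> S"
    from cover[OF this] have "p \<in> \<Union>\<F>" unfolding \<F>_def by (elim exE conjE) (rule UnionI, simp)
    then show "p \<in> (\<Union>k. G k)" unfolding rG using \<F>'(3) by simp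
  qed
  define B' where "B' k = B \<inter> disjointed G k" for k
  have "range (disjointed G) \<subseteq> sets borel"
    by (rule sets.range_disjointed_sets) (use G_open in auto)
  then have B'_sets: "B' k \<in> sets borel" for k
    unfolding B'_def using B(1) by (intro sets.Int) auto
  have B'_sets': "range B' \<subseteq> sets M" "range B' \<subseteq> sets N"
  proof -
    have "B' k \<subseteq> S" for k using B(2) unfolding B'_def by auto
    then have "B' k \<in> sets (restrict_space borel S)" for k
      using B'_sets S by (simp add: sets_restrict_space_iff)
    then show "range B' \<subseteq> sets M" "range B' \<subseteq> sets N" unfolding sets by auto
  qed
  have disj: "disjoint_family B'"
    using disjoint_family_disjointed[of G] unfolding disjoint_family_on_def B'_def by auto
  have UB: "(\<Union>k. B' k) = B"
  proof -
    have "(\<Union>k. B' k) = B \<inter> (\<Union>k. disjointed G k)" unfolding B'_def by simp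
    also have "\<dots> = B" using UG B(2) unfolding UN_disjointed_eq by auto
    finally show ?thesis .
  qed
  have "emeasure M (B' k) = emeasure N (B' k)" for k
  proof -
    have "B' k \<subseteq> S \<inter> G k" using B(2) disjointed_subset[of G k] unfolding B'_def by auto
    then show ?thesis by (rule G_eq[OF B'_sets])
  qed
  then have "(\<Sum>k. emeasure M (B' k)) = (\<Sum>k. emeasure N (B' k))" by simp
  then show "emeasure M B = emeasure N B"
    using suminf_emeasure[OF B'_sets'(1) disj] suminf_emeasure[OF B'_sets'(2) disj] UB by simp
qed

text \<open>The chart formula fixes the measure inside every chart image. This identifies the
  measures hidden in the existential of \<open>has_form_integral\<close> for different
  forms.\<close>

lemma volume_measure_unique:
  assumes "volume_measure h m S \<mu>" "volume_measure h m S \<mu>'" "S \<in> sets borel"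
    and chart: "\<And>p. p \<in> S \<Longrightarrow> \<exists>e U \<phi>. slice_chart m S e U \<phi> \<and> p \<in> \<phi> ` U"
  shows "\<mu> = \<mu>'"
proof (rule measure_eqI_open_cover[OF _ _ assms(3)])
  show "sets \<mu> = sets (restrict_space borel S)" "sets \<mu>' = sets (restrict_space borel S)"
    using assms(1,2) unfolding volume_measure_def by auto
  fix p assume "p \<in> S"
  then obtain e U \<phi> where c: "slice_chart m S e U \<phi>" "p \<in> \<phi> ` U" using chart by blast
  then have "open (\<phi> ` U)" unfolding slice_chart_def by blast
  moreover have "emeasure \<mu> B = emeasure \<mu>' B" if "B \<in> sets borel" "B \<subseteq> S \<inter> \<phi> ` U" for B
    using assms(1,2) c that unfolding volume_measure_def by simp
  ultimately show "\<exists>G. open G \<and> p \<in> G \<and> (\<forall>B\<in>sets borel. B \<subseteq> S \<inter> G \<longrightarrow> emeasure \<mu> B = emeasure \<mu>' B)"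
    using c(2) by blast
qed

text \<open>A chart of \<open>F\<close> is a chart of its smooth part as well: every point of
  \<open>F\<close> in the chart image is smooth by virtue of that same chart.\<close>

lemma smooth_part_chart:
  assumes "p \<in> smooth_part m F"
  shows "\<exists>e U \<phi>. slice_chart m (smooth_part m F) e U \<phi> \<and> p \<in> \<phi> ` U"
proof -
  obtain e U \<phi> where c: "slice_chart m F e U \<phi>" "p \<in> \<phi> ` U"
    using assms unfolding smooth_part_def by blast
  have "smooth_part m F \<inter> \<phi> ` U = F \<inter> \<phi> ` U" using c(1) unfolding smooth_part_def by blast
  then have "slice_chart m (smooth_part m F) e U \<phi>" using c(1) unfolding slice_chart_def by simp
  then show ?thesis using c(2) by blast
qed

lemma smooth_part_borel:
  assumes "closed F"
  shows "smooth_part m F \<in> sets borel"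
proof -
  let ?G = "\<Union>{\<phi> ` U | e U \<phi>. slice_chart m F e U \<phi>}"
  have "smooth_part m F = F \<inter> ?G" unfolding smooth_part_def by blast
  moreover have "open ?G" by (rule open_Union) (auto simp: slice_chart_def)
  ultimately show ?thesis using assms by auto
qed

lemma volume_measure_space: "volume_measure h m S \<mu> \<Longrightarrow> space \<mu> = S"
  unfolding volume_measure_def using sets_eq_imp_space_eq[of \<mu> "restrict_space borel S"]
  by (simp add: space_restrict_space)

lemma volume_measure_measurable:
  assumes "volume_measure h m S \<mu>" "f \<in> borel_measurable borel"
  shows "f \<in> borel_measurable \<mu>"
proof -
  have "sets \<mu> = sets (restrict_space borel S)" using assms unfolding volume_measure_def by blast
  from measurable_cong_sets[OF this refl] show ?thesis
    using measurable_restrict_space1[OF assms(2)] by blast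
qed

lemma slice_par_measurable[measurable]:
  "slice_par m e \<in> borel_measurable (Pi\<^sub>M {..<m} (\<lambda>_. lborel))"
  unfolding slice_par_def[abs_def] by measurable

lemma slice_par_in_span: "slice_par m e x \<in> span (e ` {..<m})"
  unfolding slice_par_def by (intro span_sum span_scale span_base) auto

context oriented_lorentz
begin

text \<open>Since \<open>b v v = 1\<close> and \<open>b v\<close> is constant on \<open>R\<close>,
  the time coordinate is \<open>b v q - b v p0\<close> and the projection to \<open>R\<close> is
  explicit, which makes measurability and continuity accessible.\<close>

lemma cylinder_iff:
  assumes "S \<subseteq> R"
  shows "q \<in> cylinder v J S \<longleftrightarrow> q - (b v q - b v p0) *\<^sub>R v \<in> S \<and> b v q - b v p0 \<in> J"
proof
  assume "q \<in> cylinder v J S"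
  then obtain p t where q: "q = p + t *\<^sub>R v" "t \<in> J" "p \<in> S" unfolding cylinder_def by blast
  then have "b v p = b v p0" using assms R_iff by blast
  then have "b v q - b v p0 = t" using q bvv by (simp add: linear_add[OF l2] linear_scale[OF l2])
  then show "q - (b v q - b v p0) *\<^sub>R v \<in> S \<and> b v q - b v p0 \<in> J" using q by simp
next
  assume a: "q - (b v q - b v p0) *\<^sub>R v \<in> S \<and> b v q - b v p0 \<in> J"
  have "q = (q - (b v q - b v p0) *\<^sub>R v) + (b v q - b v p0) *\<^sub>R v" by simp
  then show "q \<in> cylinder v J S" using a unfolding cylinder_def by blast
qed

lemma continuous_on_b: "continuous_on A (\<lambda>q. b v q)"
  by (rule linear_continuous_on[OF bl2])

lemma continuous_on_proj: "continuous_on A (\<lambda>q. q - (b v q - b v p0) *\<^sub>R v)"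
  by (intro continuous_intros continuous_on_b)

lemma cylinder_borel:
  assumes "S \<subseteq> R" "S \<in> sets borel" "J \<in> sets borel"
  shows "cylinder v J S \<in> sets borel"
proof -
  have "cylinder v J S = ((\<lambda>q. q - (b v q - b v p0) *\<^sub>R v) -` S \<inter> space borel) \<inter> ((\<lambda>q. b v q - b v p0) -` J \<inter> space borel)"
    using cylinder_iff[OF assms(1)] by auto
  moreover have "(\<lambda>q. q - (b v q - b v p0) *\<^sub>R v) \<in> borel_measurable borel" "(\<lambda>q. b v q - b v p0) \<in> borel_measurable borel"
    by (intro borel_measurable_continuous_onI continuous_on_proj continuous_intros continuous_on_b)+
  ultimately show ?thesis
    using assms by (simp only:) (intro sets.Int measurable_sets)
qed

text \<open>One affine chart covers the whole slice. Its frame \<open>gs\<close> is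
  \<open>h\<close>-orthonormal, so the density is 1 and the volume is Lebesgue measure in these
  coordinates.\<close>

lemma hyperplane_chart:
  assumes "\<Omega> = R \<inter> G" "open G"
  shows "slice_chart (Suc m) (cylinder v {t} \<Omega>) (nth gs) {x. p0 + x \<in> G} (\<lambda>x. p0 + t *\<^sub>R v + x)"
proof -
  let ?U = "{x. p0 + x \<in> G}" and ?\<phi> = "\<lambda>x. p0 + t *\<^sub>R v + x"
  have e: "(nth gs) ` {..<Suc m} = set gs" using length_gs by (auto simp: set_conv_nth)
  have U: "open ?U" using open_vimage[OF \<open>open G\<close>, of "\<lambda>x. p0 + x"] by (simp add: vimage_def continuous_intros)
  have inj: "inj_on ?\<phi> A" for A by (auto intro: inj_onI)
  have im: "?\<phi> ` ?U = {q. q - t *\<^sub>R v \<in> G}"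
    by (auto simp: image_iff algebra_simps intro!: exI[of _ "_ - (p0 + t *\<^sub>R v)"])
  have imo: "open (?\<phi> ` ?U)" using open_vimage[OF \<open>open G\<close>, of "\<lambda>q. q - t *\<^sub>R v"]
    unfolding im by (simp add: vimage_def continuous_intros)
  have "smooth_on (?\<phi> ` ?U) (\<lambda>q. - (p0 + t *\<^sub>R v) + q)"
    using imo by (intro smooth_on_add smooth_on_const smooth_on_ident)
  moreover have "- (p0 + t *\<^sub>R v) + q = inv_into ?U ?\<phi> q" if q: "q \<in> ?\<phi> ` ?U" for q
  proof -
    obtain x where x: "q = ?\<phi> x" "x \<in> ?U" using q by blast
    show ?thesis using inv_into_f_f[OF inj x(2)] x(1) by simp
  qed
  ultimately have "smooth_on (?\<phi> ` ?U) (inv_into ?U ?\<phi>)"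
    using smooth_on_cong[OF imo] by blast
  moreover have "?\<phi> ` (?U \<inter> W) = cylinder v {t} \<Omega> \<inter> ?\<phi> ` ?U"
    unfolding im using assms unfolding cylinder_def R_def
    by (auto simp: image_iff algebra_simps)
  ultimately show ?thesis
    unfolding slice_chart_def e
    using U imo inj G.independent_fs G.span_fs inj_on_nth[OF G.distinct_fs] length_gs
    by (auto intro!: smooth_on_add smooth_on_const smooth_on_ident)
qed

lemma hyperplane_density: "volume_density (\<lambda>p. h) (Suc m) (nth gs) (\<lambda>x. c + x) y = 1"
proof -
  have "((\<lambda>x. c + x) has_derivative (\<lambda>x. x)) (at y)" by (auto intro!: derivative_eq_intros)
  then have "frechet_derivative (\<lambda>x. c + x) (at y) = (\<lambda>x. x)" by (rule frechet_derivative_at[symmetric])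
  moreover have "Matrix.mat (Suc m) (Suc m) (\<lambda>(i, j). h (gs ! i) (gs ! j)) = 1\<^sub>m (Suc m)"
    using G.on length_gs by (intro eq_matI) auto
  ultimately show ?thesis unfolding volume_density_def by simp
qed

lemma hyperplane_volume:
  assumes \<Omega>: "\<Omega> = R \<inter> G" "open G" and \<sigma>: "volume_measure (\<lambda>p. h) (Suc m) (cylinder v {t} \<Omega>) \<sigma>"
    and B: "B \<in> sets borel" "B \<subseteq> cylinder v {t} \<Omega>"
  shows "emeasure \<sigma> B = (\<integral>\<^sup>+x. indicator {x. p0 + t *\<^sub>R v + slice_par (Suc m) (nth gs) x \<in> B} x \<partial>Pi\<^sub>M {..<Suc m} (\<lambda>_. lborel))"
proof -
  let ?U = "{x. p0 + x \<in> G}" and ?\<phi> = "\<lambda>x. p0 + t *\<^sub>R v + x"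
  have *: "x \<in> ?U" if "?\<phi> x \<in> B" for x
  proof -
    have "?\<phi> x \<in> cylinder v {t} \<Omega>" using that B by blast
    then show ?thesis unfolding cylinder_def \<Omega>(1) by (auto simp: algebra_simps)
  qed
  have "B \<subseteq> ?\<phi> ` ?U"
  proof
    fix q assume "q \<in> B"
    then have "?\<phi> (q - (p0 + t *\<^sub>R v)) \<in> B" by simp
    with *[OF this] show "q \<in> ?\<phi> ` ?U" by (intro image_eqI[of _ _ "q - (p0 + t *\<^sub>R v)"]) auto
  qed
  then have "emeasure \<sigma> B = (\<integral>\<^sup>+x. indicator {x. slice_par (Suc m) (nth gs) x \<in> ?U \<and> ?\<phi> (slice_par (Suc m) (nth gs) x) \<in> B} x
      * ennreal (volume_density (\<lambda>p. h) (Suc m) (nth gs) ?\<phi> (slice_par (Suc m) (nth gs) x)) \<partial>Pi\<^sub>M {..<Suc m} (\<lambda>_. lborel))"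
    using \<sigma> hyperplane_chart[OF \<Omega>, of t] B unfolding volume_measure_def by simp
  also have "\<dots> = (\<integral>\<^sup>+x. indicator {x. ?\<phi> (slice_par (Suc m) (nth gs) x) \<in> B} x \<partial>Pi\<^sub>M {..<Suc m} (\<lambda>_. lborel))"
    unfolding hyperplane_density by (intro nn_integral_cong) (use * in \<open>auto simp: indicator_def\<close>)
  finally show ?thesis .
qed

lemma cylinder_0: "cylinder v {0} \<Omega> = \<Omega>"
  unfolding cylinder_def by simp

text \<open>In the affine charts of two slices, the translation by \<open>t *\<^sub>R v\<close> only
  shifts the base point and leaves the coordinates alone.\<close>

lemma translated_volume:
  assumes \<Omega>: "\<Omega> = R \<inter> G" "open G" "\<Omega> \<in> sets borel"
    and \<mu>: "volume_measure (\<lambda>p. h) (Suc m) \<Omega> \<mu>"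
    and \<sigma>: "volume_measure (\<lambda>p. h) (Suc m) (cylinder v {t} \<Omega>) \<sigma>"
  shows "(\<lambda>p. p + t *\<^sub>R v) \<in> measurable \<mu> \<sigma>" and "\<sigma> = distr \<mu> \<sigma> (\<lambda>p. p + t *\<^sub>R v)"
proof -
  let ?C = "cylinder v {t} \<Omega>" and ?f = "\<lambda>p. p + t *\<^sub>R v"
  have C: "?C \<in> sets borel" using cylinder_borel[of \<Omega> "{t}"] \<Omega> by auto
  have s\<mu>: "sets \<mu> = sets (restrict_space borel \<Omega>)" and s\<sigma>: "sets \<sigma> = sets (restrict_space borel ?C)"
    using \<mu> \<sigma> unfolding volume_measure_def by auto
  have "?f \<in> measurable (restrict_space borel \<Omega>) (restrict_space borel ?C)"
    by (intro measurable_restrict_space2 measurable_restrict_space1)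
       (auto simp: cylinder_def space_restrict_space)
  then show meas: "?f \<in> measurable \<mu> \<sigma>"
    using measurable_cong_sets[OF s\<mu> s\<sigma>] by blast
  show "\<sigma> = distr \<mu> \<sigma> ?f"
  proof (rule measure_eqI)
    fix B assume "B \<in> sets \<sigma>"
    then have B: "B \<in> sets borel" "B \<subseteq> ?C" using C by (auto simp: s\<sigma> sets_restrict_space_iff)
    let ?B = "?f -` B \<inter> space \<mu>"
    have "?B \<in> sets \<mu>" using measurable_sets[OF meas \<open>B \<in> sets \<sigma>\<close>] .
    then have B': "?B \<in> sets borel" "?B \<subseteq> cylinder v {0} \<Omega>"
      using \<Omega>(3) by (auto simp: s\<mu> sets_restrict_space_iff cylinder_0)
    have \<mu>0: "volume_measure (\<lambda>p. h) (Suc m) (cylinder v {0} \<Omega>) \<mu>" using \<mu> by (simp add: cylinder_0)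
    have iff: "p \<in> ?B \<longleftrightarrow> p + t *\<^sub>R v \<in> B" for p
    proof -
      have "p \<in> \<Omega>" if pB: "p + t *\<^sub>R v \<in> B"
      proof -
        obtain p' where "p + t *\<^sub>R v = p' + t *\<^sub>R v" "p' \<in> \<Omega>" using subsetD[OF B(2) pB] unfolding cylinder_def by auto
        then show ?thesis by simp
      qed
      then show ?thesis using volume_measure_space[OF \<mu>] by auto
    qed
    have "emeasure (distr \<mu> \<sigma> ?f) B = emeasure \<mu> ?B"
      using meas \<open>B \<in> sets \<sigma>\<close> by (rule emeasure_distr)
    also have "\<dots> = emeasure \<sigma> B"
      unfolding hyperplane_volume[OF \<Omega>(1,2) \<mu>0 B'] hyperplane_volume[OF \<Omega>(1,2) \<sigma> B] iff
      by (simp add: algebra_simps)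
    finally show "emeasure \<sigma> B = emeasure (distr \<mu> \<sigma> ?f) B" by simp
  qed simp
qed

lemma tangent_space_hyperplane:
  assumes \<Omega>: "\<Omega> = R \<inter> G" "open G" and p: "p \<in> \<Omega>"
  shows "tangent_space (Suc m) \<Omega> p = W"
proof (rule tangent_space_eqI)
  show "slice_chart (Suc m) \<Omega> (nth gs) {x. p0 + x \<in> G} (\<lambda>x. p0 + x)"
    using hyperplane_chart[OF \<Omega>, of 0] by (simp add: cylinder_0)
  show "p \<in> \<Omega> \<inter> (\<lambda>x. p0 + x) ` {x. p0 + x \<in> G}"
    using p \<Omega>(1) by (auto intro!: image_eqI[of _ _ "p - p0"])
  show "tangent_space (Suc m) \<Omega> p \<subseteq> W" using tangent_subset_W \<Omega>(1) by blast
  show "dim W = Suc m" using dim_W m by simp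
qed (rule subspace_W)

end

subsection \<open>A chart of the cylinder\<close>

text \<open>Supplies the two coordinates transverse to the slice of a boundary chart. The Euclidean
  product is used here because the slice is an arbitrary subspace, on which \<open>b\<close> may
  degenerate.\<close>

lemma complement_two_vectors:
  fixes E :: "'a::euclidean_space set"
  assumes "subspace E" "Suc (Suc (dim E)) = DIM('a)"
  obtains n0 n1 where "inner n0 n0 = 1" "inner n1 n1 = 1" "inner n0 n1 = 0"
    "\<And>y. y \<in> E \<Longrightarrow> inner y n0 = 0" "\<And>y. y \<in> E \<Longrightarrow> inner y n1 = 0"
    "\<And>u. u - inner u n0 *\<^sub>R n0 - inner u n1 *\<^sub>R n1 \<in> E"
proof -
  define E' where "E' = {x. \<forall>y\<in>E. Linear_Algebra.orthogonal y x}"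
  have sub: "subspace E'" unfolding E'_def by (rule subspace_orthogonal_to_vectors)
  have pd: "pos_def_on inner E'"
    unfolding pos_def_on_def using sub
    by (auto simp: bilinear_conv_bounded_bilinear bounded_bilinear_inner inner_commute)
  obtain ns where "orthonormal_basis inner E' ns" using orthonormal_basis_exists[OF pd] by (elim exE)
  then interpret N: orthonormal inner E' ns using pd by unfold_locales
  have "dim {y \<in> UNIV. \<forall>x \<in> E. Linear_Algebra.orthogonal x y} + dim E = dim (UNIV :: 'a set)"
    using assms(1) by (intro dim_subspace_orthogonal_to_vectors) auto
  then have "length ns = 2" using N.length_fs assms(2) unfolding E'_def by simp
  then have set2: "{..<length ns} = {0, 1}" and len: "0 < length ns" "1 < length ns" by auto
  show thesis
  proof (rule that[of "ns ! 0" "ns ! 1"])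
    show "inner (ns ! 0) (ns ! 0) = 1" "inner (ns ! 1) (ns ! 1) = 1" "inner (ns ! 0) (ns ! 1) = 0"
      using N.on len by auto
    show *: "inner y (ns ! 0) = 0" "inner y (ns ! 1) = 0" if "y \<in> E" for y
      using N.fs_in[OF len(1)] N.fs_in[OF len(2)] that unfolding E'_def Linear_Algebra.orthogonal_def by auto
    fix u
    obtain y z where y: "y \<in> span E" and z: "\<And>w. w \<in> span E \<Longrightarrow> Linear_Algebra.orthogonal z w" and u: "u = y + z"
      using orthogonal_subspace_decomp_exists by blast
    have yE: "y \<in> E" using y assms(1) span_eq_iff by blast
    have "z \<in> E'" unfolding E'_def using z span_base by (auto simp: orthogonal_commute)
    from N.expansion[OF this] have "z = inner (ns ! 0) z *\<^sub>R ns ! 0 + inner (ns ! 1) z *\<^sub>R ns ! 1"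
      unfolding set2 by simp
    moreover have "inner u (ns ! 0) = inner (ns ! 0) z" "inner u (ns ! 1) = inner (ns ! 1) z"
      unfolding u using *[OF yE] by (simp_all add: inner_add_left inner_commute)
    ultimately have "u - inner u (ns ! 0) *\<^sub>R ns ! 0 - inner u (ns ! 1) *\<^sub>R ns ! 1 = y"
      using u by (simp add: algebra_simps)
    then show "u - inner u (ns ! 0) *\<^sub>R ns ! 0 - inner u (ns ! 1) *\<^sub>R ns ! 1 \<in> E" using yE by simp
  qed
qed

context oriented_lorentz
begin

text \<open>
  The chart is \<open>u \<mapsto> \<phi> (Pr u) + s \<nu> + t v\<close>, where \<open>Pr\<close> is the projection onto the slice of \<open>\<phi>\<close> and \<open>s\<close>, \<open>t\<close> are
  the two remaining coordinates; the normal \<open>\<nu>\<close> at the base point makes it a local diffeomorphism.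
\<close>

lemma cylinder_chart:
  assumes S: "S \<subseteq> R" and ch: "slice_chart m S e U \<phi>" and p: "p \<in> S \<inter> \<phi> ` U" and \<nu>: "normal_at S p \<nu>"
    and \<tau>: "\<tau> \<in> {a<..<b'}"
  obtains n U' \<Phi> where "slice_chart (Suc m) (cylinder v {a<..<b'} S) (e(m := n)) U' \<Phi>" "p + \<tau> *\<^sub>R v \<in> \<Phi> ` U'"
    "\<And>y t. y \<in> span (e ` {..<m}) \<Longrightarrow> \<Phi> (y + t *\<^sub>R n) = \<phi> y + t *\<^sub>R v"
    "\<And>y t. y \<in> span (e ` {..<m}) \<Longrightarrow> y + t *\<^sub>R n \<in> U' \<Longrightarrow> y \<in> U"
    "\<And>y t. y \<in> span (e ` {..<m}) \<Longrightarrow> y \<in> U \<Longrightarrow> \<phi> y + t *\<^sub>R v \<in> \<Phi> ` U' \<Longrightarrow> y + t *\<^sub>R n \<in> U'"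
    "\<And>y t u. y \<in> span (e ` {..<m}) \<Longrightarrow> y + t *\<^sub>R n \<in> U' \<Longrightarrow> u \<in> span (e ` {..<m}) \<Longrightarrow>
        frechet_derivative \<Phi> (at (y + t *\<^sub>R n)) u = frechet_derivative \<phi> (at y) u"
    "\<And>y t. y \<in> span (e ` {..<m}) \<Longrightarrow> y + t *\<^sub>R n \<in> U' \<Longrightarrow> frechet_derivative \<Phi> (at (y + t *\<^sub>R n)) n = v"
proof -
  note c = ch[unfolded slice_chart_def]
  let ?E = "span (e ` {..<m})"
  let ?C = "cylinder v {a<..<b'} S"
  have inj_e: "inj_on e {..<m}" and ind_e: "independent (e ` {..<m})" and U: "open U" and sm: "smooth_on U \<phi>"
    and inj_\<phi>: "inj_on \<phi> U" and o\<phi>: "open (\<phi> ` U)" and smi: "smooth_on (\<phi> ` U) (inv_into U \<phi>)"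
    and sl: "\<phi> ` (U \<inter> ?E) = S \<inter> \<phi> ` U"
    using c by simp_all
  have "dim ?E = m" using dim_eq_card_independent[OF ind_e] card_image[OF inj_e] by simp
  then have "Suc (Suc (dim ?E)) = DIM('a)" using m by simp
  then obtain n0 n1 where n: "inner n0 n0 = 1" "inner n1 n1 = 1" "inner n0 n1 = 0"
    and nE: "\<And>y. y \<in> ?E \<Longrightarrow> inner y n0 = 0" "\<And>y. y \<in> ?E \<Longrightarrow> inner y n1 = 0"
    and PrE: "\<And>u. u - inner u n0 *\<^sub>R n0 - inner u n1 *\<^sub>R n1 \<in> ?E"
    using complement_two_vectors[OF subspace_span] by metis
  define Pr where "Pr u = u - inner u n0 *\<^sub>R n0 - inner u n1 *\<^sub>R n1" for u
  have linPr: "linear Pr"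
    unfolding Pr_def by (rule linearI) (simp_all add: inner_add_left algebra_simps)
  have Pr_in: "Pr u \<in> ?E" for u using PrE unfolding Pr_def .
  have Pr_decomp: "u = Pr u + inner u n0 *\<^sub>R n0 + inner u n1 *\<^sub>R n1" for u unfolding Pr_def by simp
  have coords: "Pr (y + t *\<^sub>R n1) = y" "inner (y + t *\<^sub>R n1) n0 = 0" "inner (y + t *\<^sub>R n1) n1 = t" if "y \<in> ?E" for y t
    using nE[OF that] n unfolding Pr_def by (simp_all add: inner_add_left inner_commute[of n1 n0])
  have coords0: "Pr y = y" "inner y n0 = 0" "inner y n1 = 0" if "y \<in> ?E" for y
    using nE[OF that] unfolding Pr_def by simp_all
  define \<Phi> where "\<Phi> u = \<phi> (Pr u) + inner u n0 *\<^sub>R \<nu> + inner u n1 *\<^sub>R v" for u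
  define U0 where "U0 = Pr -` U"
  have blPr: "bounded_linear Pr" using linPr linear_conv_bounded_linear by blast
  have U0: "open U0" unfolding U0_def using U linear_continuous_on[OF blPr] by (intro open_vimage) auto
  have sm\<Phi>: "smooth_on U0 \<Phi>"
    unfolding \<Phi>_def
  proof (intro smooth_on_add U0)
    show "smooth_on U0 (\<lambda>u. \<phi> (Pr u))"
      using U0_def by (intro smooth_on_compose[OF U0 _ sm] smooth_on_linear[OF linPr U0]) auto
    have "linear (\<lambda>u. inner u n0 *\<^sub>R \<nu>)" "linear (\<lambda>u. inner u n1 *\<^sub>R v)"
      by (auto intro!: linearI simp: inner_add_left algebra_simps)
    then show "smooth_on U0 (\<lambda>u. inner u n0 *\<^sub>R \<nu>)" "smooth_on U0 (\<lambda>u. inner u n1 *\<^sub>R v)"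
      using smooth_on_linear U0 by blast+
  qed
  have D\<Phi>: "frechet_derivative \<Phi> (at u) = (\<lambda>w. frechet_derivative \<phi> (at (Pr u)) (Pr w) + inner w n0 *\<^sub>R \<nu> + inner w n1 *\<^sub>R v)"
    if u: "u \<in> U0" for u
  proof -
    have "(Pr has_derivative Pr) (at u)" using bounded_linear_imp_has_derivative[OF blPr] .
    moreover have "(\<phi> has_derivative frechet_derivative \<phi> (at (Pr u))) (at (Pr u))"
      using slice_chart_derivative(1)[OF ch] u U0_def by simp
    ultimately have "((\<lambda>u. \<phi> (Pr u)) has_derivative (\<lambda>w. frechet_derivative \<phi> (at (Pr u)) (Pr w))) (at u)"
      by (rule has_derivative_compose)
    then have "(\<Phi> has_derivative (\<lambda>w. frechet_derivative \<phi> (at (Pr u)) (Pr w) + inner w n0 *\<^sub>R \<nu> + inner w n1 *\<^sub>R v)) (at u)"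
      unfolding \<Phi>_def
      by (intro has_derivative_add has_derivative_scaleR_left has_derivative_inner_left has_derivative_ident)
    then show ?thesis by (rule frechet_derivative_at[symmetric])
  qed
  obtain x0 where x0: "x0 \<in> U \<inter> ?E" "\<phi> x0 = p" using p unfolding sl[symmetric] by auto
  let ?u0 = "x0 + \<tau> *\<^sub>R n1"
  have u0: "?u0 \<in> U0" unfolding U0_def using coords(1) x0 by simp
  have \<nu>': "\<nu> \<in> W" "h \<nu> \<nu> = 1" "\<And>w. w \<in> tangent_space m S p \<Longrightarrow> h \<nu> w = 0"
    using \<nu> unfolding normal_at_def by auto
  have tangent: "frechet_derivative \<phi> (at x0) u \<in> tangent_space m S p" if "u \<in> ?E" for u
    using subsetD[OF slice_chart_tangent_image(3)[OF ch x0(1)] imageI[OF that]] unfolding x0(2) .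
  \<comment> \<open>Three tests separate the summands of the derivative: \<open>b v\<close> kills
    everything except the time part, \<open>h \<nu>\<close> then isolates the normal part, and what
    remains is the injective derivative of \<open>\<phi>\<close>.\<close>
  have "inj (frechet_derivative \<Phi> (at ?u0))"
  proof -
    have lin: "linear (frechet_derivative \<Phi> (at ?u0))"
      using smooth_on_derivative(1)[OF sm\<Phi> u0] has_derivative_linear by blast
    have "w = 0" if w: "frechet_derivative \<Phi> (at ?u0) w = 0" for w
    proof -
      let ?d = "frechet_derivative \<phi> (at x0) (Pr w)"
      have eq: "?d + inner w n0 *\<^sub>R \<nu> + inner w n1 *\<^sub>R v = 0"
        using w D\<Phi>[OF u0] coords(1) x0 by simp
      have d: "?d \<in> tangent_space m S p" by (rule tangent[OF Pr_in])
      then have "b v ?d = 0" "b v \<nu> = 0" using tangent_subset_W[OF S] \<nu>'(1) unfolding W_def by auto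
      moreover have "b v (?d + inner w n0 *\<^sub>R \<nu> + inner w n1 *\<^sub>R v) = 0" unfolding eq by (rule linear_0[OF l2])
      ultimately have t: "inner w n1 = 0" using bvv by (simp add: linear_add[OF l2] linear_scale[OF l2])
      have "h \<nu> (?d + inner w n0 *\<^sub>R \<nu> + inner w n1 *\<^sub>R v) = 0" unfolding eq by (rule linear_0[OF h_lin2])
      then have s: "inner w n0 = 0" using t \<nu>'(2) \<nu>'(3)[OF d] by (simp add: linear_add[OF h_lin2] linear_scale[OF h_lin2])
      have "?d = 0" using eq s t by simp
      then have "Pr w = 0"
        using slice_chart_derivative(2,3)[OF ch, of x0] x0(1) by (auto simp: linear_injective_0)
      then show ?thesis using Pr_decomp[of w] s t by simp
    qed
    then show ?thesis using linear_injective_0[OF lin] by blast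
  qed
  from smooth_local_diffeomorphism[OF U0 sm\<Phi> u0 this]
  obtain U1 \<psi> where U1: "open U1" "U1 \<subseteq> U0" "?u0 \<in> U1" "open (\<Phi> ` U1)" "smooth_on (\<Phi> ` U1) \<psi>"
    and \<psi>: "\<And>y. y \<in> U1 \<Longrightarrow> \<psi> (\<Phi> y) = y" by metis
  define \<pi> where "\<pi> q = q - (b v q - b v p0) *\<^sub>R v" for q
  define T where "T q = b v q - b v p0" for q
  have \<pi>T: "\<pi> (x + t *\<^sub>R v) = x" "T (x + t *\<^sub>R v) = t" if "x \<in> S" for x t
  proof -
    have "b v x = b v p0" using S R_iff that by blast
    then show "\<pi> (x + t *\<^sub>R v) = x" "T (x + t *\<^sub>R v) = t"
      unfolding \<pi>_def T_def using bvv by (simp_all add: linear_add[OF l2] linear_scale[OF l2])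
  qed
  \<comment> \<open>The slice condition needs more than a diffeomorphism: every point of the
    cylinder in the image has to come from a slice point of the domain. \<open>\<kappa>\<close>
    rebuilds that slice point from projection and time, and \<open>G\<close> retains the points for
    which it falls into \<open>U1\<close>. The time window in \<open>H\<close> keeps images of slice
    points inside the cylinder.\<close>
  define H where "H = \<Phi> ` U1 \<inter> \<pi> -` (\<phi> ` U) \<inter> T -` {a<..<b'}"
  define \<kappa> where "\<kappa> q = inv_into U \<phi> (\<pi> q) + T q *\<^sub>R n1" for q
  define G where "G = H \<inter> \<kappa> -` U1"
  have cont: "continuous_on A \<pi>" "continuous_on A T" for A
    unfolding \<pi>_def T_def by (intro continuous_on_proj continuous_intros continuous_on_b)+
  have oH: "open H" unfolding H_def using U1(4) o\<phi> cont by (intro open_Int open_vimage) auto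
  have "continuous_on H \<kappa>"
    unfolding \<kappa>_def using cont
    by (intro continuous_intros continuous_on_compose2[OF smooth_on_imp_continuous_on[OF smi]]) (auto simp: H_def)
  then have oG: "open G" unfolding G_def using oH U1(1) by (rule continuous_open_preimage)
  define U' where "U' = U1 \<inter> \<Phi> -` G"
  have oU': "open U'" unfolding U'_def
    using continuous_open_preimage[OF continuous_on_subset[OF smooth_on_imp_continuous_on[OF sm\<Phi>] U1(2)] U1(1) oG] .
  have im: "\<Phi> ` U' = G" unfolding U'_def G_def H_def by auto
  have \<Phi>_slice: "\<Phi> (y + t *\<^sub>R n1) = \<phi> y + t *\<^sub>R v" if "y \<in> ?E" for y t
    unfolding \<Phi>_def coords[OF that] by simp
  have U'_U: "y \<in> U" if "y \<in> ?E" "y + t *\<^sub>R n1 \<in> U'" for y t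
  proof -
    have "y + t *\<^sub>R n1 \<in> U0" using that(2) U1(2) unfolding U'_def by blast
    then show ?thesis unfolding U0_def using coords(1)[OF that(1)] by simp
  qed
  have \<phi>S: "\<phi> y \<in> S" if "y \<in> ?E" "y \<in> U" for y
    using imageI[of y "U \<inter> ?E" \<phi>] that unfolding sl by simp
  have \<kappa>: "\<kappa> (\<phi> y + t *\<^sub>R v) = y + t *\<^sub>R n1" if "y \<in> ?E" "y \<in> U" for y t
    unfolding \<kappa>_def \<pi>T[OF \<phi>S[OF that]] using inv_into_f_f[OF inj_\<phi> that(2)] by simp
  have in_U': "y + t *\<^sub>R n1 \<in> U'" if "y \<in> ?E" "y \<in> U" "\<phi> y + t *\<^sub>R v \<in> \<Phi> ` U'" for y t
  proof -
    have G: "\<phi> y + t *\<^sub>R v \<in> G" using that(3) im by simp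
    then have "\<kappa> (\<phi> y + t *\<^sub>R v) \<in> U1" unfolding G_def by simp
    then have "y + t *\<^sub>R n1 \<in> U1" using \<kappa>[OF that(1,2)] by simp
    then show ?thesis using G \<Phi>_slice[OF that(1)] unfolding U'_def by simp
  qed
  have base: "p + \<tau> *\<^sub>R v \<in> \<Phi> ` U'"
  proof -
    have pS: "p \<in> S" using p by blast
    have 1: "\<Phi> ?u0 = p + \<tau> *\<^sub>R v" using \<Phi>_slice x0 by simp
    have "\<kappa> (p + \<tau> *\<^sub>R v) = ?u0" using \<kappa>[of x0 \<tau>] x0 by simp
    moreover have "p + \<tau> *\<^sub>R v \<in> \<Phi> ` U1" using imageI[OF U1(3), of \<Phi>] unfolding 1 .
    ultimately show ?thesis
      unfolding im G_def H_def using \<pi>T[OF pS] \<tau> p U1(3) by simp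
  qed
  have n1E: "n1 \<notin> ?E" using nE(2)[of n1] n by auto
  \<comment> \<open>With \<open>n1\<close> appended to the frame of \<open>\<phi>\<close>, time
    becomes the last coordinate of \<open>slice_par\<close>, which can later be integrated
    separately.\<close>
  let ?e = "e(m := n1)"
  have e_im: "?e ` {..<Suc m} = insert n1 (e ` {..<m})"
    by (auto simp: lessThan_Suc image_iff)
  have inj_e': "inj_on ?e {..<Suc m}"
  proof -
    have "n1 \<notin> e ` {..<m}" by (rule contrapos_nn[OF n1E]) (rule span_base)
    then show ?thesis using inj_e by (auto simp: lessThan_Suc inj_on_def)
  qed
  have chart: "slice_chart (Suc m) ?C ?e U' \<Phi>"
    unfolding slice_chart_def e_im im
  proof (intro conjI)
    show "inj_on ?e {..<Suc m}" by (rule inj_e')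
    show "independent (insert n1 (e ` {..<m}))" using ind_e n1E by (simp add: independent_insert)
    show "open U'" "open G" using oU' oG by auto
    show "smooth_on U' \<Phi>" by (rule smooth_on_subset[OF sm\<Phi>]) (use U1(2) in \<open>auto simp: U'_def\<close>)
    show inj: "inj_on \<Phi> U'" by (rule inj_on_inverseI[of _ \<psi>], rule \<psi>) (simp add: U'_def)
    have "\<psi> q = inv_into U' \<Phi> q" if "q \<in> G" for q
    proof -
      obtain u where u: "u \<in> U'" "q = \<Phi> u" using \<open>q \<in> G\<close> unfolding im[symmetric] by auto
      then have "\<psi> q = u" using \<psi>[of u] unfolding U'_def by simp
      then show ?thesis using inv_into_f_f[OF inj u(1)] u(2) by simp
    qed
    moreover have "smooth_on G \<psi>" by (rule smooth_on_subset[OF U1(5)]) (auto simp: G_def H_def)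
    ultimately show "smooth_on G (inv_into U' \<Phi>)" by (rule smooth_on_cong[OF oG])
    show "\<Phi> ` (U' \<inter> span (insert n1 (e ` {..<m}))) = ?C \<inter> G"
    proof (intro equalityI subsetI)
      fix q assume "q \<in> \<Phi> ` (U' \<inter> span (insert n1 (e ` {..<m})))"
      then obtain u where u: "u \<in> U'" "u \<in> span (insert n1 (e ` {..<m}))" "q = \<Phi> u" by auto
      obtain t where t: "u - t *\<^sub>R n1 \<in> ?E" using u(2) unfolding span_breakdown_eq by auto
      define y where "y = u - t *\<^sub>R n1"
      have y: "y \<in> ?E" "u = y + t *\<^sub>R n1" using t unfolding y_def by simp_all
      have yU: "y \<in> U" using U'_U y u(1) by simp
      have q: "q = \<phi> y + t *\<^sub>R v" using \<Phi>_slice y u(3) by simp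
      have qG: "q \<in> G" using imageI[OF u(1), of \<Phi>] u(3) unfolding im by simp
      then have "T q \<in> {a<..<b'}" unfolding G_def H_def by simp
      then have "t \<in> {a<..<b'}" using \<pi>T(2)[OF \<phi>S[OF y(1) yU]] q by simp
      then show "q \<in> ?C \<inter> G" using q qG \<phi>S[OF y(1) yU] unfolding cylinder_def by auto
    next
      fix q assume q: "q \<in> ?C \<inter> G"
      then obtain x t where x: "q = x + t *\<^sub>R v" "x \<in> S" unfolding cylinder_def by auto
      have "\<pi> q \<in> \<phi> ` U" using q unfolding G_def H_def by simp
      then have "x \<in> S \<inter> \<phi> ` U" using \<pi>T(1) x by simp
      then obtain y where y: "y \<in> U" "y \<in> ?E" "x = \<phi> y" unfolding sl[symmetric] by auto
      have "y + t *\<^sub>R n1 \<in> U'" using in_U'[OF y(2,1)] q x y im by simp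
      moreover have "y + t *\<^sub>R n1 \<in> span (insert n1 (e ` {..<m}))"
        using span_breakdown_eq[of "y + t *\<^sub>R n1" n1 "e ` {..<m}"] y(2) by (auto intro!: exI[of _ t])
      moreover have "q = \<Phi> (y + t *\<^sub>R n1)" using \<Phi>_slice y x by simp
      ultimately show "q \<in> \<Phi> ` (U' \<inter> span (insert n1 (e ` {..<m})))" by simp
    qed
  qed
  have der: "frechet_derivative \<Phi> (at (y + t *\<^sub>R n1)) u = frechet_derivative \<phi> (at y) u"
    if "y \<in> ?E" "y + t *\<^sub>R n1 \<in> U'" "u \<in> ?E" for y t u
  proof -
    have "y + t *\<^sub>R n1 \<in> U0" using that(2) U1(2) unfolding U'_def by blast
    then show ?thesis using D\<Phi> coords(1)[OF that(1)] coords0[OF that(3)] by simp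
  qed
  have der_v: "frechet_derivative \<Phi> (at (y + t *\<^sub>R n1)) n1 = v"
    if "y \<in> ?E" "y + t *\<^sub>R n1 \<in> U'" for y t
  proof -
    have u: "y + t *\<^sub>R n1 \<in> U0" using that(2) U1(2) unfolding U'_def by blast
    have "Pr n1 = 0" "inner n1 n0 = 0" unfolding Pr_def using n by (simp_all add: inner_commute[of n1 n0])
    moreover have "linear (frechet_derivative \<phi> (at y))"
      using slice_chart_derivative(2)[OF ch] U'_U that by blast
    ultimately show ?thesis using D\<Phi>[OF u] coords(1)[OF that(1)] n by (simp add: linear_0)
  qed
  show thesis
    by (rule that[OF chart base \<Phi>_slice U'_U in_U' der der_v])
qed

end

subsection \<open>The volume of the cylinder\<close>

text \<open>The last row has 1 as its only nonzero entry, so one Laplace expansion leaves the block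
  \<open>- M\<close>; the absolute value removes the sign of its determinant.\<close>

lemma abs_det_bordered:
  fixes M :: "real mat"
  assumes "M \<in> carrier_mat m m" "A \<in> carrier_mat (Suc m) (Suc m)"
    and A: "\<And>i j. i < m \<Longrightarrow> j < m \<Longrightarrow> A $$ (i, j) = - M $$ (i, j)"
    and A': "\<And>j. j < m \<Longrightarrow> A $$ (m, j) = 0" "A $$ (m, m) = 1"
  shows "\<bar>Determinant.det A\<bar> = \<bar>Determinant.det M\<bar>"
proof -
  have "Determinant.det A = (\<Sum>j<Suc m. A $$ (m, j) * cofactor A m j)"
    by (rule laplace_expansion_row[OF assms(2)]) simp
  also have "\<dots> = cofactor A m m" using A' by simp
  also have "\<dots> = Determinant.det (mat_delete A m m)" unfolding cofactor_def by simp
  also have "mat_delete A m m = (- 1) \<cdot>\<^sub>m M"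
    using assms by (intro eq_matI) (auto simp: mat_delete_def)
  finally show ?thesis using assms(1) by (simp add: abs_mult power_abs)
qed

lemma bilinear_continuous_on:
  fixes \<beta> :: "'a::euclidean_space \<Rightarrow> 'a \<Rightarrow> real"
  assumes "bilinear \<beta>" "continuous_on A f" "continuous_on A g"
  shows "continuous_on A (\<lambda>x. \<beta> (f x) (g x))"
  using bounded_bilinear.continuous_on[OF assms(1)[unfolded bilinear_conv_bounded_bilinear] assms(2,3)] .

lemma volume_density_continuous_on:
  fixes S :: "'a::euclidean_space set"
  assumes ch: "slice_chart k S e U \<phi>" and \<beta>: "bilinear \<beta>"
  shows "continuous_on U (volume_density (\<lambda>p. \<beta>) k e \<phi>)"
proof -
  let ?M = "\<lambda>y. Matrix.mat k k (\<lambda>(i, j). \<beta> (frechet_derivative \<phi> (at y) (e i)) (frechet_derivative \<phi> (at y) (e j)))"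
  have "smooth_on U \<phi>" using ch unfolding slice_chart_def by blast
  then have D: "continuous_on U (\<lambda>y. frechet_derivative \<phi> (at y) w)" for w
    using smooth_on_imp_continuous_on smooth_on_derivative(2) by blast
  have entry: "continuous_on U (\<lambda>y. ?M y $$ (i, p i))" if "p permutes {0..<k}" "i < k" for p i
  proof -
    have "p i < k" using that permutes_in_image[OF that(1), of i] by simp
    then show ?thesis using that(2) by (simp add: bilinear_continuous_on[OF \<beta> D D])
  qed
  have "continuous_on U (\<lambda>y. \<Sum>p\<in>{p. p permutes {0..<k}}. signof p * (\<Prod>i = 0..<k. ?M y $$ (i, p i)))"
    by (intro continuous_intros entry) auto
  then have "continuous_on U (\<lambda>y. Determinant.det (?M y))"
    by (simp add: det_def'[of _ k])
  then show ?thesis unfolding volume_density_def by (intro continuous_intros)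
qed

lemma chart_integrand_measurable:
  fixes S :: "'a::euclidean_space set"
  assumes ch: "slice_chart k S e U \<phi>" and \<beta>: "bilinear \<beta>" and B: "B \<in> sets borel"
  shows "(\<lambda>z. indicator {z. z \<in> U \<and> \<phi> z \<in> B} z * ennreal (volume_density (\<lambda>p. \<beta>) k e \<phi> z)) \<in> borel_measurable borel"
proof -
  have U: "open U" and \<phi>: "smooth_on U \<phi>" using ch unfolding slice_chart_def by simp_all
  then have Ub: "U \<in> sets borel" by simp
  have "\<phi> \<in> borel_measurable (restrict_space borel U)"
    using smooth_on_imp_continuous_on[OF \<phi>] by (rule borel_measurable_continuous_on_restrict)
  then have "\<phi> -` B \<inter> space (restrict_space borel U) \<in> sets (restrict_space borel U)"
    using B by (rule measurable_sets)
  then have "\<phi> -` B \<inter> U \<in> sets borel" using Ub by (simp add: sets_restrict_space_iff space_restrict_space)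
  moreover have "{z. z \<in> U \<and> \<phi> z \<in> B} = \<phi> -` B \<inter> U" by auto
  ultimately have 1: "{z. z \<in> U \<and> \<phi> z \<in> B} \<in> sets borel" by simp
  \<comment> \<open>The density is continuous on \<open>U\<close> only; cutting it off outside
    \<open>U\<close> makes it Borel on the whole space without changing the integrand.\<close>
  have 2: "(\<lambda>z. indicator U z *\<^sub>R volume_density (\<lambda>p. \<beta>) k e \<phi> z) \<in> borel_measurable borel"
    by (rule borel_measurable_continuous_on_indicator[OF Ub volume_density_continuous_on[OF ch \<beta>]])
  have "(\<lambda>z. indicator {z. z \<in> U \<and> \<phi> z \<in> B} z * ennreal (indicator U z *\<^sub>R volume_density (\<lambda>p. \<beta>) k e \<phi> z))
      \<in> borel_measurable borel"
    using 1 2 by measurable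
  moreover have "(\<lambda>z. indicator {z. z \<in> U \<and> \<phi> z \<in> B} z * ennreal (indicator U z *\<^sub>R volume_density (\<lambda>p. \<beta>) k e \<phi> z))
    = (\<lambda>z. indicator {z. z \<in> U \<and> \<phi> z \<in> B} z * ennreal (volume_density (\<lambda>p. \<beta>) k e \<phi> z))"
    by (rule ext) (simp add: indicator_def)
  ultimately show ?thesis by simp
qed

lemma slice_par_Suc: "slice_par (Suc m) (e(m := n)) (x(m := t)) = slice_par m e x + t *\<^sub>R n"
  unfolding slice_par_def by simp

context oriented_lorentz
begin

text \<open>The Gram matrix of \<open>b\<close> in the cylinder chart is minus that of
  \<open>h\<close> in the chart of \<open>S\<close>, bordered by \<open>b v v = 1\<close> and by
  zeros, because tangent vectors of \<open>S\<close> are \<open>b\<close>-orthogonal to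
  \<open>v\<close>.\<close>

lemma cylinder_density:
  assumes S: "S \<subseteq> R" and ch: "slice_chart m S e U \<phi>" and y: "y \<in> U \<inter> span (e ` {..<m})"
    and D: "\<And>u. u \<in> span (e ` {..<m}) \<Longrightarrow> frechet_derivative \<Phi> (at z) u = frechet_derivative \<phi> (at y) u"
      "frechet_derivative \<Phi> (at z) n = v"
  shows "volume_density (\<lambda>p. b) (Suc m) (e(m := n)) \<Phi> z = volume_density (\<lambda>p. h) m e \<phi> y"
proof -
  have e: "e i \<in> span (e ` {..<m})" if "i < m" for i using that by (intro span_base) auto
  have W: "b v (frechet_derivative \<phi> (at y) (e i)) = 0" if "i < m" for i
    by (rule slice_chart_derivative_tangent[OF ch y e[OF that] bl2, of v "b v p0"]) (use S R_iff in auto)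
  have "\<bar>Determinant.det (Matrix.mat (Suc m) (Suc m) (\<lambda>(i, j). b (frechet_derivative \<Phi> (at z) ((e(m := n)) i))
        (frechet_derivative \<Phi> (at z) ((e(m := n)) j))))\<bar>
    = \<bar>Determinant.det (Matrix.mat m m (\<lambda>(i, j). h (frechet_derivative \<phi> (at y) (e i)) (frechet_derivative \<phi> (at y) (e j))))\<bar>"
  proof (rule abs_det_bordered)
    fix i j assume "i < m" "j < m"
    then show "Matrix.mat (Suc m) (Suc m) (\<lambda>(i, j). b (frechet_derivative \<Phi> (at z) ((e(m := n)) i))
        (frechet_derivative \<Phi> (at z) ((e(m := n)) j))) $$ (i, j)
      = - Matrix.mat m m (\<lambda>(i, j). h (frechet_derivative \<phi> (at y) (e i)) (frechet_derivative \<phi> (at y) (e j))) $$ (i, j)"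
      using D(1)[OF e] by (simp add: h_def)
  qed (use D W e bvv in auto)
  then show ?thesis unfolding volume_density_def by simp
qed

text \<open>Both measures are compared in the charts from \<open>cylinder_chart\<close>: there the
  density does not depend on time, so integrating over time first gives the section formula of the
  product measure.\<close>

lemma cylinder_volume:
  assumes S: "S \<subseteq> R" "S \<in> sets borel"
    and charts: "\<And>p. p \<in> S \<Longrightarrow> \<exists>e U \<phi>. slice_chart m S e U \<phi> \<and> p \<in> \<phi> ` U"
    and \<nu>: "\<And>p. p \<in> S \<Longrightarrow> normal_at S p (\<nu> p)"
    and \<mu>: "volume_measure (\<lambda>p. h) m S \<mu>" "finite_measure \<mu>"
    and \<sigma>: "volume_measure (\<lambda>p. b) (Suc m) (cylinder v {t0<..<t1} S) \<sigma>"
  defines "N \<equiv> restrict_space lborel {t0<..<t1}"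
  shows "(\<lambda>(p, t). p + t *\<^sub>R v) \<in> measurable (\<mu> \<Otimes>\<^sub>M N) \<sigma>"
    and "\<sigma> = distr (\<mu> \<Otimes>\<^sub>M N) \<sigma> (\<lambda>(p, t). p + t *\<^sub>R v)"
proof -
  let ?J = "{t0<..<t1}"
  let ?C = "cylinder v ?J S" and ?f = "\<lambda>(p, t). p + t *\<^sub>R v"
  interpret \<mu>: finite_measure \<mu> by fact
  have "emeasure N (space N) = emeasure lborel ?J"
    unfolding N_def by (simp add: emeasure_restrict_space space_restrict_space)
  then have "finite_measure N" by (intro finite_measureI) (cases "t0 \<le> t1"; simp)
  then interpret N: finite_measure N .
  interpret P: pair_sigma_finite \<mu> N by unfold_locales
  have C: "?C \<in> sets borel" using cylinder_borel S by simp
  have s\<sigma>: "sets \<sigma> = sets (restrict_space borel ?C)" using \<sigma> unfolding volume_measure_def by blast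
  have sp: "space \<mu> = S" "space N = ?J" unfolding N_def using volume_measure_space[OF \<mu>(1)] by (simp_all add: space_restrict_space)
  have [measurable]: "(\<lambda>x. x) \<in> borel_measurable \<mu>" by (rule volume_measure_measurable[OF \<mu>(1)]) simp
  have [measurable]: "(\<lambda>x. x) \<in> borel_measurable N" unfolding N_def by (intro measurable_restrict_space1) simp
  have "?f \<in> measurable (\<mu> \<Otimes>\<^sub>M N) (restrict_space borel ?C)"
  proof (rule measurable_restrict_space2)
    show "?f \<in> space (\<mu> \<Otimes>\<^sub>M N) \<rightarrow> ?C" by (auto simp: space_pair_measure sp cylinder_def intro!: exI)
    have "(\<lambda>x. fst x) \<in> borel_measurable (\<mu> \<Otimes>\<^sub>M N)" "(\<lambda>x. snd x) \<in> borel_measurable (\<mu> \<Otimes>\<^sub>M N)"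
      using measurable_compose[OF measurable_fst, of "\<lambda>x. x" \<mu> borel N] measurable_compose[OF measurable_snd, of "\<lambda>x. x" N borel \<mu>]
      by simp_all
    then show "?f \<in> borel_measurable (\<mu> \<Otimes>\<^sub>M N)" unfolding case_prod_beta by measurable
  qed
  then show meas: "?f \<in> measurable (\<mu> \<Otimes>\<^sub>M N) \<sigma>"
    using measurable_cong_sets[OF refl s\<sigma>] by blast
  show "\<sigma> = distr (\<mu> \<Otimes>\<^sub>M N) \<sigma> ?f"
  proof (rule measure_eqI_open_cover[OF s\<sigma> _ C])
    show "sets (distr (\<mu> \<Otimes>\<^sub>M N) \<sigma> ?f) = sets (restrict_space borel ?C)" using s\<sigma> by simp
    fix q assume "q \<in> ?C"
    then obtain p \<tau> where p: "p \<in> S" "\<tau> \<in> ?J" "q = p + \<tau> *\<^sub>R v" unfolding cylinder_def by auto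
    obtain e U \<phi> where ch: "slice_chart m S e U \<phi>" "p \<in> \<phi> ` U" using charts[OF p(1)] by (elim exE conjE)
    let ?E = "span (e ` {..<m})"
    have pU: "p \<in> S \<inter> \<phi> ` U" using p ch by simp
    obtain n U' \<Phi> where cyl: "slice_chart (Suc m) ?C (e(m := n)) U' \<Phi>" "p + \<tau> *\<^sub>R v \<in> \<Phi> ` U'"
      and \<Phi>: "\<And>y t. y \<in> ?E \<Longrightarrow> \<Phi> (y + t *\<^sub>R n) = \<phi> y + t *\<^sub>R v"
      and U'_U: "\<And>y t. y \<in> ?E \<Longrightarrow> y + t *\<^sub>R n \<in> U' \<Longrightarrow> y \<in> U"
      and in_U': "\<And>y t. y \<in> ?E \<Longrightarrow> y \<in> U \<Longrightarrow> \<phi> y + t *\<^sub>R v \<in> \<Phi> ` U' \<Longrightarrow> y + t *\<^sub>R n \<in> U'"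
      and der: "\<And>y t u. y \<in> ?E \<Longrightarrow> y + t *\<^sub>R n \<in> U' \<Longrightarrow> u \<in> ?E \<Longrightarrow>
        frechet_derivative \<Phi> (at (y + t *\<^sub>R n)) u = frechet_derivative \<phi> (at y) u"
      and der_v: "\<And>y t. y \<in> ?E \<Longrightarrow> y + t *\<^sub>R n \<in> U' \<Longrightarrow> frechet_derivative \<Phi> (at (y + t *\<^sub>R n)) n = v"
      by (rule cylinder_chart[OF S(1) ch(1) pU \<nu>[OF p(1)] p(2)]) (rule that)
    have sl: "\<phi> ` (U \<inter> ?E) = S \<inter> \<phi> ` U" using ch(1) unfolding slice_chart_def by blast
    have sl': "\<Phi> ` (U' \<inter> span ((e(m := n)) ` {..<Suc m})) = ?C \<inter> \<Phi> ` U'" using cyl(1) unfolding slice_chart_def by blast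
    have \<phi>S: "\<phi> y \<in> S" if "y \<in> ?E" "y \<in> U" for y
      using imageI[of y "U \<inter> ?E" \<phi>] that unfolding sl by simp
    have JC: "t \<in> ?J" if "x \<in> S" "x + t *\<^sub>R v \<in> ?C" for x t
    proof -
      have "b v x = b v p0" using subsetD[OF S(1) that(1)] by (simp add: R_iff)
      then have "b v (x + t *\<^sub>R v) - b v p0 = t" using bvv by (simp add: linear_add[OF l2] linear_scale[OF l2])
      then show ?thesis using that(2) cylinder_iff[OF S(1)] by simp
    qed
    \<comment> \<open>Time and base point are determined by a point of the cylinder. Hence the time
      sections of a set inside the cylinder chart lie in the chart of \<open>S\<close>, where
      \<open>\<mu>\<close> can be computed.\<close>
    have base_U: "x \<in> \<phi> ` U" if x: "x \<in> S" "x + t *\<^sub>R v \<in> ?C \<inter> \<Phi> ` U'" for x t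
    proof -
      obtain u where u: "u \<in> U'" "u \<in> span ((e(m := n)) ` {..<Suc m})" "x + t *\<^sub>R v = \<Phi> u"
        using x(2) unfolding sl'[symmetric] by auto
      have "(e(m := n)) ` {..<Suc m} = insert n (e ` {..<m})" by (auto simp: lessThan_Suc image_iff)
      then obtain s where s: "u - s *\<^sub>R n \<in> ?E" using u(2) by (auto simp: span_breakdown_eq)
      define y where "y = u - s *\<^sub>R n"
      have y: "y \<in> ?E" "u = y + s *\<^sub>R n" using s unfolding y_def by simp_all
      have yU: "y \<in> U" using U'_U y u(1) by simp
      have eq: "x + t *\<^sub>R v = \<phi> y + s *\<^sub>R v" using u(3) y \<Phi> by simp
      have "b v x = b v (\<phi> y)" using subsetD[OF S(1) x(1)] subsetD[OF S(1) \<phi>S[OF y(1) yU]] by (simp add: R_iff)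
      with arg_cong[OF eq, of "b v"] have "t = s" using bvv by (simp add: linear_add[OF l2] linear_scale[OF l2])
      then show ?thesis using eq yU by simp
    qed
    have oU': "open (\<Phi> ` U')" using cyl(1) unfolding slice_chart_def by blast
    have "emeasure \<sigma> B = emeasure (distr (\<mu> \<Otimes>\<^sub>M N) \<sigma> ?f) B"
      if B: "B \<in> sets borel" "B \<subseteq> ?C \<inter> \<Phi> ` U'" for B
    proof -
      let ?par = "slice_par m e" and ?par' = "slice_par (Suc m) (e(m := n))"
      let ?L = "\<lambda>k::nat. Pi\<^sub>M {..<k} (\<lambda>_. lborel :: real measure)"
      let ?F = "\<lambda>z. indicator {z. z \<in> U' \<and> \<Phi> z \<in> B} z * ennreal (volume_density (\<lambda>p. b) (Suc m) (e(m := n)) \<Phi> z)"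
      let ?B = "\<lambda>t. {x \<in> S. x + t *\<^sub>R v \<in> B}"
      interpret L: product_sigma_finite "\<lambda>_::nat. lborel :: real measure" by standard
      have Bs: "?B t \<in> sets borel" for t
      proof -
        have "(\<lambda>x. x + t *\<^sub>R v) -` B \<inter> space borel \<in> sets borel"
          using B(1) by (intro measurable_sets[of _ borel borel]) auto
        then have "S \<inter> ((\<lambda>x. x + t *\<^sub>R v) -` B \<inter> space borel) \<in> sets borel" using S(2) by (rule sets.Int[rotated])
        moreover have "S \<inter> ((\<lambda>x. x + t *\<^sub>R v) -` B \<inter> space borel) = ?B t" by auto
        ultimately show ?thesis by simp
      qed
      have BU: "?B t \<subseteq> S \<inter> \<phi> ` U" for t
      proof
        fix x assume "x \<in> ?B t"
        then have x: "x \<in> S" "x + t *\<^sub>R v \<in> ?C \<inter> \<Phi> ` U'" using B(2) by auto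
        then show "x \<in> S \<inter> \<phi> ` U" using base_U[OF x] by simp
      qed
      have "bilinear b" using lor unfolding lorentzian_form_def by blast
      have "?F \<in> borel_measurable borel" by (rule chart_integrand_measurable[OF cyl(1) \<open>bilinear b\<close> B(1)])
      then have "(\<lambda>x. ?F (?par' x)) \<in> borel_measurable (?L (Suc m))"
        using measurable_compose[OF slice_par_measurable] by blast
      then have Fm: "(\<lambda>x. ?F (?par' x)) \<in> borel_measurable (Pi\<^sub>M (insert m {..<m}) (\<lambda>_. lborel))"
        by (simp add: lessThan_Suc)
      \<comment> \<open>The integrand of the cylinder chart splits into the time window and the
        integrand that computes the volume of the section at time \<open>t\<close>.\<close>
      have pointwise: "?F (?par x + t *\<^sub>R n) = indicator ?J t * (indicator {x. ?par x \<in> U \<and> \<phi> (?par x) \<in> ?B t} x *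
          ennreal (volume_density (\<lambda>p. h) m e \<phi> (?par x)))" for x t
      proof (cases "?par x \<in> U \<and> \<phi> (?par x) + t *\<^sub>R v \<in> B")
        case True
        have E: "?par x \<in> ?E" by (rule slice_par_in_span)
        have xS: "\<phi> (?par x) \<in> S" using \<phi>S E True by simp
        have "\<phi> (?par x) + t *\<^sub>R v \<in> ?C" "\<phi> (?par x) + t *\<^sub>R v \<in> \<Phi> ` U'" using True B(2) by auto
        then have t: "t \<in> ?J" and U': "?par x + t *\<^sub>R n \<in> U'"
          using JC[OF xS] in_U'[OF E] True by auto
        have "volume_density (\<lambda>p. b) (Suc m) (e(m := n)) \<Phi> (?par x + t *\<^sub>R n) = volume_density (\<lambda>p. h) m e \<phi> (?par x)"
          by (rule cylinder_density[OF S(1) ch(1)]) (use E True der[OF E U'] der_v[OF E U'] in auto)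
        then show ?thesis using True t U' xS \<Phi>[OF E] by (simp add: indicator_def)
      next
        case False
        have E: "?par x \<in> ?E" by (rule slice_par_in_span)
        have "\<not> (?par x + t *\<^sub>R n \<in> U' \<and> \<Phi> (?par x + t *\<^sub>R n) \<in> B)"
          using False U'_U[OF E] \<Phi>[OF E] by auto
        then show ?thesis using False by (auto simp: indicator_def)
      qed
      have "emeasure \<sigma> B = (\<integral>\<^sup>+x. indicator {x. ?par' x \<in> U' \<and> \<Phi> (?par' x) \<in> B} x *
          ennreal (volume_density (\<lambda>p. b) (Suc m) (e(m := n)) \<Phi> (?par' x)) \<partial>?L (Suc m))"
        using \<sigma> cyl(1) B unfolding volume_measure_def by simp
      also have "\<dots> = (\<integral>\<^sup>+x. ?F (?par' x) \<partial>Pi\<^sub>M (insert m {..<m}) (\<lambda>_. lborel))"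
        unfolding lessThan_Suc by (intro nn_integral_cong) (simp add: indicator_def)
      \<comment> \<open>Tonelli's theorem with the last coordinate, which is time, as the outer
        variable.\<close>
      also have "\<dots> = (\<integral>\<^sup>+t. (\<integral>\<^sup>+x. ?F (?par' (x(m := t))) \<partial>?L m) \<partial>lborel)"
        by (rule L.product_nn_integral_insert_rev[OF _ _ Fm]) auto
      also have "\<dots> = (\<integral>\<^sup>+t. emeasure \<mu> (?B t) * indicator ?J t \<partial>lborel)"
      proof (rule nn_integral_cong)
        fix t :: real
        have "(\<integral>\<^sup>+x. ?F (?par' (x(m := t))) \<partial>?L m) = (\<integral>\<^sup>+x. indicator ?J t * (indicator {x. ?par x \<in> U \<and> \<phi> (?par x) \<in> ?B t} x *
          ennreal (volume_density (\<lambda>p. h) m e \<phi> (?par x))) \<partial>?L m)"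
          unfolding slice_par_Suc pointwise ..
        also have "\<dots> = indicator ?J t * (\<integral>\<^sup>+x. indicator {x. ?par x \<in> U \<and> \<phi> (?par x) \<in> ?B t} x *
          ennreal (volume_density (\<lambda>p. h) m e \<phi> (?par x)) \<partial>?L m)"
        proof (rule nn_integral_cmult)
          have "(\<lambda>x. indicator {z. z \<in> U \<and> \<phi> z \<in> ?B t} (?par x) * ennreal (volume_density (\<lambda>p. h) m e \<phi> (?par x)))
              \<in> borel_measurable (?L m)"
            using measurable_compose[OF slice_par_measurable chart_integrand_measurable[OF ch(1) bilinear_h Bs]] .
          then show "(\<lambda>x. indicator {x. ?par x \<in> U \<and> \<phi> (?par x) \<in> ?B t} x * ennreal (volume_density (\<lambda>p. h) m e \<phi> (?par x)))
              \<in> borel_measurable (?L m)" by (simp add: indicator_def)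
        qed
        also have "\<dots> = emeasure \<mu> (?B t) * indicator ?J t"
          using \<mu>(1) ch(1) Bs[of t] BU[of t] unfolding volume_measure_def by (simp add: mult.commute)
        finally show "(\<integral>\<^sup>+x. ?F (?par' (x(m := t))) \<partial>?L m) = emeasure \<mu> (?B t) * indicator ?J t" .
      qed
      also have "\<dots> = (\<integral>\<^sup>+t. emeasure \<mu> (?B t) \<partial>N)"
        unfolding N_def by (rule nn_integral_restrict_space[symmetric]) simp
      also have "\<dots> = (\<integral>\<^sup>+t. emeasure \<mu> ((\<lambda>x. (x, t)) -` (?f -` B \<inter> space (\<mu> \<Otimes>\<^sub>M N))) \<partial>N)"
        by (intro nn_integral_cong arg_cong[where f = "emeasure \<mu>"]) (auto simp: space_pair_measure sp)
      also have "\<dots> = emeasure (distr (\<mu> \<Otimes>\<^sub>M N) \<sigma> ?f) B"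
      proof -
        have B\<sigma>: "B \<in> sets \<sigma>" using B C by (simp add: s\<sigma> sets_restrict_space_iff)
        show ?thesis
          unfolding emeasure_distr[OF meas B\<sigma>]
          by (rule P.emeasure_pair_measure_alt2[symmetric]) (rule measurable_sets[OF meas B\<sigma>])
      qed
      finally show ?thesis .
    qed
    then show "\<exists>G. open G \<and> q \<in> G \<and> (\<forall>B\<in>sets borel. B \<subseteq> ?C \<inter> G \<longrightarrow> emeasure \<sigma> B = emeasure (distr (\<mu> \<Otimes>\<^sub>M N) \<sigma> ?f) B)"
      using oU' cyl(2) p(3) by (intro exI[of _ "\<Phi> ` U'"]) simp
  qed
qed

end

subsection \<open>The divergence theorem on the domain\<close>

lemma alternating_form_Cons:
  assumes "alternating_form (Suc k) \<omega>"
  shows "alternating_form k (\<lambda>ws. \<omega> (z # ws))"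
  unfolding alternating_form_def
proof (intro allI impI conjI)
  fix ws :: "'a list" and i assume "length ws = k" "i < k"
  then have "length (z # ws) = Suc k" "Suc i < Suc k" by simp_all
  then have "linear (\<lambda>x. \<omega> ((z # ws)[Suc i := x]))"
    using assms unfolding alternating_form_def by (elim allE[of _ "z # ws"]) blast
  then show "linear (\<lambda>x. \<omega> (z # ws[i := x]))" by simp
next
  fix ws :: "'a list" and i j assume a: "length ws = k" "i < j" "j < k" "ws ! i = ws ! j"
  then have "\<not> distinct (z # ws)" using nth_eq_iff_index_eq[of ws i j] by auto
  then show "\<omega> (z # ws) = 0" using alternating_form_eq_0[OF assms, of "z # ws"] a by simp
qed

lemma frechet_derivative_translate:
  assumes "smooth_on UNIV Z"
  shows "frechet_derivative (\<lambda>q. Z (q + c)) (at p) = frechet_derivative Z (at (p + c))"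
proof -
  have "((\<lambda>q. q + c) has_derivative (\<lambda>x. x)) (at p)" by (auto intro!: derivative_eq_intros)
  moreover have "(Z has_derivative frechet_derivative Z (at (p + c))) (at (p + c))"
    using smooth_on_derivative(1)[OF assms] by simp
  ultimately have "((\<lambda>q. Z (q + c)) has_derivative frechet_derivative Z (at (p + c))) (at p)"
    by (rule has_derivative_compose)
  then show ?thesis by (rule frechet_derivative_at[symmetric])
qed

lemma finite_measure_if_integrable_const:
  assumes "integrable M (\<lambda>x. c :: real)" "c \<noteq> 0"
  shows "finite_measure M"
proof (rule finite_measureI)
  have "(\<integral>\<^sup>+x. ennreal (norm c) \<partial>M) < \<infinity>" using assms(1) unfolding integrable_iff_bounded by blast
  then have "ennreal \<bar>c\<bar> * emeasure M (space M) < \<infinity>" by simp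
  then show "emeasure M (space M) \<noteq> \<infinity>" using assms(2) by (auto simp: ennreal_mult_eq_top_iff)
qed

text \<open>The compact \<open>K\<close> contains both the domain and its smooth boundary; it
  supplies the bounds for continuous integrands.\<close>

locale stokes_domain = oriented_lorentz +
  fixes \<Omega> G S K :: "'a set" and \<nu> :: "'a \<Rightarrow> 'a"
  assumes \<Omega>: "\<Omega> = R \<inter> G" "open G"
    and S: "S \<subseteq> R" "S \<in> sets borel"
    and charts: "\<And>p. p \<in> S \<Longrightarrow> \<exists>e U \<phi>. slice_chart m S e U \<phi> \<and> p \<in> \<phi> ` U"
    and \<nu>: "\<And>p. p \<in> S \<Longrightarrow> normal_at S p (\<nu> p)"
    and K: "compact K" "\<Omega> \<subseteq> K" "S \<subseteq> K"
    and stokes: "stokes_applies (\<lambda>p. h) m ori \<Omega> S \<nu>"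
begin

lemma \<Omega>_borel: "\<Omega> \<in> sets borel"
proof -
  have "R = (\<lambda>q. b v q) -` {b v p0} \<inter> space borel" using R_iff by auto
  moreover have "(\<lambda>q. b v q) \<in> borel_measurable borel"
    by (intro borel_measurable_continuous_onI continuous_on_b)
  ultimately have "R \<in> sets borel" by (simp only:) (intro measurable_sets[of _ borel borel]; simp)
  then show ?thesis using \<Omega> by auto
qed

text \<open>Stokes' theorem for the contraction of \<open>ori\<close> with \<open>Z\<close>: both
  form coefficients carry the factor \<open>c0\<close>, which is divided out.\<close>

lemma stokes_flux:
  assumes Z: "smooth_on UNIV Z" and ZW: "\<And>q. Z q \<in> W"
  obtains I \<mu> \<rho> where "volume_measure (\<lambda>p. h) (Suc m) \<Omega> \<mu>" "volume_measure (\<lambda>p. h) m S \<rho>"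
    "has_bochner_integral \<mu> (\<lambda>p. trace_of (frechet_derivative Z (at p))) I"
    "has_bochner_integral \<rho> (\<lambda>p. h (\<nu> p) (Z p)) I"
proof -
  let ?\<eta> = "\<lambda>p ws. ori (Z p # ws)"
  have smooth: "smooth_form m ?\<eta>"
    unfolding smooth_form_def
  proof (intro conjI allI impI)
    show "alternating_form m (?\<eta> p)" for p by (rule alternating_form_Cons[OF ori'])
    fix ws :: "'a list" assume "length ws = m"
    then have "bounded_linear (\<lambda>x. ori (x # ws))" using linear_hyperplane_form linear_conv_bounded_linear by auto
    then show "smooth_on UNIV (\<lambda>p. ?\<eta> p ws)" by (rule smooth_on_bounded_linear[OF _ open_UNIV Z])
  qed
  obtain I where I: "has_form_integral (\<lambda>p. h) (Suc m) \<Omega> (\<lambda>p. ori) (ext_deriv ?\<eta>) I"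
      "has_form_integral (\<lambda>p. h) m S (\<lambda>p fs. ori (\<nu> p # fs)) ?\<eta> I"
    using stokes[unfolded stokes_applies_def, rule_format, OF smooth] by (elim exE conjE)
  obtain \<mu> where \<mu>: "volume_measure (\<lambda>p. h) (Suc m) \<Omega> \<mu>"
      "has_bochner_integral \<mu> (\<lambda>p. form_coefficient h (tangent_space (Suc m) \<Omega> p) ori (ext_deriv ?\<eta> p)) I"
    using I(1) unfolding has_form_integral_def by (elim exE conjE)
  obtain \<rho> where \<rho>: "volume_measure (\<lambda>p. h) m S \<rho>"
      "has_bochner_integral \<rho> (\<lambda>p. form_coefficient h (tangent_space m S p) (\<lambda>fs. ori (\<nu> p # fs)) (?\<eta> p)) I"
    using I(2) unfolding has_form_integral_def by (elim exE conjE)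
  have "has_bochner_integral \<mu> (\<lambda>p. c0 * trace_of (frechet_derivative Z (at p))) I"
  proof (rule iffD1[OF has_bochner_integral_cong[OF refl _ refl] \<mu>(2)])
    fix p assume "p \<in> space \<mu>"
    then have "p \<in> \<Omega>" using volume_measure_space[OF \<mu>(1)] by simp
    show "form_coefficient h (tangent_space (Suc m) \<Omega> p) ori (ext_deriv ?\<eta> p) = c0 * trace_of (frechet_derivative Z (at p))"
      unfolding tangent_space_hyperplane[OF \<Omega> \<open>p \<in> \<Omega>\<close>]
      by (rule interior_coefficient[OF smooth_on_derivative(1)[OF Z] ZW]) simp
  qed
  from has_bochner_integral_mult_right[OF this, of "1 / c0"]
  have 1: "has_bochner_integral \<mu> (\<lambda>p. trace_of (frechet_derivative Z (at p))) (1 / c0 * I)" using c0_pos by simp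
  have "has_bochner_integral \<rho> (\<lambda>p. c0 * h (\<nu> p) (Z p)) I"
  proof (rule iffD1[OF has_bochner_integral_cong[OF refl _ refl] \<rho>(2)])
    fix p assume "p \<in> space \<rho>"
    then have p: "p \<in> S" using volume_measure_space[OF \<rho>(1)] by simp
    obtain e U \<phi> where "slice_chart m S e U \<phi>" "p \<in> \<phi> ` U" using charts[OF p] by (elim exE conjE)
    then show "form_coefficient h (tangent_space m S p) (\<lambda>fs. ori (\<nu> p # fs)) (?\<eta> p) = c0 * h (\<nu> p) (Z p)"
      using p by (intro boundary_coefficient[OF S(1) _ _ \<nu>[OF p] ZW, of e U \<phi>]) auto
  qed
  from has_bochner_integral_mult_right[OF this, of "1 / c0"]
  have 2: "has_bochner_integral \<rho> (\<lambda>p. h (\<nu> p) (Z p)) (1 / c0 * I)" using c0_pos by simp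
  show thesis by (rule that[OF \<mu>(1) \<rho>(1) 1 2])
qed

lemma volume_measure_\<Omega>_unique:
  assumes "volume_measure (\<lambda>p. h) (Suc m) \<Omega> \<mu>" "volume_measure (\<lambda>p. h) (Suc m) \<Omega> \<mu>'"
  shows "\<mu> = \<mu>'"
proof (rule volume_measure_unique[OF assms \<Omega>_borel])
  fix p assume p: "p \<in> \<Omega>"
  have "slice_chart (Suc m) \<Omega> (nth gs) {x. p0 + x \<in> G} (\<lambda>x. p0 + x)"
    using hyperplane_chart[OF \<Omega>, of 0] by (simp add: cylinder_0)
  moreover have "p \<in> (\<lambda>x. p0 + x) ` {x. p0 + x \<in> G}"
    using p \<Omega>(1) by (auto intro!: image_eqI[of _ _ "p - p0"])
  ultimately show "\<exists>e U \<phi>. slice_chart (Suc m) \<Omega> e U \<phi> \<and> p \<in> \<phi> ` U" by blast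
qed

lemma volume_measure_S_unique:
  assumes "volume_measure (\<lambda>p. h) m S \<rho>" "volume_measure (\<lambda>p. h) m S \<rho>'"
  shows "\<rho> = \<rho>'"
  by (rule volume_measure_unique[OF assms S(2) charts])

definition "\<mu> = (THE \<mu>. volume_measure (\<lambda>p. h) (Suc m) \<Omega> \<mu>)"
definition "\<rho> = (THE \<rho>. volume_measure (\<lambda>p. h) m S \<rho>)"

lemma \<mu>: "volume_measure (\<lambda>p. h) (Suc m) \<Omega> \<mu>" and \<rho>: "volume_measure (\<lambda>p. h) m S \<rho>"
proof -
  \<comment> \<open>Existence of both volume measures is read off from Stokes' theorem for the zero
    field.\<close>
  obtain \<mu>' \<rho>' where 1: "volume_measure (\<lambda>p. h) (Suc m) \<Omega> \<mu>'" and 2: "volume_measure (\<lambda>p. h) m S \<rho>'"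
    by (rule stokes_flux[of "\<lambda>p. 0"]) (simp_all add: subspace_W subspace_0 smooth_on_const)
  show "volume_measure (\<lambda>p. h) (Suc m) \<Omega> \<mu>"
    unfolding \<mu>_def by (rule theI[of _ \<mu>']) (use 1 volume_measure_\<Omega>_unique in auto)
  show "volume_measure (\<lambda>p. h) m S \<rho>"
    unfolding \<rho>_def by (rule theI[of _ \<rho>']) (use 2 volume_measure_S_unique in auto)
qed

lemma divergence_theorem:
  assumes Z: "smooth_on UNIV Z" and ZW: "\<And>q. Z q \<in> W"
  shows "integrable \<mu> (\<lambda>p. trace_of (frechet_derivative Z (at p)))"
    and "integrable \<rho> (\<lambda>p. h (\<nu> p) (Z p))"
    and "(\<integral>p. trace_of (frechet_derivative Z (at p)) \<partial>\<mu>) = (\<integral>p. h (\<nu> p) (Z p) \<partial>\<rho>)"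
proof -
  obtain I \<mu>' \<rho>' where *: "volume_measure (\<lambda>p. h) (Suc m) \<Omega> \<mu>'" "volume_measure (\<lambda>p. h) m S \<rho>'"
    and I: "has_bochner_integral \<mu>' (\<lambda>p. trace_of (frechet_derivative Z (at p))) I"
    "has_bochner_integral \<rho>' (\<lambda>p. h (\<nu> p) (Z p)) I"
    by (rule stokes_flux[OF assms])
  have "\<mu>' = \<mu>" "\<rho>' = \<rho>"
    by (rule volume_measure_\<Omega>_unique[OF *(1) \<mu>]) (rule volume_measure_S_unique[OF *(2) \<rho>])
  with I show "integrable \<mu> (\<lambda>p. trace_of (frechet_derivative Z (at p)))"
    and "integrable \<rho> (\<lambda>p. h (\<nu> p) (Z p))"
    and "(\<integral>p. trace_of (frechet_derivative Z (at p)) \<partial>\<mu>) = (\<integral>p. h (\<nu> p) (Z p) \<partial>\<rho>)"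
    by (auto simp: has_bochner_integral_iff)
qed

definition proj :: "'a \<Rightarrow> 'a" where "proj x = x - b v x *\<^sub>R v"

lemma proj_W: "proj x \<in> W"
  unfolding proj_def by (rule minus_component_in_W)

lemma linear_proj: "linear proj"
  unfolding proj_def by (rule linearI) (simp_all add: linear_add[OF l2] linear_scale[OF l2] algebra_simps)

lemma bounded_linear_proj: "bounded_linear proj"
  using linear_proj linear_conv_bounded_linear by blast

text \<open>In the frame of \<open>v\<close> and \<open>gs\<close>, projecting to \<open>W\<close>
  removes the diagonal entry along \<open>v\<close> and keeps the others. For the derivative of
  \<open>Y\<close> the removed entry is the time derivative of its \<open>v\<close>
  component.\<close>

lemma trace_of_proj:
  assumes "linear F"
  shows "trace_of (\<lambda>x. proj (F x)) = trace_of F - b v (F v)"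
proof -
  have bg: "b (gs ! i) v = 0" if "i < length gs" for i
    using G.fs_in[OF that] bsymm[of v] unfolding W_def by simp
  have lin: "linear (\<lambda>x. proj (F x))" using linear_compose[OF assms linear_proj] by (simp add: o_def)
  have "b v (proj (F v)) = 0" using proj_W unfolding W_def by auto
  moreover have "b (gs ! i) (proj x) = b (gs ! i) x" if "i < length gs" for i x
    unfolding proj_def using bg[OF that] by (simp add: linear_diff[OF l2] linear_scale[OF l2])
  ultimately show ?thesis unfolding trace_of_eq[OF lin] trace_of_eq[OF assms] by simp
qed

text \<open>\<open>proj\<close> is the position field of the hyperplane: its divergence is the
  constant \<open>Suc m\<close>, and an integrable nonzero constant forces finite measure.\<close>

lemma finite_\<mu>: "finite_measure \<mu>"
proof -
  have "frechet_derivative proj (at p) = proj" for p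
    by (rule frechet_derivative_at[symmetric]) (rule bounded_linear_imp_has_derivative[OF bounded_linear_proj])
  moreover have "trace_of proj = Suc m"
  proof -
    have "trace_of proj = trace_of (\<lambda>x::'a. x) - 1" using trace_of_proj[OF linear_ident] bvv by simp
    also have "trace_of (\<lambda>x::'a. x) = DIM('a)" unfolding trace_of_def by (simp add: inner_Basis)
    finally show ?thesis using m by simp
  qed
  ultimately have "integrable \<mu> (\<lambda>p. real (Suc m))"
    using divergence_theorem(1)[OF smooth_on_linear[OF linear_proj open_UNIV] proj_W] by simp
  then show ?thesis by (rule finite_measure_if_integrable_const) simp
qed

text \<open>Constant fields along the basis pick out the components of \<open>\<nu>\<close>.
  Integrability includes measurability, which is the source of all measurability statements about
  \<open>\<nu>\<close>.\<close>

lemma normal_component_integrable: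
  assumes "j < length gs"
  shows "integrable \<rho> (\<lambda>p. h (\<nu> p) (gs ! j))"
  using divergence_theorem(2)[of "\<lambda>p. gs ! j"] smooth_on_const G.fs_in[OF assms] by auto

lemma sum_normal_components:
  assumes "p \<in> S"
  shows "(\<Sum>j<length gs. (h (\<nu> p) (gs ! j))\<^sup>2) = 1"
proof -
  have n: "\<nu> p \<in> W" "h (\<nu> p) (\<nu> p) = 1" using \<nu>[OF assms] unfolding normal_at_def by auto
  have "h (\<nu> p) (\<nu> p) = h (\<nu> p) (\<Sum>j<length gs. h (gs ! j) (\<nu> p) *\<^sub>R gs ! j)"
    using arg_cong[OF G.expansion[OF n(1)], of "h (\<nu> p)"] .
  also have "\<dots> = (\<Sum>j<length gs. h (gs ! j) (\<nu> p) * h (\<nu> p) (gs ! j))"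
    by (simp only: linear_sum[OF h_lin2] linear_scale[OF h_lin2] real_scaleR_def)
  also have "\<dots> = (\<Sum>j<length gs. (h (\<nu> p) (gs ! j))\<^sup>2)"
    by (intro sum.cong refl) (simp only: power2_eq_square G.symm[of "\<nu> p"])
  finally show ?thesis using n by simp
qed

lemma abs_normal_component_le:
  assumes "p \<in> S" "j < length gs"
  shows "\<bar>h (\<nu> p) (gs ! j)\<bar> \<le> 1"
proof -
  have "(h (\<nu> p) (gs ! j))\<^sup>2 \<le> (\<Sum>j<length gs. (h (\<nu> p) (gs ! j))\<^sup>2)"
    using assms(2) by (intro member_le_sum) auto
  then show ?thesis unfolding sum_normal_components[OF assms(1)] by (simp add: abs_square_le_1)
qed

text \<open>Each component of the unit vector \<open>\<nu>\<close> has absolute value at most 1, so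
  1, the sum of the squares, is bounded by the integrable sum of absolute values.\<close>

lemma finite_\<rho>: "finite_measure \<rho>"
proof -
  have "integrable \<rho> (\<lambda>p. \<Sum>j<length gs. \<bar>h (\<nu> p) (gs ! j)\<bar>)"
    using normal_component_integrable by (intro Bochner_Integration.integrable_sum integrable_abs) auto
  then have "integrable \<rho> (\<lambda>p. 1 :: real)"
  proof (rule Bochner_Integration.integrable_bound)
    show "AE p in \<rho>. norm (1 :: real) \<le> norm (\<Sum>j<length gs. \<bar>h (\<nu> p) (gs ! j)\<bar>)"
    proof (rule AE_I2)
      fix p assume "p \<in> space \<rho>"
      then have p: "p \<in> S" using volume_measure_space[OF \<rho>] by simp
      have "1 = (\<Sum>j<length gs. (h (\<nu> p) (gs ! j))\<^sup>2)" using sum_normal_components[OF p] by simp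
      also have "\<dots> \<le> (\<Sum>j<length gs. \<bar>h (\<nu> p) (gs ! j)\<bar>)"
      proof (rule sum_mono)
        fix j assume "j \<in> {..<length gs}"
        then have "\<bar>h (\<nu> p) (gs ! j)\<bar> \<le> 1" using abs_normal_component_le[OF p] by simp
        then have "\<bar>h (\<nu> p) (gs ! j)\<bar> * \<bar>h (\<nu> p) (gs ! j)\<bar> \<le> \<bar>h (\<nu> p) (gs ! j)\<bar> * 1"
          by (intro mult_left_mono) auto
        then show "(h (\<nu> p) (gs ! j))\<^sup>2 \<le> \<bar>h (\<nu> p) (gs ! j)\<bar>" by (simp add: power2_eq_square)
      qed
      finally show "norm (1 :: real) \<le> norm (\<Sum>j<length gs. \<bar>h (\<nu> p) (gs ! j)\<bar>)" by simp
    qed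
  qed simp
  then show ?thesis by (rule finite_measure_if_integrable_const) simp
qed

end

subsection \<open>The flux balance\<close>

lemma integral_FTC_restrict_space:
  fixes F f :: "real \<Rightarrow> real"
  assumes "a < c" "\<And>t. (F has_real_derivative f t) (at t)" "continuous_on UNIV f"
  shows "(\<integral>t. f t \<partial>restrict_space lborel {a<..<c}) = F c - F a"
proof -
  have "(\<integral>t. f t \<partial>restrict_space lborel {a<..<c}) = (LBINT t:{a<..<c}. f t)"
    unfolding set_lebesgue_integral_def by (rule integral_restrict_space) simp
  also have "\<dots> = (LBINT t=a..c. f t)" using assms(1) by (simp add: interval_integral_Ioo)
  also have "\<dots> = F c - F a"
  proof (rule interval_integral_FTC_finite)
    show "continuous_on {min a c..max a c} f" using assms(3) continuous_on_subset by blast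
    show "(F has_vector_derivative f x) (at x within {min a c..max a c})" for x
      using assms(2)[of x] has_real_derivative_iff_has_vector_derivative has_vector_derivative_at_within by blast
  qed
  finally show ?thesis .
qed

context stokes_domain
begin

lemma flux_balance:
  assumes Y: "smooth_on UNIV Y" and divY: "\<And>p. trace_of (frechet_derivative Y (at p)) = 0"
    and t: "t0 < t1"
    and \<sigma>0: "volume_measure (\<lambda>p. h) (Suc m) (cylinder v {t0} \<Omega>) \<sigma>0"
    and \<sigma>1: "volume_measure (\<lambda>p. h) (Suc m) (cylinder v {t1} \<Omega>) \<sigma>1"
    and \<sigma>L: "volume_measure (\<lambda>p. b) (Suc m) (cylinder v {t0<..<t1} S) \<sigma>L"
    and normal_ext: "\<And>p t. p \<in> S \<Longrightarrow> t \<in> {t0<..<t1} \<Longrightarrow> \<nu> (p + t *\<^sub>R v) = \<nu> p"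
  shows "integrable \<sigma>1 (\<lambda>q. b v (Y q)) \<and> integrable \<sigma>0 (\<lambda>q. b v (Y q)) \<and> integrable \<sigma>L (\<lambda>q. b (\<nu> q) (Y q)) \<and>
    0 = (\<integral>q. b v (Y q) \<partial>\<sigma>1) - (\<integral>q. b v (Y q) \<partial>\<sigma>0) - (\<integral>q. b (\<nu> q) (Y q) \<partial>\<sigma>L)"
proof -
  let ?J = "{t0<..<t1}"
  define N where "N = restrict_space (lborel :: real measure) ?J"
  let ?f = "\<lambda>(p, t). p + t *\<^sub>R v"
  have "emeasure N (space N) = emeasure lborel ?J"
    unfolding N_def by (simp add: emeasure_restrict_space space_restrict_space)
  then have fN: "finite_measure N" using t by (intro finite_measureI) simp
  interpret N: finite_measure N by (rule fN)
  interpret M: finite_measure \<mu> by (rule finite_\<mu>)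
  interpret R: finite_measure \<rho> by (rule finite_\<rho>)
  interpret MN: pair_sigma_finite \<mu> N by unfold_locales
  interpret RN: pair_sigma_finite \<rho> N by unfold_locales
  interpret MNf: finite_measure "\<mu> \<Otimes>\<^sub>M N" by (rule finite_measure_pair_measure[OF fN finite_\<mu>])
  interpret RNf: finite_measure "\<rho> \<Otimes>\<^sub>M N" by (rule finite_measure_pair_measure[OF fN finite_\<rho>])
  have sp: "space \<mu> = \<Omega>" "space \<rho> = S" "space N = ?J"
    using volume_measure_space[OF \<mu>] volume_measure_space[OF \<rho>] unfolding N_def by (simp_all add: space_restrict_space)
  define d where "d q = b v (frechet_derivative Y (at q) v)" for q
  define Z where "Z q = proj (Y q)" for q
  have Z: "smooth_on UNIV Z" unfolding Z_def by (rule smooth_on_bounded_linear[OF bounded_linear_proj open_UNIV Y])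
  have ZW: "Z q \<in> W" for q unfolding Z_def by (rule proj_W)
  have DY: "(Y has_derivative frechet_derivative Y (at q)) (at q)" for q
    using smooth_on_derivative(1)[OF Y] by simp
  \<comment> \<open>\<open>Z\<close> is \<open>Y\<close> without its \<open>v\<close> component; as
    \<open>Y\<close> is divergence free, the divergence of \<open>Z\<close> is minus the time
    derivative \<open>d\<close> of that component.\<close>
  have traceZ: "trace_of (frechet_derivative Z (at q)) = - d q" for q
  proof -
    have "frechet_derivative Z (at q) = (\<lambda>x. proj (frechet_derivative Y (at q) x))"
      unfolding Z_def
      by (rule frechet_derivative_at[symmetric]) (rule bounded_linear.has_derivative[OF bounded_linear_proj DY])
    then show ?thesis using trace_of_proj[OF has_derivative_linear[OF DY]] divY unfolding d_def by simp
  qed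
  have cY: "continuous_on A Y" for A using smooth_on_imp_continuous_on[OF Y] continuous_on_subset by blast
  have cZ: "continuous_on A Z" for A using smooth_on_imp_continuous_on[OF Z] continuous_on_subset by blast
  have cd: "continuous_on A d" for A
    unfolding d_def
    using continuous_on_subset[OF smooth_on_imp_continuous_on[OF smooth_on_derivative(2)[OF Y]]]
    by (intro linear_continuous_on_compose[OF _ l2]) auto
  have cg: "continuous_on A (\<lambda>q. h (gs ! j) (Z q))" for A j
    by (intro linear_continuous_on_compose[OF cZ h_lin2])
  have ca: "continuous_on A (\<lambda>q. b v (Y q))" for A
    by (intro linear_continuous_on_compose[OF cY l2])
  \<comment> \<open>The compact set swept out by \<open>K\<close> during the whole time interval;
    continuous functions are bounded on it, hence integrable over the finite measures.\<close>
  define K' where "K' = ?f ` (K \<times> {t0..t1})"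
  have cf: "continuous_on A ?f" for A
    by (auto simp: case_prod_beta intro!: continuous_intros)
  have K': "compact K'"
    unfolding K'_def by (rule compact_continuous_image[OF cf]) (intro compact_Times K(1) compact_Icc)
  have inK': "p + s *\<^sub>R v \<in> K'" if "p \<in> K" "s \<in> {t0..t1}" for p s
    unfolding K'_def using that by (intro image_eqI[of _ _ "(p, s)"]) auto
  have bounded: "\<exists>B\<ge>0. \<forall>q\<in>K'. \<bar>F q\<bar> \<le> B" if "continuous_on K' F" for F :: "'a \<Rightarrow> real"
  proof -
    have "bounded (F ` K')" using compact_continuous_image[OF that K'] compact_imp_bounded by blast
    then obtain B where "\<And>x. x \<in> F ` K' \<Longrightarrow> norm x \<le> B" "B > 0" unfolding bounded_pos by auto
    then show ?thesis by (intro exI[of _ B]) auto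
  qed
  have id\<mu>: "(\<lambda>x. x) \<in> borel_measurable \<mu>" and id\<rho>: "(\<lambda>x. x) \<in> borel_measurable \<rho>"
    by (rule volume_measure_measurable[OF \<mu>], simp) (rule volume_measure_measurable[OF \<rho>], simp)
  have idN: "(\<lambda>x. x) \<in> borel_measurable N" unfolding N_def by (intro measurable_restrict_space1) simp
  have meas: "?f \<in> borel_measurable (M \<Otimes>\<^sub>M N)" if "(\<lambda>x. x) \<in> borel_measurable M" for M :: "'a measure"
  proof -
    have "(\<lambda>x. fst x) \<in> borel_measurable (M \<Otimes>\<^sub>M N)" "(\<lambda>x. snd x) \<in> borel_measurable (M \<Otimes>\<^sub>M N)"
      using measurable_compose[OF measurable_fst that, of N] measurable_compose[OF measurable_snd idN, of M]
      by simp_all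
    then show ?thesis unfolding case_prod_beta by measurable
  qed
  have comp: "(\<lambda>x. F (?f x)) \<in> borel_measurable (M \<Otimes>\<^sub>M N)"
    if "(\<lambda>x. x) \<in> borel_measurable M" "continuous_on UNIV F" for M :: "'a measure" and F :: "'a \<Rightarrow> real"
    using measurable_compose[OF meas[OF that(1)] borel_measurable_continuous_onI[OF that(2)]] .

  \<comment> \<open>Top and bottom: integrals over the slices pulled back to the domain\<close>
  have top: "integrable \<sigma> (\<lambda>q. b v (Y q)) \<and> integrable \<mu> (\<lambda>p. b v (Y (p + s *\<^sub>R v)))
      \<and> (\<integral>q. b v (Y q) \<partial>\<sigma>) = (\<integral>p. b v (Y (p + s *\<^sub>R v)) \<partial>\<mu>)"
    if \<sigma>: "volume_measure (\<lambda>p. h) (Suc m) (cylinder v {s} \<Omega>) \<sigma>" and s: "s \<in> {t0..t1}" for s \<sigma>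
  proof -
    note tr = translated_volume[OF \<Omega> \<Omega>_borel \<mu> \<sigma>]
    have m: "(\<lambda>q. b v (Y q)) \<in> borel_measurable \<sigma>"
      by (rule volume_measure_measurable[OF \<sigma>]) (rule borel_measurable_continuous_onI[OF ca])
    obtain B where B: "\<And>q. q \<in> K' \<Longrightarrow> \<bar>b v (Y q)\<bar> \<le> B" using bounded[OF ca] by auto
    have "integrable \<mu> (\<lambda>p. b v (Y (p + s *\<^sub>R v)))"
    proof (rule M.integrable_const_bound[where B = B])
      show "AE p in \<mu>. norm (b v (Y (p + s *\<^sub>R v))) \<le> B"
        using B inK' s K(2) by (intro AE_I2) (auto simp: sp)
      show "(\<lambda>p. b v (Y (p + s *\<^sub>R v))) \<in> borel_measurable \<mu>" by (rule measurable_compose[OF tr(1) m])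
    qed
    moreover have "(\<integral>q. b v (Y q) \<partial>\<sigma>) = (\<integral>p. b v (Y (p + s *\<^sub>R v)) \<partial>\<mu>)"
      by (subst tr(2)) (rule integral_distr[OF tr(1) m])
    moreover have "integrable \<sigma> (\<lambda>q. b v (Y q)) \<longleftrightarrow> integrable \<mu> (\<lambda>p. b v (Y (p + s *\<^sub>R v)))"
      by (subst tr(2)) (rule integrable_distr_eq[OF tr(1) m])
    ultimately show ?thesis by blast
  qed
  note top0 = top[OF \<sigma>0] and top1 = top[OF \<sigma>1]

  \<comment> \<open>Integrability over the products with the time interval\<close>
  have int_d: "integrable (\<mu> \<Otimes>\<^sub>M N) (\<lambda>(p, s). d (p + s *\<^sub>R v))"
  proof -
    obtain B where B: "\<And>q. q \<in> K' \<Longrightarrow> \<bar>d q\<bar> \<le> B" using bounded[OF cd] by auto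
    have "integrable (\<mu> \<Otimes>\<^sub>M N) (\<lambda>x. d (?f x))"
    proof (rule MNf.integrable_const_bound[where B = B])
      show "AE x in \<mu> \<Otimes>\<^sub>M N. norm (d (?f x)) \<le> B"
        using B inK' K(2) by (intro AE_I2) (auto simp: space_pair_measure sp)
    qed (rule comp[OF id\<mu> cd])
    then show ?thesis by (simp add: case_prod_beta')
  qed

  have side_expansion: "b (\<nu> p) (Y q) = - (\<Sum>j<length gs. h (\<nu> p) (gs ! j) * h (gs ! j) (Z q))"
    and side_h: "b (\<nu> p) (Y q) = - h (\<nu> p) (Z q)" if p: "p \<in> S" for p q
  proof -
    have "b (\<nu> p) v = 0" using \<nu>[OF p] bsymm[of v] unfolding normal_at_def W_def by simp
    then show 1: "b (\<nu> p) (Y q) = - h (\<nu> p) (Z q)"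
      unfolding Z_def proj_def h_def by (simp add: linear_diff[OF l2] linear_scale[OF l2])
    have "h (\<nu> p) (Z q) = h (\<nu> p) (\<Sum>j<length gs. h (gs ! j) (Z q) *\<^sub>R gs ! j)"
      using arg_cong[OF G.expansion[OF ZW], of "h (\<nu> p)"] .
    also have "\<dots> = (\<Sum>j<length gs. h (\<nu> p) (gs ! j) * h (gs ! j) (Z q))"
      by (simp only: linear_sum[OF h_lin2] linear_scale[OF h_lin2] real_scaleR_def mult.commute)
    finally show "b (\<nu> p) (Y q) = - (\<Sum>j<length gs. h (\<nu> p) (gs ! j) * h (gs ! j) (Z q))" using 1 by simp
  qed
  \<comment> \<open>Separating variables: \<open>\<nu>\<close> depends on the base point and
    \<open>Z\<close> on the moved point. Written as a finite sum over the basis, the flux density is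
    jointly measurable, since each factor is measurable in its own variable.\<close>
  define s where "s p q = - (\<Sum>j<length gs. h (\<nu> p) (gs ! j) * h (gs ! j) (Z q))" for p q
  have nm: "(\<lambda>p. h (\<nu> p) (gs ! j)) \<in> borel_measurable \<rho>" if "j < length gs" for j
    using normal_component_integrable[OF that] by (rule borel_measurable_integrable)
  have int_s: "integrable (\<rho> \<Otimes>\<^sub>M N) (\<lambda>(p, t). s p (p + t *\<^sub>R v))"
  proof -
    have "integrable (\<rho> \<Otimes>\<^sub>M N) (\<lambda>x. h (\<nu> (fst x)) (gs ! j) * h (gs ! j) (Z (?f x)))" if j: "j < length gs" for j
    proof -
      obtain B where B: "B \<ge> 0" "\<And>q. q \<in> K' \<Longrightarrow> \<bar>h (gs ! j) (Z q)\<bar> \<le> B" using bounded[OF cg[of K' j]] by auto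
      show ?thesis
      proof (rule RNf.integrable_const_bound[where B = B])
        show "AE x in \<rho> \<Otimes>\<^sub>M N. norm (h (\<nu> (fst x)) (gs ! j) * h (gs ! j) (Z (?f x))) \<le> B"
        proof (rule AE_I2)
          fix x assume "x \<in> space (\<rho> \<Otimes>\<^sub>M N)"
          then have x: "fst x \<in> S" "snd x \<in> ?J" by (auto simp: space_pair_measure sp)
          then have "?f x \<in> K'" using inK'[of "fst x" "snd x"] K(3) by (auto simp: case_prod_beta)
          then have "\<bar>h (\<nu> (fst x)) (gs ! j)\<bar> * \<bar>h (gs ! j) (Z (?f x))\<bar> \<le> 1 * B"
            using abs_normal_component_le[OF x(1) j] B by (intro mult_mono) auto
          then show "norm (h (\<nu> (fst x)) (gs ! j) * h (gs ! j) (Z (?f x))) \<le> B" by (simp add: abs_mult)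
        qed
        have "(\<lambda>x. h (\<nu> (fst x)) (gs ! j)) \<in> borel_measurable (\<rho> \<Otimes>\<^sub>M N)"
          by (rule measurable_compose[OF measurable_fst nm[OF j]])
        then show "(\<lambda>x. h (\<nu> (fst x)) (gs ! j) * h (gs ! j) (Z (?f x))) \<in> borel_measurable (\<rho> \<Otimes>\<^sub>M N)"
          by (intro borel_measurable_times comp[OF id\<rho> cg])
      qed
    qed
    then have "integrable (\<rho> \<Otimes>\<^sub>M N) (\<lambda>x. - (\<Sum>j<length gs. h (\<nu> (fst x)) (gs ! j) * h (gs ! j) (Z (?f x))))"
      by (intro Bochner_Integration.integrable_minus Bochner_Integration.integrable_sum) auto
    then show ?thesis unfolding s_def by (simp add: case_prod_beta')
  qed

  \<comment> \<open>Lateral boundary: its integral as one over the product of \<open>S\<close> with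
    time\<close>
  have lateral: "integrable \<sigma>L (\<lambda>q. b (\<nu> q) (Y q)) \<and>
      (\<integral>q. b (\<nu> q) (Y q) \<partial>\<sigma>L) = (\<integral>x. (case x of (p, t) \<Rightarrow> s p (p + t *\<^sub>R v)) \<partial>(\<rho> \<Otimes>\<^sub>M N))"
  proof -
    let ?C = "cylinder v ?J S"
    let ?\<pi> = "\<lambda>q. q - (b v q - b v p0) *\<^sub>R v"
    have cyl: "?f \<in> measurable (\<rho> \<Otimes>\<^sub>M N) \<sigma>L" "\<sigma>L = distr (\<rho> \<Otimes>\<^sub>M N) \<sigma>L ?f"
      unfolding N_def
      by (rule cylinder_volume(1)[OF S charts \<nu> \<rho> finite_\<rho> \<sigma>L]; assumption)
         (rule cylinder_volume(2)[OF S charts \<nu> \<rho> finite_\<rho> \<sigma>L]; assumption)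
    have spL: "space \<sigma>L = ?C" by (rule volume_measure_space[OF \<sigma>L])
    have s\<sigma>: "sets \<sigma>L = sets (restrict_space borel ?C)" "sets \<rho> = sets (restrict_space borel S)"
      using \<sigma>L \<rho> unfolding volume_measure_def by blast+
    have "?\<pi> \<in> measurable (restrict_space borel ?C) (restrict_space borel S)"
    proof (rule measurable_restrict_space2)
      show "?\<pi> \<in> space (restrict_space borel ?C) \<rightarrow> S" using cylinder_iff[OF S(1)] by (auto simp: space_restrict_space)
      show "?\<pi> \<in> borel_measurable (restrict_space borel ?C)"
        by (intro measurable_restrict_space1 borel_measurable_continuous_onI continuous_on_proj)
    qed
    then have \<pi>: "?\<pi> \<in> measurable \<sigma>L \<rho>" using measurable_cong_sets[OF s\<sigma>] by simp
    \<comment> \<open>The normal does not change along \<open>v\<close>, so at a point of the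
      cylinder it may be evaluated at the projection to \<open>S\<close>.\<close>
    have eq: "b (\<nu> q) (Y q) = s (?\<pi> q) q" if "q \<in> ?C" for q
    proof -
      have q: "?\<pi> q \<in> S" "b v q - b v p0 \<in> ?J" using that cylinder_iff[OF S(1)] by auto
      have "\<nu> q = \<nu> (?\<pi> q)" using normal_ext[OF q] by simp
      then show ?thesis using side_expansion[OF q(1), of q] unfolding s_def by simp
    qed
    have sm: "(\<lambda>q. s (?\<pi> q) q) \<in> borel_measurable \<sigma>L"
      unfolding s_def
    proof (intro borel_measurable_uminus borel_measurable_sum borel_measurable_times)
      fix j assume "j \<in> {..<length gs}"
      then show "(\<lambda>q. h (\<nu> (?\<pi> q)) (gs ! j)) \<in> borel_measurable \<sigma>L" using measurable_compose[OF \<pi> nm] by simp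
      show "(\<lambda>q. h (gs ! j) (Z q)) \<in> borel_measurable \<sigma>L"
        by (rule volume_measure_measurable[OF \<sigma>L]) (rule borel_measurable_continuous_onI[OF cg])
    qed
    have cong: "integrable \<sigma>L (\<lambda>q. b (\<nu> q) (Y q)) \<longleftrightarrow> integrable \<sigma>L (\<lambda>q. s (?\<pi> q) q)"
      "(\<integral>q. b (\<nu> q) (Y q) \<partial>\<sigma>L) = (\<integral>q. s (?\<pi> q) q \<partial>\<sigma>L)"
      by (rule Bochner_Integration.integrable_cong[OF refl], use eq spL in simp)
         (rule Bochner_Integration.integral_cong[OF refl], use eq spL in simp)
    have pull: "s (?\<pi> (?f x)) (?f x) = (case x of (p, t) \<Rightarrow> s p (p + t *\<^sub>R v))" if x: "x \<in> space (\<rho> \<Otimes>\<^sub>M N)" for x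
    proof -
      obtain p t where pt: "x = (p, t)" "p \<in> S" using x by (cases x) (auto simp: space_pair_measure sp)
      have "b v p = b v p0" using subsetD[OF S(1) pt(2)] by (simp add: R_iff)
      then have "b v (p + t *\<^sub>R v) - b v p0 = t" using bvv by (simp add: linear_add[OF l2] linear_scale[OF l2])
      then show ?thesis unfolding pt(1) by (simp only: prod.case add_diff_cancel)
    qed
    have "integrable \<sigma>L (\<lambda>q. s (?\<pi> q) q) \<longleftrightarrow> integrable (\<rho> \<Otimes>\<^sub>M N) (\<lambda>x. s (?\<pi> (?f x)) (?f x))"
      by (subst cyl(2)) (rule integrable_distr_eq[OF cyl(1) sm])
    also have "\<dots> \<longleftrightarrow> integrable (\<rho> \<Otimes>\<^sub>M N) (\<lambda>(p, t). s p (p + t *\<^sub>R v))"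
      by (rule Bochner_Integration.integrable_cong[OF refl pull])
    finally have "integrable \<sigma>L (\<lambda>q. b (\<nu> q) (Y q))" using int_s cong(1) by simp
    moreover have "(\<integral>q. s (?\<pi> q) q \<partial>\<sigma>L) = (\<integral>x. s (?\<pi> (?f x)) (?f x) \<partial>(\<rho> \<Otimes>\<^sub>M N))"
      by (subst cyl(2)) (rule integral_distr[OF cyl(1) sm])
    moreover have "\<dots> = (\<integral>x. (case x of (p, t) \<Rightarrow> s p (p + t *\<^sub>R v)) \<partial>(\<rho> \<Otimes>\<^sub>M N))"
      by (rule Bochner_Integration.integral_cong[OF refl pull])
    ultimately show ?thesis using cong(2) by simp
  qed

  \<comment> \<open>Divergence theorem at a fixed time and fundamental theorem of calculus in
    time\<close>
  have slice: "(\<integral>p. d (p + t *\<^sub>R v) \<partial>\<mu>) = (\<integral>p. s p (p + t *\<^sub>R v) \<partial>\<rho>)" for t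
  proof -
    have sZ: "smooth_on UNIV (\<lambda>q. Z (q + t *\<^sub>R v))"
      by (rule smooth_on_compose[OF open_UNIV _ Z]) (auto intro!: smooth_on_add smooth_on_ident smooth_on_const)
    have "(\<integral>p. trace_of (frechet_derivative (\<lambda>q. Z (q + t *\<^sub>R v)) (at p)) \<partial>\<mu>) = (\<integral>p. h (\<nu> p) (Z (p + t *\<^sub>R v)) \<partial>\<rho>)"
      by (rule divergence_theorem(3)[OF sZ ZW])
    then have "- (\<integral>p. d (p + t *\<^sub>R v) \<partial>\<mu>) = (\<integral>p. h (\<nu> p) (Z (p + t *\<^sub>R v)) \<partial>\<rho>)"
      unfolding frechet_derivative_translate[OF Z] traceZ by simp
    also have "\<dots> = (\<integral>p. - s p (p + t *\<^sub>R v) \<partial>\<rho>)"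
    proof (rule Bochner_Integration.integral_cong[OF refl])
      fix p assume "p \<in> space \<rho>"
      then have "p \<in> S" by (simp add: sp)
      then show "h (\<nu> p) (Z (p + t *\<^sub>R v)) = - s p (p + t *\<^sub>R v)"
        using side_expansion[of p "p + t *\<^sub>R v"] side_h[of p "p + t *\<^sub>R v"] unfolding s_def by simp
    qed
    finally show ?thesis by simp
  qed

  have ftc: "b v (Y (p + t1 *\<^sub>R v)) - b v (Y (p + t0 *\<^sub>R v)) = (\<integral>t. d (p + t *\<^sub>R v) \<partial>N)" for p
    unfolding N_def
  proof (rule integral_FTC_restrict_space[symmetric, OF t])
    fix t
    have "((\<lambda>t. p + t *\<^sub>R v) has_derivative (\<lambda>x. x *\<^sub>R v)) (at t)" by (auto intro!: derivative_eq_intros)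
    from has_derivative_compose[OF this DY]
    have "((\<lambda>t. Y (p + t *\<^sub>R v)) has_derivative (\<lambda>x. frechet_derivative Y (at (p + t *\<^sub>R v)) (x *\<^sub>R v))) (at t)" .
    from bounded_linear.has_derivative[OF bl2 this, of v]
    have "((\<lambda>t. b v (Y (p + t *\<^sub>R v))) has_derivative (\<lambda>x. b v (frechet_derivative Y (at (p + t *\<^sub>R v)) (x *\<^sub>R v)))) (at t)" .
    moreover have "(\<lambda>x. b v (frechet_derivative Y (at (p + t *\<^sub>R v)) (x *\<^sub>R v))) = (*) (d (p + t *\<^sub>R v))"
      unfolding d_def
      by (rule ext) (simp add: linear_scale[OF has_derivative_linear[OF DY]] linear_scale[OF l2])
    ultimately show "((\<lambda>t. b v (Y (p + t *\<^sub>R v))) has_real_derivative d (p + t *\<^sub>R v)) (at t)"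
      unfolding has_field_derivative_def by simp
  next
    show "continuous_on UNIV (\<lambda>t. d (p + t *\<^sub>R v))"
      by (rule continuous_on_compose2[OF cd[of UNIV]]) (auto intro!: continuous_intros)
  qed

  \<comment> \<open>Two exchanges of integration: over the domain and time, so that Stokes' theorem
    applies for each time, and then back from the iterated integral to the product of
    \<open>S\<close> with time.\<close>
  have "(\<integral>q. b v (Y q) \<partial>\<sigma>1) - (\<integral>q. b v (Y q) \<partial>\<sigma>0) = (\<integral>p. b v (Y (p + t1 *\<^sub>R v)) - b v (Y (p + t0 *\<^sub>R v)) \<partial>\<mu>)"
    using top0 top1 t by (simp add: Bochner_Integration.integral_diff)
  also have "\<dots> = (\<integral>p. (\<integral>t. d (p + t *\<^sub>R v) \<partial>N) \<partial>\<mu>)" unfolding ftc ..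
  also have "\<dots> = (\<integral>t. (\<integral>p. d (p + t *\<^sub>R v) \<partial>\<mu>) \<partial>N)"
    by (rule MN.Fubini_integral[symmetric]) (rule int_d)
  also have "\<dots> = (\<integral>t. (\<integral>p. s p (p + t *\<^sub>R v) \<partial>\<rho>) \<partial>N)" unfolding slice ..
  also have "\<dots> = (\<integral>x. (case x of (p, t) \<Rightarrow> s p (p + t *\<^sub>R v)) \<partial>(\<rho> \<Otimes>\<^sub>M N))"
    by (rule RN.integral_snd) (rule int_s)
  finally show ?thesis using top0 top1 t lateral by simp
qed

end

subsection \<open>The conservation law\<close>

text \<open>Testing with constant fields is enough: the derivative of the constant function
  \<open>b x y\<close> vanishes, and the bracket of \<open>\<xi>\<close> with the constant field
  \<open>x\<close> is minus the derivative of \<open>\<xi>\<close> in direction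
  \<open>x\<close>.\<close>

lemma antisymmetric_from_lie_derivative:
  fixes \<xi> :: "'a::euclidean_space \<Rightarrow> 'a"
  assumes b: "bilinear b" and "\<And>Y Z p. smooth_on UNIV Y \<Longrightarrow> smooth_on UNIV Z \<Longrightarrow> lie_derivative \<xi> (\<lambda>p. b) Y Z p = 0"
  shows "b (frechet_derivative \<xi> (at p) x) y + b x (frechet_derivative \<xi> (at p) y) = 0"
proof -
  have l: "linear (\<lambda>x. b x y)" "linear (\<lambda>x. b y x)" for y using b unfolding bilinear_def by auto
  have "lie_derivative \<xi> (\<lambda>p. b) (\<lambda>q. x) (\<lambda>q. y) p = 0"
    by (rule assms(2)) (simp_all add: smooth_on_const)
  then show ?thesis
    unfolding lie_derivative_def lie_bracket_def frechet_derivative_at[OF has_derivative_const, symmetric]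
    using linear_neg[OF l(1)] linear_neg[OF l(2)] by simp
qed

lemma smooth_on_along_const:
  fixes F :: "'a::euclidean_space \<times> 'a \<Rightarrow> 'b::real_normed_vector"
  assumes "smooth_on (UNIV \<times> A) F" "v \<in> A"
  shows "smooth_on UNIV (along F (\<lambda>p. v))"
  unfolding along_def
proof (rule smooth_on_compose[OF open_UNIV _ assms(1)])
  show "range (\<lambda>p::'a. (p, v)) \<subseteq> UNIV \<times> A" using assms(2) by auto
  have "smooth_on UNIV (\<lambda>p::'a. (p, 0::'a) + (0, v))"
    by (intro smooth_on_add smooth_on_const smooth_on_linear) (auto intro!: linearI)
  then show "smooth_on UNIV (\<lambda>p::'a. (p, v))" by simp
qed

theorem corollary5p13:
  fixes A :: "'a::euclidean_space set" and L :: "'a \<Rightarrow> real"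
    and v p0 :: 'a and V :: "'a \<Rightarrow> 'a"
    and g h :: "'a \<Rightarrow> 'a \<Rightarrow> 'a \<Rightarrow> real"
    and W R D \<Omega> S :: "'a set" and \<nu> :: "'a \<Rightarrow> 'a"
    and ori :: "'a list \<Rightarrow> real" and t0 t1 :: real
    and T :: "'a \<times> 'a \<Rightarrow> ('a \<Rightarrow>\<^sub>L 'a)" and X :: "'a \<times> 'a \<Rightarrow> 'a"
    and \<sigma>0 \<sigma>1 \<sigma>L :: "'a measure"
  assumes dim: "DIM('a) \<ge> 2"
    and L: "lorentz_norm A L"
    and v: "v \<in> A" "L v = 1"
    and V: "V = (\<lambda>p. v)"
    and g: "g = metric_along L V"
    and h: "h = (\<lambda>p u w. - g p u w)"
    and W: "W = {w. fund_tensor L v v w = 0}"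
    and R: "R = {p0 + w | w. w \<in> W}"
    and ori: "alternating_form (DIM('a) - 1) ori"
      "\<exists>ws. length ws = DIM('a) - 1 \<and> set ws \<subseteq> W \<and> ori ws \<noteq> 0"
    and D: "is_domain R D" "compact D"
    and \<Omega>: "\<Omega> = (top_of_set R) interior_of D"
    and S: "S = smooth_part (DIM('a) - 2) ((top_of_set R) frontier_of \<Omega>)"
    and null: "null_dim_measure R (DIM('a) - 2) ((top_of_set R) frontier_of \<Omega> - S)"
    and normal: "\<And>p. p \<in> S \<Longrightarrow> outward_unit_normal h W D (DIM('a) - 2) S p (\<nu> p)"
    and normal_ext: "\<And>p t. p \<in> S \<Longrightarrow> t \<in> {t0<..<t1} \<Longrightarrow> \<nu> (p + t *\<^sub>R v) = \<nu> p"
    and stokes: "stokes_applies h (DIM('a) - 2) ori \<Omega> S \<nu>"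
    and t: "t0 < t1"
    and T: "smooth_on (UNIV \<times> A) T"
    and X: "smooth_on (UNIV \<times> A) X"
    and div: "\<And>p w. div_tensor (along T V) p w = 0"
    and TX: "(\<forall>p y w. flat_along L T V p y (nabla_along X V p w)
                        = - flat_along L T V p w (nabla_along X V p y)) \<or>
             (\<forall>p y w. flat_along L T V p y w = flat_along L T V p w y) \<and>
             (\<forall>Y Z p. smooth_on UNIV Y \<longrightarrow> smooth_on UNIV Z \<longrightarrow>
                        lie_derivative (along X V) g Y Z p = 0)"
    and \<sigma>0: "volume_measure h (DIM('a) - 1) (cylinder v {t0} \<Omega>) \<sigma>0"
    and \<sigma>1: "volume_measure h (DIM('a) - 1) (cylinder v {t1} \<Omega>) \<sigma>1"
    and \<sigma>L: "volume_measure g (DIM('a) - 1) (cylinder v {t0<..<t1} S) \<sigma>L"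
  shows "integrable \<sigma>1 (\<lambda>q. flat_along L T V q (V q) (along X V q)) \<and>
         integrable \<sigma>0 (\<lambda>q. flat_along L T V q (V q) (along X V q)) \<and>
         integrable \<sigma>L (\<lambda>q. flat_along L T V q (\<nu> q) (along X V q)) \<and>
         0 = (\<integral>q. flat_along L T V q (V q) (along X V q) \<partial>\<sigma>1)
             - (\<integral>q. flat_along L T V q (V q) (along X V q) \<partial>\<sigma>0)
             - (\<integral>q. flat_along L T V q (\<nu> q) (along X V q) \<partial>\<sigma>L)"
proof -
  let ?b = "fund_tensor L v"
  let ?m = "DIM('a) - 2"
  have lor: "lorentzian_form ?b" using L v(1) unfolding lorentz_norm_def by blast
  have bvv: "?b v v = 1" using fund_tensor_self[OF L v(1)] v(2) by simp
  interpret I: lorentz_split ?b v using lor bvv by unfold_locales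
  obtain gs where gs: "orthonormal_basis I.h I.W gs"
    using orthonormal_basis_exists[OF I.pos_def_h] by (elim exE)
  have m: "DIM('a) = Suc (Suc ?m)" "DIM('a) - 1 = Suc ?m" using dim by auto
  have W_eq: "W = I.W" unfolding W I.W_def ..
  have h_eq: "h = (\<lambda>p. I.h)" unfolding h g metric_along_def V I.h_def ..
  have g_eq: "g = (\<lambda>p. ?b)" unfolding g metric_along_def V ..
  interpret O: oriented_lorentz ?b v gs ori ?m p0
    by unfold_locales (use gs ori m W_eq in auto)
  have R_eq: "R = O.R" unfolding R O.R_def W_eq ..
  let ?F = "(top_of_set R) frontier_of \<Omega>"
  \<comment> \<open>Closedness of \<open>R\<close> turns the relatively closed frontier into a
    closed set, so that its smooth part is Borel.\<close>
  have "R = (\<lambda>q. ?b v q) -` {?b v p0}" unfolding R_eq using O.R_iff by auto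
  moreover have "closed ((\<lambda>q. ?b v q) -` {?b v p0})"
    using I.bl2 linear_continuous_on by (intro closed_vimage) auto
  ultimately have closedR: "closed R" by simp
  obtain G where G: "open G" "\<Omega> = R \<inter> G"
    using openin_interior_of[of "top_of_set R" D] unfolding \<Omega>[symmetric] openin_open by auto
  have "\<Omega> \<subseteq> D" unfolding \<Omega> by (rule interior_of_subset)
  have "closedin (top_of_set R) D"
    using D(1) unfolding is_domain_def by (metis closedin_closure_of)
  \<comment> \<open>The frontier lies in the closure of \<open>\<Omega>\<close>, which stays inside
    the relatively closed \<open>D\<close>; hence \<open>D\<close> can serve as the compact set
    \<open>K\<close>.\<close>
  have FD: "?F \<subseteq> D"
    using closure_of_minimal[OF \<open>\<Omega> \<subseteq> D\<close> \<open>closedin (top_of_set R) D\<close>] unfolding frontier_of_def by auto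
  have "closedin (top_of_set R) ?F" by (rule closedin_frontier_of)
  then have "closed ?F" using closedR closedin_closed_trans by blast
  have SF: "S \<subseteq> ?F" unfolding S smooth_part_def by auto
  have "?F \<subseteq> R" using frontier_of_subset_topspace[of "top_of_set R" \<Omega>] by simp
  interpret B: stokes_domain ?b v gs ori ?m p0 \<Omega> G S D \<nu>
  proof unfold_locales
    show "\<Omega> = O.R \<inter> G" "open G" using G R_eq by auto
    show "S \<subseteq> O.R" using SF \<open>?F \<subseteq> R\<close> R_eq by auto
    show "S \<in> sets borel" unfolding S by (rule smooth_part_borel[OF \<open>closed ?F\<close>])
    show "\<exists>e U \<phi>. slice_chart ?m S e U \<phi> \<and> p \<in> \<phi> ` U" if "p \<in> S" for p
      using smooth_part_chart[of p ?m ?F] that unfolding S by simp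
    show "O.normal_at S p (\<nu> p)" if "p \<in> S" for p
      using normal[OF that] unfolding outward_unit_normal_def O.normal_at_def h_eq W_eq by simp
    show "compact D" by (rule D(2))
    show "\<Omega> \<subseteq> D" "S \<subseteq> D" using \<open>\<Omega> \<subseteq> D\<close> FD SF by auto
    show "stokes_applies (\<lambda>p. I.h) ?m ori \<Omega> S \<nu>" using stokes unfolding h_eq .
  qed
  define \<tau> where "\<tau> = along T V"
  define \<xi> where "\<xi> = along X V"
  define Y where "Y p = blinfun_apply (\<tau> p) (\<xi> p)" for p
  have s\<tau>: "smooth_on UNIV \<tau>" unfolding \<tau>_def V by (rule smooth_on_along_const[OF T v(1)])
  have s\<xi>: "smooth_on UNIV \<xi>" unfolding \<xi>_def V by (rule smooth_on_along_const[OF X v(1)])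
  have sY: "smooth_on UNIV Y"
    unfolding Y_def by (rule bounded_bilinear.smooth_on_prod[OF bounded_bilinear_blinfun_apply open_UNIV s\<tau> s\<xi>])
  have flat: "flat_along L T V p y w = ?b y (blinfun_apply (\<tau> p) w)" for p y w
    unfolding flat_along_def metric_along_def \<tau>_def V ..
  have D\<xi>: "(\<xi> has_derivative frechet_derivative \<xi> (at p)) (at p)" for p
    using smooth_on_derivative(1)[OF s\<xi>] by simp
  \<comment> \<open>Both alternatives on \<open>T\<close> and \<open>X\<close> come down to this
    trace: in the first the composition is antisymmetric for \<open>g\<close>, in the second
    \<open>T\<close> is symmetric and the Killing condition makes the derivative of \<open>X\<close>
    antisymmetric.\<close>
  have "trace_of (\<lambda>x. blinfun_apply (\<tau> p) (frechet_derivative \<xi> (at p) x)) = 0" for p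
  proof -
    have lin\<tau>: "linear (blinfun_apply (\<tau> p))" using blinfun.bounded_linear_right bounded_linear.linear by blast
    have lin\<xi>: "linear (frechet_derivative \<xi> (at p))" using D\<xi> has_derivative_linear by blast
    from TX show ?thesis
    proof
      assume a: "\<forall>p y w. flat_along L T V p y (nabla_along X V p w) = - flat_along L T V p w (nabla_along X V p y)"
      show ?thesis
      proof (rule O.trace_of_antisymmetric)
        show "linear (\<lambda>x. blinfun_apply (\<tau> p) (frechet_derivative \<xi> (at p) x))"
          using linear_compose[OF lin\<xi> lin\<tau>] by (simp add: o_def)
        show "?b x (blinfun_apply (\<tau> p) (frechet_derivative \<xi> (at p) y)) = - ?b y (blinfun_apply (\<tau> p) (frechet_derivative \<xi> (at p) x))" for x y
          using a[rule_format, of p x y] unfolding flat nabla_along_def \<xi>_def .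
      qed
    next
      assume a: "(\<forall>p y w. flat_along L T V p y w = flat_along L T V p w y) \<and>
             (\<forall>Y Z p. smooth_on UNIV Y \<longrightarrow> smooth_on UNIV Z \<longrightarrow> lie_derivative (along X V) g Y Z p = 0)"
      show ?thesis
      proof (rule O.trace_of_symmetric_antisymmetric[OF lin\<tau> _ lin\<xi>])
        show "?b x (blinfun_apply (\<tau> p) y) = ?b y (blinfun_apply (\<tau> p) x)" for x y
          using conjunct1[OF a, rule_format, of p x y] unfolding flat .
        show "?b (frechet_derivative \<xi> (at p) x) y + ?b x (frechet_derivative \<xi> (at p) y) = 0" for x y
        proof (rule antisymmetric_from_lie_derivative)
          show "bilinear ?b" using lor unfolding lorentzian_form_def by blast
          show "lie_derivative \<xi> (\<lambda>p. ?b) Y Z p = 0" if "smooth_on UNIV Y" "smooth_on UNIV Z" for Y Z p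
            using conjunct2[OF a, rule_format, OF that] unfolding g_eq \<xi>_def .
        qed
      qed
    qed
  qed
  then have divY: "trace_of (frechet_derivative Y (at p)) = 0" for p
  proof -
    have "(\<tau> has_derivative frechet_derivative \<tau> (at p)) (at p)" "(Y has_derivative frechet_derivative Y (at p)) (at p)"
      using smooth_on_derivative(1)[OF s\<tau>] smooth_on_derivative(1)[OF sY] by simp_all
    from trace_of_derivative_apply[OF this(1) D\<xi> this(2)[unfolded Y_def]]
    show ?thesis using div unfolding Y_def[symmetric] \<tau>_def[symmetric]
      using \<open>\<And>p. trace_of (\<lambda>x. blinfun_apply (\<tau> p) (frechet_derivative \<xi> (at p) x)) = 0\<close> by simp
  qed
  have flux: "flat_along L T V q y (along X V q) = ?b y (Y q)" for q y
    unfolding flat Y_def \<xi>_def ..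
  have Vq: "V q = v" for q unfolding V ..
  show ?thesis
    unfolding flux unfolding Vq
    by (rule B.flux_balance[OF sY divY t])
       (use \<sigma>0 \<sigma>1 \<sigma>L normal_ext m(2) in \<open>simp_all add: h_eq g_eq\<close>)
qed

end
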